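(* Let $W$ be a Coxeter group with simple reflections indexed by $I$, and let $K\subset I$. Then the poset $(Q_K,\preceq)$ is thin and EL-shellable.
   Context: Let $\le$ be the Bruhat order on $W$, $W_K$ the subgroup generated by the simple reflections in $K$, and $W^K$ the set of minimal length representatives of the cosets $W/W_K$. Define $Q_K=\{(v,w)\in W\times W^K: v\le w\}$, with the partial order: $(v',w')\preceq(v,w)$ iff there exists $u\in W_K$ such that $v\le v'u\le w'u\le w$. For a poset $Q$ and $x\le y$ in $Q$, $[x,y]=\{z: x\le z\le y\}$. Write $y\gtrdot x$ (covering relation) if $x\neq y$ and $[x,y]=\{x,y\}$. A maximal chain from $x$ to $y$ is a finite sequence $y=w_0\gtrdot w_1\gtrdot\cdots\gtrdot w_n=x$; $n$ is its length. $Q$ is pure if for all $x\le y$ maximal chains from $x$ to $y$ exist and all have the same length (called the length of $[x,y]$). A pure poset is thin if every interval of length $2$ has exactly $4$ elements. An edge labeling of a pure poset $Q$ is a map $\lambda$ from the set of covering relations of $Q$ to a poset $\Lambda$; it sends a maximal chain $w_0\gtrdot\cdots\gtrdot w_n$ of an interval to the tuple $(\lambda(w_0\gtrdot w_1),\dots,\lambda(w_{n-1}\gtrdot w_n))$. The chain is increasing if this tuple is increasing (each entry $\le$ the next) in $\Lambda$. Maximal chains of an interval are compared by the lexicographic order of their tuples. The labeling is an EL-labeling if in every interval there is a unique increasing maximal chain, and all other maximal chains of the interval are lexicographically greater than it. $Q$ is EL-shellable if it admits an EL-labeling. *)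

theory Defs
  imports "HOL-Algebra.Algebra" "HOL-Library.Extended_Nat"
begin

text \<open>
  A poset is given by its carrier \<open>Q\<close> and its order \<open>r \<subseteq> Q \<times> Q\<close>, where \<open>(x, y) \<in> r\<close>
  means \<open>x \<le> y\<close>.
\<close>

definition closed_interval :: "'a rel \<Rightarrow> 'a \<Rightarrow> 'a \<Rightarrow> 'a set" where
  "closed_interval r x y = {z. (x, z) \<in> r \<and> (z, y) \<in> r}"

text \<open>The larger element comes first in \<open>covers\<close>, and chains are listed from top to bottom.\<close>

definition covers :: "'a rel \<Rightarrow> 'a \<Rightarrow> 'a \<Rightarrow> bool" where
  "covers r y x \<longleftrightarrow> (x, y) \<in> r \<and> x \<noteq> y \<and> closed_interval r x y = {x, y}"

definition maximal_chain :: "'a rel \<Rightarrow> 'a \<Rightarrow> 'a \<Rightarrow> 'a list \<Rightarrow> bool" where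
  "maximal_chain r x y ws \<longleftrightarrow>
     ws \<noteq> [] \<and> hd ws = y \<and> last ws = x \<and> successively (covers r) ws"

definition chain_length :: "'a list \<Rightarrow> nat" where
  "chain_length ws = length ws - 1"

definition pure_poset :: "'a set \<Rightarrow> 'a rel \<Rightarrow> bool" where
  "pure_poset Q r \<longleftrightarrow> partial_order_on Q r \<and>
     (\<forall>(x, y) \<in> r. (\<exists>ws. maximal_chain r x y ws) \<and>
        (\<forall>ws ws'. maximal_chain r x y ws \<longrightarrow> maximal_chain r x y ws' \<longrightarrow>
           chain_length ws = chain_length ws'))"

definition thin_poset :: "'a set \<Rightarrow> 'a rel \<Rightarrow> bool" where
  "thin_poset Q r \<longleftrightarrow> pure_poset Q r \<and>
     (\<forall>(x, y) \<in> r. (\<exists>ws. maximal_chain r x y ws \<and> chain_length ws = 2) \<longrightarrow>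
        card (closed_interval r x y) = 4)"

definition chain_labels :: "('a \<Rightarrow> 'a \<Rightarrow> 'b) \<Rightarrow> 'a list \<Rightarrow> 'b list" where
  "chain_labels f ws = map2 f ws (tl ws)"

definition edge_labeling :: "'a rel \<Rightarrow> 'b set \<Rightarrow> ('a \<Rightarrow> 'a \<Rightarrow> 'b) \<Rightarrow> bool" where
  "edge_labeling r L f \<longleftrightarrow> (\<forall>y x. covers r y x \<longrightarrow> f y x \<in> L)"

definition increasing_chain :: "'b rel \<Rightarrow> ('a \<Rightarrow> 'a \<Rightarrow> 'b) \<Rightarrow> 'a list \<Rightarrow> bool" where
  "increasing_chain rL f ws \<longleftrightarrow> successively (\<lambda>a b. (a, b) \<in> rL) (chain_labels f ws)"

definition EL_labeling ::
    "'a set \<Rightarrow> 'a rel \<Rightarrow> 'b set \<Rightarrow> 'b rel \<Rightarrow> ('a \<Rightarrow> 'a \<Rightarrow> 'b) \<Rightarrow> bool" where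
  "EL_labeling Q r L rL f \<longleftrightarrow>
     pure_poset Q r \<and> partial_order_on L rL \<and> edge_labeling r L f \<and>
     (\<forall>(x, y) \<in> r. \<exists>ws.
        maximal_chain r x y ws \<and> increasing_chain rL f ws \<and>
        (\<forall>ws'. maximal_chain r x y ws' \<and> ws' \<noteq> ws \<longrightarrow>
           \<not> increasing_chain rL f ws' \<and>
           (chain_labels f ws, chain_labels f ws') \<in> lex (rL - Id)))"

text \<open>
  HOL cannot quantify existentially over the type of labels. Taking labels in \<open>'a \<times> 'a\<close>
  loses no generality: whether a labeling is an EL-labeling depends only on the induced order on
  the labels actually used, and the set of these is the image of a subset of \<open>'a \<times> 'a\<close>, hence
  can be embedded in \<open>'a \<times> 'a\<close>. The order \<open>rL\<close> is arbitrary and unrelated to \<open>r\<close>.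
\<close>

definition EL_shellable :: "'a set \<Rightarrow> 'a rel \<Rightarrow> bool" where
  "EL_shellable Q r \<longleftrightarrow>
     (\<exists>(L :: ('a \<times> 'a) set) rL f. EL_labeling Q r L rL f)"

definition coxeter_matrix :: "'i set \<Rightarrow> ('i \<Rightarrow> 'i \<Rightarrow> enat) \<Rightarrow> bool" where
  "coxeter_matrix I m \<longleftrightarrow>
     (\<forall>i\<in>I. \<forall>j\<in>I. m i j = m j i \<and> m i j \<ge> 1 \<and> (m i j = 1 \<longleftrightarrow> i = j))"

text \<open>
  One step deletes a factor \<open>(i j)\<^sup>n\<close> with \<open>n = m i j\<close> finite from a word. Since \<open>m i i = 1\<close>,
  the factors \<open>i i\<close> are among these, so formal inverses of letters are not needed: words in
  \<open>I\<close> modulo the generated equivalence are the group with generators \<open>I\<close> and relations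
  \<open>(i j)\<^bsup>m i j\<^esup> = 1\<close>.
\<close>

definition word_step :: "'i set \<Rightarrow> ('i \<Rightarrow> 'i \<Rightarrow> enat) \<Rightarrow> 'i list \<Rightarrow> 'i list \<Rightarrow> bool" where
  "word_step I m u v \<longleftrightarrow>
     (\<exists>a\<in>lists I. \<exists>b\<in>lists I. \<exists>i\<in>I. \<exists>j\<in>I. \<exists>n. m i j = enat n \<and>
        u = a @ concat (replicate n [i, j]) @ b \<and> v = a @ b)"

definition word_value :: "('w, 'b) monoid_scheme \<Rightarrow> ('i \<Rightarrow> 'w) \<Rightarrow> 'i list \<Rightarrow> 'w" where
  "word_value W s u = foldr (\<lambda>i x. s i \<otimes>\<^bsub>W\<^esub> x) u \<one>\<^bsub>W\<^esub>"

text \<open>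
  The last two assumptions say that \<open>W\<close> is presented by the generators \<open>s i\<close> and the relations
  \<open>(s i \<otimes> s j)\<^bsup>m i j\<^esup> = \<one>\<close> (no relation when \<open>m i j = \<infinity>\<close>). The set \<open>I\<close> may be infinite.
\<close>

locale coxeter_system = group W
  for W :: "('w, 'b) monoid_scheme" (structure) +
  fixes I :: "'i set" and m :: "'i \<Rightarrow> 'i \<Rightarrow> enat" and s :: "'i \<Rightarrow> 'w"
  assumes matrix: "coxeter_matrix I m"
    and simple_closed: "s ` I \<subseteq> carrier W"
    and generated: "word_value W s ` lists I = carrier W"
    and presented: "\<And>u v. \<lbrakk>u \<in> lists I; v \<in> lists I\<rbrakk> \<Longrightarrow>
          word_value W s u = word_value W s v \<longleftrightarrow> equivclp (word_step I m) u v"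
begin

definition len :: "'w \<Rightarrow> nat" where
  "len w = (LEAST n. \<exists>u\<in>lists I. length u = n \<and> word_value W s u = w)"

definition reflections :: "'w set" where
  "reflections = {x \<otimes> s i \<otimes> inv x | x i. x \<in> carrier W \<and> i \<in> I}"

definition bruhat_step :: "'w \<Rightarrow> 'w \<Rightarrow> bool" where
  "bruhat_step v w \<longleftrightarrow>
     v \<in> carrier W \<and> (\<exists>t\<in>reflections. w = v \<otimes> t) \<and> len v < len w"

definition bruhat_le :: "'w \<Rightarrow> 'w \<Rightarrow> bool" where
  "bruhat_le v w \<longleftrightarrow> v \<in> carrier W \<and> w \<in> carrier W \<and> bruhat_step\<^sup>*\<^sup>* v w"

definition parabolic :: "'i set \<Rightarrow> 'w set" where
  "parabolic K = generate W (s ` K)"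

definition min_reps :: "'i set \<Rightarrow> 'w set" where
  "min_reps K = {w \<in> carrier W. \<forall>x \<in> w <# parabolic K. len w \<le> len x}"

definition Q :: "'i set \<Rightarrow> ('w \<times> 'w) set" where
  "Q K = {(v, w). v \<in> carrier W \<and> w \<in> min_reps K \<and> bruhat_le v w}"

definition Q_order :: "'i set \<Rightarrow> ('w \<times> 'w) rel" where
  "Q_order K = {((v', w'), (v, w)). (v', w') \<in> Q K \<and> (v, w) \<in> Q K \<and>
     (\<exists>u \<in> parabolic K. bruhat_le v (v' \<otimes> u) \<and> bruhat_le (v' \<otimes> u) (w' \<otimes> u) \<and>
        bruhat_le (w' \<otimes> u) w)}"

end

end

theory Submission
  imports Defs Complex_Main
begin

text \<open>
  Glue two copies of the Coxeter graph of \<open>W\<close> along \<open>K\<close>, with no relations between the remaining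
  letters of different copies, and let \<open>V\<close> be the resulting Coxeter group. The map sending \<open>(v, w)\<close>
  to the copy of \<open>v\<close> in the first factor times the copy of \<open>inv w\<close> in the second identifies \<open>Q K\<close> with a
  convex subset of \<open>V\<close> in the Bruhat order twisted by the first factor (Bao and He), in which the
  contribution of that factor to the length is counted negatively.

  It remains to treat twisted Bruhat orders. Cover relations \<open>x < x t\<close> are labelled by the reflection
  \<open>t\<close>, and reflections are ordered by a reflection order in the sense of Dyer, obtained from the
  geometric representation. Right multiplication by a simple reflection \<open>s\<close> conjugates labels and
  respects the order except along the edges \<open>x, x s\<close>. If \<open>x < x s\<close> and \<open>y s < y\<close>, it therefore matches the
  increasing chains from \<open>x\<close> to \<open>y\<close> with those from \<open>x\<close> to \<open>y s\<close> for another reflection order. The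
  remaining case \<open>x s < x\<close> follows by counting in the interval from \<open>x s\<close> to \<open>y\<close>: the alternating
  number of ways to cut a chain into a decreasing and an increasing part vanishes, and so does the
  alternating number of elements.
\<close>

section \<open>The contragredient geometric representation\<close>

text \<open>The element \<open>u\<close> in the order of \<open>Q K\<close> comes from the shared
  letters: the two copies of \<open>W\<close> meet in the subgroup generated by \<open>K\<close>, so
  a factor from it can be moved between the two factors of \<open>glue v (inv w)\<close>. Inverting
  \<open>w\<close> puts the minimal representative on the correct side for a unique decomposition.
  The reversed inequality for \<open>v\<close> is the reason for the negative count: the height is
  the length of \<open>w\<close> minus that of \<open>v\<close>.

  If \<open>W\<close> is infinite, this height is unbounded below on the first copy, so induction
  starts from the upper end. Right descents shorten its second factor until both ends lie in the
  first copy, where the order is opposite to the Bruhat order. Heights are axiomatised so that the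
  Bruhat and the twisted case share one argument.

  Paths record labels upwards while chains are read downwards, so the increasing chain of an
  interval is its decreasing path. That this chain is lexicographically first is reduced to
  intervals of length two, where the two label pairs are compared through their roots.\<close>

fun alternating :: "'a \<Rightarrow> 'a \<Rightarrow> nat \<Rightarrow> 'a list" where
  "alternating a b 0 = []"
| "alternating a b (Suc k) = (if even k then a else b) # alternating a b k"

lemma length_alternating [simp]: "length (alternating a b k) = k"
  by (induction k) auto

lemma alternating_in_lists: "a \<in> A \<Longrightarrow> b \<in> A \<Longrightarrow> alternating a b k \<in> lists A"
  by (induction k) auto

text \<open>For \<open>k > 0\<close> the word \<open>alternating a b k\<close> ends in
  \<open>a\<close> and grows at its left end. Removing its last letter therefore exchanges the roles
  of the two letters.\<close>

lemma alternating_snoc: "alternating a b (Suc k) = alternating b a k @ [a]"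
proof (induction k)
  case (Suc k)
  have "alternating a b (Suc (Suc k)) = (if even (Suc k) then a else b) # alternating a b (Suc k)"
    by (rule alternating.simps)
  also have "\<dots> = alternating b a (Suc k) @ [a]"
    unfolding Suc.IH by auto
  finally show ?case .
qed auto

lemma rev_alternating: "rev (alternating a b k) = (if even k then alternating b a k else alternating a b k)"
proof (induction k arbitrary: a b)
  case (Suc k)
  have "rev (alternating a b (Suc k)) = a # rev (alternating b a k)"
    unfolding alternating_snoc by simp
  then show ?case
    using Suc.IH[of b a] by auto
qed auto

lemma alternating_add:
  "alternating a b (n + k) = (if even k then alternating a b n else alternating b a n) @ alternating a b k"
  by (induction n) auto

lemma alternating_double: "alternating a b (2 * n) = concat (replicate n [b, a])"
  by (induction n) auto

section \<open>Words, their values and the length function\<close>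

context coxeter_system
begin

abbreviation val :: "'i list \<Rightarrow> 'w" where
  "val \<equiv> word_value W s"

lemma simple_in_carrier [simp]: "i \<in> I \<Longrightarrow> s i \<in> carrier W"
  using simple_closed by blast

lemma val_Nil [simp]: "val [] = \<one>"
  by (simp add: word_value_def)

lemma val_Cons [simp]: "val (i # u) = s i \<otimes> val u"
  by (simp add: word_value_def)

lemma val_closed [simp]: "u \<in> lists I \<Longrightarrow> val u \<in> carrier W"
  using generated by blast

lemma val_closed_set [simp]: "\<forall>i\<in>set u. i \<in> I \<Longrightarrow> val u \<in> carrier W"
  by (intro val_closed) auto

lemma val_append: "u \<in> lists I \<Longrightarrow> v \<in> lists I \<Longrightarrow> val (u @ v) = val u \<otimes> val v"
  by (induction u) (auto simp: m_assoc)

lemma word_exists: "w \<in> carrier W \<Longrightarrow> \<exists>u\<in>lists I. val u = w"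
  unfolding generated[symmetric] by blast

lemma word_step_in_lists: "word_step I m u v \<Longrightarrow> u \<in> lists I \<and> v \<in> lists I"
  unfolding word_step_def by (auto split: if_splits)

lemma val_word_step:
  assumes "word_step I m u v"
  shows "val u = val v"
proof -
  have "equivclp (word_step I m) u v"
    using assms by blast
  then show ?thesis
    using word_step_in_lists[OF assms] presented by blast
qed

lemma val_relation:
  assumes "i \<in> I" "j \<in> I" "m i j = enat n"
  shows "val (concat (replicate n [i, j])) = \<one>"
proof -
  have "word_step I m (concat (replicate n [i, j])) []"
    unfolding word_step_def using assms
    by (intro bexI[of _ "[]"] bexI[of _ i] bexI[of _ j] exI[of _ n]) auto
  from val_word_step[OF this] show ?thesis
    by simp
qed

lemma m_self: "i \<in> I \<Longrightarrow> m i i = enat 1"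
  using matrix by (auto simp: coxeter_matrix_def one_enat_def)

lemma m_sym: "i \<in> I \<Longrightarrow> j \<in> I \<Longrightarrow> m i j = m j i"
  using matrix by (auto simp: coxeter_matrix_def)

lemma m_ge_2: "i \<in> I \<Longrightarrow> j \<in> I \<Longrightarrow> i \<noteq> j \<Longrightarrow> m i j = enat n \<Longrightarrow> n \<ge> 2"
  using matrix unfolding coxeter_matrix_def one_enat_def
  by (metis One_nat_def Suc_1 Suc_leI enat_ord_simps(1) le_neq_implies_less)

lemma simple_square [simp]: "i \<in> I \<Longrightarrow> s i \<otimes> s i = \<one>"
  using val_relation[of i i 1] m_self by simp

lemma inv_simple [simp]: "i \<in> I \<Longrightarrow> inv (s i) = s i"
  using inv_equality simple_square by simp

lemma mult_simple_simple [simp]: "x \<in> carrier W \<Longrightarrow> i \<in> I \<Longrightarrow> x \<otimes> s i \<otimes> s i = x"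
  by (simp add: m_assoc)

lemma simple_simple_mult [simp]: "x \<in> carrier W \<Longrightarrow> i \<in> I \<Longrightarrow> s i \<otimes> (s i \<otimes> x) = x"
  by (simp add: m_assoc[symmetric])

text \<open>The universal property in its working form: parity of the length, the geometric action
  and homomorphisms out of \<open>W\<close> are functions of words that do not change when a relator
  is deleted.\<close>

lemma word_invariant:
  assumes step: "\<And>u v. word_step I m u v \<Longrightarrow> g u = g v"
    and "u \<in> lists I" "v \<in> lists I" "val u = val v"
  shows "g u = g v"
proof -
  have "equivclp (word_step I m) u v"
    using assms presented by blast
  then show ?thesis
    by (induction rule: equivclp_induct) (auto dest: step)
qed

lemma val_rev: "u \<in> lists I \<Longrightarrow> val (rev u) = inv (val u)"
proof (induction u)
  case (Cons i u)
  then have "rev u \<in> lists I"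
    by auto
  with Cons show ?case
    by (simp add: val_append[of "rev u" "[i]"] inv_mult_group)
qed simp

text \<open>The braid relation. The relator of length \<open>2 n\<close> is cut in the middle; one
  half is inverse to the other, and the inverse of a word is its reversal.\<close>

lemma val_alternating_swap:
  assumes "i \<in> I" "j \<in> I" "m i j = enat n"
  shows "val (alternating i j n) = val (alternating j i n)"
proof -
  have *: "alternating i j n \<in> lists I" "alternating j i n \<in> lists I"
    using assms alternating_in_lists by metis+
  have "m j i = enat n"
    using assms m_sym by simp
  from val_relation[OF assms(2,1) this]
  have "val (alternating i j (n + n)) = \<one>"
    using alternating_double[of i j n] by (simp add: mult_2)
  then have **: "val (if even n then alternating i j n else alternating j i n) \<otimes> val (alternating i j n) = \<one>"
    unfolding alternating_add using * by (auto simp: val_append)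
  have "inv (val (alternating i j n)) = val (if even n then alternating j i n else alternating i j n)"
    using val_rev[OF *(1)] by (simp add: rev_alternating)
  moreover have "inv (val (alternating i j n)) = val (if even n then alternating i j n else alternating j i n)"
    using ** * by (intro inv_equality) auto
  ultimately show ?thesis
    by (auto split: if_splits)
qed

lemma len_val_le: "u \<in> lists I \<Longrightarrow> len (val u) \<le> length u"
  unfolding len_def by (rule Least_le) auto

lemma reduced_word_exists:
  assumes "w \<in> carrier W"
  obtains u where "u \<in> lists I" "val u = w" "length u = len w"
proof -
  obtain u where "u \<in> lists I" "val u = w"
    using word_exists assms by blast
  then have "\<exists>n. \<exists>u\<in>lists I. length u = n \<and> val u = w"
    by blast
  from LeastI_ex[OF this] show ?thesis
    using that unfolding len_def by blast
qed

text \<open>Relators have even length \<open>2 n\<close>. Consequently right multiplication by a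
  generator never preserves the length, which is what \<open>len_mult_simple\<close> rests
  on.\<close>

lemma even_length_word:
  assumes "u \<in> lists I"
  shows "even (length u) \<longleftrightarrow> even (len (val u))"
proof -
  obtain v where v: "v \<in> lists I" "val v = val u" "length v = len (val u)"
    using reduced_word_exists assms val_closed by blast
  have "even (length u) = even (length v)"
  proof (rule word_invariant)
    show "even (length u) = even (length v)" if "word_step I m u v" for u v
      using that by (auto simp: word_step_def length_concat sum_list_replicate)
  qed (use v assms in auto)
  then show ?thesis
    using v by simp
qed

lemma len_one [simp]: "len \<one> = 0"
  using len_val_le[of "[]"] by simp

lemma len_eq_0_iff: "w \<in> carrier W \<Longrightarrow> len w = 0 \<longleftrightarrow> w = \<one>"
  by (metis len_one length_0_conv reduced_word_exists val_Nil)

lemma len_inv_le: "w \<in> carrier W \<Longrightarrow> len (inv w) \<le> len w"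
  by (metis len_val_le length_rev reduced_word_exists val_rev in_lists_conv_set set_rev)

lemma len_inv [simp]: "w \<in> carrier W \<Longrightarrow> len (inv w) = len w"
  by (metis antisym inv_closed inv_inv len_inv_le)

lemma len_mult_le: "x \<in> carrier W \<Longrightarrow> y \<in> carrier W \<Longrightarrow> len (x \<otimes> y) \<le> len x + len y"
  by (metis len_val_le length_append reduced_word_exists val_append append_in_lists_conv)

lemma even_len_mult:
  assumes "x \<in> carrier W" "y \<in> carrier W"
  shows "even (len (x \<otimes> y)) \<longleftrightarrow> even (len x + len y)"
proof -
  obtain u v where "u \<in> lists I" "val u = x" "v \<in> lists I" "val v = y"
    using word_exists assms by metis
  then show ?thesis
    using even_length_word[of "u @ v"] even_length_word[of u] even_length_word[of v]
    by (auto simp: val_append)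
qed

lemma len_simple [simp]: "i \<in> I \<Longrightarrow> len (s i) = 1"
  using len_val_le[of "[i]"] even_length_word[of "[i]"] by (auto elim: oddE)

lemma len_mult_simple:
  assumes "w \<in> carrier W" "i \<in> I"
  shows "len (w \<otimes> s i) = len w + 1 \<or> len w = len (w \<otimes> s i) + 1"
proof -
  have "len (w \<otimes> s i) \<le> len w + 1" "len w \<le> len (w \<otimes> s i) + 1"
    using len_mult_le[of w "s i"] len_mult_le[of "w \<otimes> s i" "s i"] assms by auto
  moreover have "len (w \<otimes> s i) \<noteq> len w"
    using even_len_mult[of w "s i"] assms by auto
  ultimately show ?thesis by linarith
qed

lemma right_descent_exists:
  assumes "w \<in> carrier W" "w \<noteq> \<one>"
  shows "\<exists>i\<in>I. len w = len (w \<otimes> s i) + 1"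
proof -
  obtain u where u: "u \<in> lists I" "val u = w" "length u = len w"
    using reduced_word_exists assms by blast
  then have "u \<noteq> []"
    using assms by auto
  then obtain v i where v: "u = v @ [i]"
    by (meson rev_exhaust)
  have "v \<in> lists I" "i \<in> I"
    using u v by auto
  moreover have "w \<otimes> s i = val v"
    unfolding u(2)[symmetric] v using calculation by (simp add: val_append[of v "[i]"])
  ultimately have "len (w \<otimes> s i) < len w"
    using len_val_le[of v] u v by auto
  then show ?thesis
    using len_mult_simple[OF assms(1) \<open>i \<in> I\<close>] \<open>i \<in> I\<close> by force
qed

text \<open>
  The geometric representation is used in its contragredient form: \<open>W\<close> acts from the right on
  functions \<open>f\<close> on \<open>I\<close>, where \<open>f i\<close> is the value of a functional at the simple root of \<open>i\<close>,
  and a root is the function \<open>f \<mapsto> act f x i\<close>. No finiteness of \<open>I\<close> or of supports is needed.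
  The bilinear form \<open>form\<close> is set to \<open>0\<close> outside \<open>I\<close> so that it is symmetric everywhere.
\<close>

definition form :: "'i \<Rightarrow> 'i \<Rightarrow> real" where
  "form i j = (if i \<in> I \<and> j \<in> I then case m i j of enat n \<Rightarrow> - cos (pi / real n) | \<infinity> \<Rightarrow> -1 else 0)"

definition refl :: "'i \<Rightarrow> ('i \<Rightarrow> real) \<Rightarrow> 'i \<Rightarrow> real" where
  "refl i f = (\<lambda>j. f j - 2 * f i * form i j)"

definition act :: "('i \<Rightarrow> real) \<Rightarrow> 'w \<Rightarrow> 'i \<Rightarrow> real" where
  "act f w = fold refl (SOME u. u \<in> lists I \<and> val u = w) f"

lemma form_sym: "form i j = form j i"
  using m_sym by (auto simp: form_def)

lemma form_self [simp]: "i \<in> I \<Longrightarrow> form i i = 1"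
  by (simp add: form_def m_self)

lemma refl_refl [simp]: "i \<in> I \<Longrightarrow> refl i (refl i f) = f"
  by (auto simp: refl_def)

lemma double_cos_sin: "2 * cos x * sin y = sin (y + x) + sin (y - x)" for x y :: real
  by (simp add: sin_add sin_diff)

text \<open>For different letters the Gram matrix of \<open>form\<close> has determinant
  \<open>sin \<theta>\<close> squared, which is nonzero. So \<open>f\<close> splits into a part
  vanishing at \<open>i\<close> and \<open>j\<close>, fixed by both reflections, and a combination
  of \<open>form i\<close> and \<open>form j\<close>. On the latter the product of the reflections
  is a rotation by twice \<theta>: the coefficients satisfy the recurrence solved by
  \<open>P\<close> and \<open>R\<close>, and \<open>n\<close> steps are a full turn.\<close>

lemma fold_refl_relation:
  assumes ij: "i \<in> I" "j \<in> I" and n: "m i j = enat n"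
  shows "fold refl (concat (replicate n [i, j])) f = f"
proof (cases "i = j")
  case True
  then have "n = 1"
    using m_self ij n by simp
  then show ?thesis
    using True ij by simp
next
  case False
  then have "n \<ge> 2"
    using m_ge_2 ij n by blast
  define \<theta> where "\<theta> = pi / real n"
  have \<theta>: "0 < \<theta>" "\<theta> < pi" "2 * real n * \<theta> = 2 * pi"
    using \<open>n \<ge> 2\<close> by (auto simp: \<theta>_def field_simps)
  have sin: "sin \<theta> \<noteq> 0"
    using sin_gt_zero[OF \<theta>(1,2)] by simp
  have c: "form i j = - cos \<theta>" "form j i = - cos \<theta>" "form i i = 1" "form j j = 1"
    using ij n form_sym[of i j] by (auto simp: form_def \<theta>_def m_self)
  define D where "D = (sin \<theta>)\<^sup>2"
  have D: "D \<noteq> 0" "(cos \<theta>)\<^sup>2 = 1 - D"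
    using sin by (auto simp: D_def cos_squared_eq)
  \<comment> \<open>Coefficients of the part of \<open>f\<close> in the span of
    \<open>form i\<close> and \<open>form j\<close>. They solve the linear system of the Gram matrix
    with entries \<open>1\<close> and \<open>- cos \<theta>\<close>, whose determinant is
    \<open>D\<close>.\<close>
  define p q where "p = (f i + cos \<theta> * f j) / D" and "q = (f j + cos \<theta> * f i) / D"
  define f0 where "f0 = (\<lambda>k. f k - p * form i k - q * form j k)"
  have pq: "D * p = f i + cos \<theta> * f j" "D * q = f j + cos \<theta> * f i"
    using D by (simp_all add: p_def q_def)
  have "D * f0 i = D * f i - D * p + cos \<theta> * (D * q)" "D * f0 j = D * f j + cos \<theta> * (D * p) - D * q"
    by (simp_all add: f0_def c algebra_simps)
  then have "D * f0 i = (D - 1 + (cos \<theta>)\<^sup>2) * f i" "D * f0 j = (D - 1 + (cos \<theta>)\<^sup>2) * f j"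
    unfolding pq by (simp_all add: algebra_simps power2_eq_square)
  then have "D * f0 i = 0" "D * f0 j = 0"
    using D(2) by simp_all
  then have f0: "f0 i = 0" "f0 j = 0"
    using D(1) by simp_all
  \<comment> \<open>Chosen so that the sequences below start with \<open>P 0 = p\<close> and
    \<open>R 0 = q\<close>, hence \<open>F 0 = f\<close>.\<close>
  define a b where "a = - p / sin \<theta>" and "b = q / sin \<theta>"
  define P where "P k = a * sin (2 * real k * \<theta> - \<theta>) + b * sin (2 * real k * \<theta>)" for k
  define R where "R k = a * sin (2 * real k * \<theta>) + b * sin (2 * real k * \<theta> + \<theta>)" for k
  define F where "F k = (\<lambda>l. f0 l + P k * form i l + R k * form j l)" for k
  have P: "P (Suc k) = 2 * cos \<theta> * R k - P k" for k
  proof -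
    have "2 * cos \<theta> * R k = a * (2 * cos \<theta> * sin (2 * real k * \<theta>)) + b * (2 * cos \<theta> * sin (2 * real k * \<theta> + \<theta>))"
      by (simp add: R_def algebra_simps)
    then show ?thesis
      unfolding double_cos_sin by (simp add: P_def algebra_simps)
  qed
  have R: "R (Suc k) = 2 * cos \<theta> * P (Suc k) - R k" for k
  proof -
    have "2 * cos \<theta> * P (Suc k) = a * (2 * cos \<theta> * sin (2 * real k * \<theta> + \<theta>))
        + b * (2 * cos \<theta> * sin (2 * real k * \<theta> + 2 * \<theta>))"
      by (simp add: P_def algebra_simps)
    then show ?thesis
      unfolding double_cos_sin by (simp add: R_def algebra_simps)
  qed
  have step: "refl j (refl i (F k)) = F (Suc k)" for k
  proof -
    have "refl i (F k) = (\<lambda>l. f0 l + P (Suc k) * form i l + R k * form j l)"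
      using f0 by (auto simp: refl_def F_def c P fun_eq_iff algebra_simps)
    then show ?thesis
      using f0 by (auto simp: refl_def F_def c R fun_eq_iff algebra_simps)
  qed
  have iter: "fold refl (concat (replicate l [i, j])) (F k) = F (k + l)" for k l
    by (induction l arbitrary: k) (auto simp: step)
  have "F 0 = f"
    using sin by (auto simp: F_def P_def R_def f0_def a_def b_def)
  moreover have "F n = F 0"
  proof -
    have "sin (2 * real n * \<theta> - \<theta>) = sin (- \<theta>)" "sin (2 * real n * \<theta> + \<theta>) = sin \<theta>" "sin (2 * real n * \<theta>) = 0"
      unfolding \<theta>(3) by (simp_all add: sin_diff sin_add)
    then show ?thesis
      by (simp add: F_def P_def R_def)
  qed
  ultimately show ?thesis
    using iter[of n 0] by simp
qed

lemma act_val: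
  assumes "u \<in> lists I"
  shows "act f (val u) = fold refl u f"
proof -
  have v: "(SOME v. v \<in> lists I \<and> val v = val u) \<in> lists I \<and> val (SOME v. v \<in> lists I \<and> val v = val u) = val u"
    by (rule someI[of _ u]) (use assms in auto)
  have step: "fold refl u f = fold refl v f" if "word_step I m u v" for u v f
    using that by (auto simp: word_step_def fold_refl_relation)
  show ?thesis
    unfolding act_def by (rule word_invariant[OF step]) (use v assms in auto)
qed

lemma act_one [simp]: "act f \<one> = f"
  using act_val[of "[]"] by simp

lemma act_simple [simp]: "i \<in> I \<Longrightarrow> act f (s i) = refl i f"
  using act_val[of "[i]"] by simp

lemma act_mult:
  assumes "x \<in> carrier W" "y \<in> carrier W"
  shows "act f (x \<otimes> y) = act (act f x) y"
proof -
  obtain u v where "u \<in> lists I" "val u = x" "v \<in> lists I" "val v = y"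
    using word_exists assms by metis
  then show ?thesis
    by (metis act_val append_in_lists_conv comp_apply fold_append val_append)
qed

lemma fold_refl_linear:
  "fold refl u (\<lambda>j. a * f j + b * g j) = (\<lambda>j. a * fold refl u f j + b * fold refl u g j)"
proof (induction u arbitrary: f g)
  case (Cons i u)
  have "refl i (\<lambda>j. a * f j + b * g j) = (\<lambda>j. a * refl i f j + b * refl i g j)"
    by (auto simp: refl_def algebra_simps)
  then show ?case
    using Cons.IH by simp
qed auto

lemma act_linear:
  "w \<in> carrier W \<Longrightarrow> act (\<lambda>j. a * f j + b * g j) w = (\<lambda>j. a * act f w j + b * act g w j)"
  using word_exists[of w] fold_refl_linear act_val by metis

text \<open>Even for infinite \<open>I\<close> a root involves only finitely many simple roots; this
  makes its coordinate expansion a finite sum.\<close>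

lemma act_finite_support:
  assumes "w \<in> carrier W" "i \<in> I"
  shows "\<exists>F c. finite F \<and> F \<subseteq> I \<and> (\<forall>f. act f w i = (\<Sum>j\<in>F. c j * f j))"
proof -
  have "\<exists>F c. finite F \<and> F \<subseteq> I \<and> (\<forall>f. fold refl u f i = (\<Sum>j\<in>F. c j * f j))" if "u \<in> lists I" for u
    using that
  proof (induction u)
    case Nil
    then show ?case
      using assms by (intro exI[of _ "{i}"] exI[of _ "\<lambda>_. 1"]) auto
  next
    case (Cons k u)
    then have "k \<in> I"
      by auto
    from Cons obtain F c where F: "finite F" "F \<subseteq> I" "\<forall>f. fold refl u f i = (\<Sum>j\<in>F. c j * f j)"
      by auto
    define d where "d = 2 * (\<Sum>j\<in>F. c j * form k j)"
    define c' where "c' j = (if j \<in> F then c j else 0) - (if j = k then d else 0)" for j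
    have "fold refl (k # u) f i = (\<Sum>j\<in>insert k F. c' j * f j)" for f
    proof -
      have "fold refl (k # u) f i = (\<Sum>j\<in>F. c j * f j) - d * f k"
        using F(3) by (simp add: refl_def d_def algebra_simps sum_subtractf sum_distrib_left)
      also have "(\<Sum>j\<in>F. c j * f j) = (\<Sum>j\<in>insert k F. (if j \<in> F then c j else 0) * f j)"
        using F(1) by (intro sum.mono_neutral_cong_left) auto
      also have "d * f k = (\<Sum>j\<in>insert k F. (if j = k then d else 0) * f j)"
        using F(1) by (simp add: if_distrib[of "\<lambda>x. x * _"] cong: if_cong)
      finally show ?thesis
        by (simp add: c'_def algebra_simps sum_subtractf)
    qed
    then show ?case
      using F \<open>k \<in> I\<close> by (intro exI[of _ "insert k F"] exI[of _ c']) auto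
  qed
  moreover obtain u where "u \<in> lists I" "val u = w"
    using word_exists assms by blast
  ultimately show ?thesis
    using act_val by metis
qed

definition root :: "'w \<Rightarrow> 'i \<Rightarrow> ('i \<Rightarrow> real) \<Rightarrow> real" where
  "root x i = (\<lambda>f. act f x i)"

text \<open>Positivity is tested on the dominant cone. For a root, which is a finite combination of
  coordinates in \<open>I\<close>, this amounts to all coefficients being nonnegative, as evaluation
  at unit vectors shows.\<close>

definition positive :: "(('i \<Rightarrow> real) \<Rightarrow> real) \<Rightarrow> bool" where
  "positive \<beta> \<longleftrightarrow> (\<forall>f. (\<forall>i\<in>I. 0 \<le> f i) \<longrightarrow> 0 \<le> \<beta> f)"

text \<open>In the dihedral group of \<open>i\<close> and \<open>j\<close> the coefficients are
  Chebyshev values: \<open>U l = sin (l \<theta>) / sin \<theta>\<close> with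
  \<open>\<theta> = pi / n\<close> for finite order \<open>n\<close>, and \<open>U l = l\<close> for
  infinite order. They are nonnegative up to \<open>l = n\<close>, and a word of length
  \<open>k\<close> involves \<open>U k\<close> and \<open>U (Suc k)\<close>.\<close>

lemma fold_refl_alternating_nonneg:
  assumes ij: "i \<in> I" "j \<in> I" "i \<noteq> j" and k: "enat (Suc k) \<le> m i j" and f: "0 \<le> f i" "0 \<le> f j"
  shows "0 \<le> fold refl (alternating i j k) f j"
proof -
  define C where "C = - 2 * form i j"
  have "\<exists>U :: nat \<Rightarrow> real. U 0 = 0 \<and> U 1 = 1 \<and> (\<forall>l. U (Suc (Suc l)) = C * U (Suc l) - U l)
      \<and> (\<forall>l. enat l \<le> m i j \<longrightarrow> 0 \<le> U l)"
  proof (cases "m i j")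
    case (enat n)
    have "n \<ge> 2"
      using m_ge_2 ij enat by blast
    define \<theta> where "\<theta> = pi / real n"
    have \<theta>: "0 < \<theta>" "\<theta> < pi"
      using \<open>n \<ge> 2\<close> by (auto simp: \<theta>_def field_simps)
    have sin: "sin \<theta> > 0"
      using sin_gt_zero[OF \<theta>(1,2)] by simp
    have C: "C = 2 * cos \<theta>"
      using enat ij by (simp add: C_def form_def \<theta>_def)
    have "sin (real (Suc (Suc l)) * \<theta>) = 2 * cos \<theta> * sin (real (Suc l) * \<theta>) - sin (real l * \<theta>)" for l
      unfolding double_cos_sin by (simp add: algebra_simps)
    moreover have "0 \<le> sin (real l * \<theta>)" if "l \<le> n" for l
    proof (rule sin_ge_zero)
      show "real l * \<theta> \<le> pi"
        using that \<open>n \<ge> 2\<close> by (simp add: \<theta>_def divide_le_eq)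
    qed (use \<theta> in auto)
    ultimately show ?thesis
      using sin enat by (intro exI[of _ "\<lambda>l. sin (real l * \<theta>) / sin \<theta>"]) (auto simp: C field_simps)
  next
    case infinity
    then show ?thesis
      using ij by (intro exI[of _ real]) (auto simp: C_def form_def)
  qed
  then obtain U :: "nat \<Rightarrow> real" where U: "U 0 = 0" "U 1 = 1" "\<And>l. U (Suc (Suc l)) = C * U (Suc l) - U l"
      "\<And>l. enat l \<le> m i j \<Longrightarrow> 0 \<le> U l"
    by metis
  have "fold refl (alternating i j k) f j = (if even k then U (Suc k) * f j + U k * f i
      else U (Suc k) * f i + U k * f j)" for k f
  proof (induction k arbitrary: f)
    case (Suc k)
    show ?case
    proof (cases "even k")
      case True
      then have "fold refl (alternating i j (Suc k)) f j = U (Suc k) * f j + (C * U (Suc k) - U k) * f i"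
        using ij by (simp add: Suc.IH refl_def C_def algebra_simps)
      then show ?thesis
        using True by (simp only: U(3)) simp
    next
      case False
      then have "fold refl (alternating i j (Suc k)) f j = U (Suc k) * f i + (C * U (Suc k) - U k) * f j"
        using ij form_sym[of i j] by (simp add: Suc.IH refl_def C_def algebra_simps)
      then show ?thesis
        using False by (simp only: U(3)) simp
    qed
  qed (use U in auto)
  moreover have "0 \<le> U k" "0 \<le> U (Suc k)"
    using U(4) k by (auto simp: order_trans[OF _ k])
  ultimately show ?thesis
    using f by auto
qed

text \<open>
  Peel off right factors \<open>s r\<close>, \<open>s i\<close> alternately as long as the length drops. What remains
  has neither as a right descent, so induction applies to it, and the peeled alternating word is
  shorter than \<open>m r i\<close>, so the dihedral computation applies.
\<close>
theorem positive_root: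
  assumes "w \<in> carrier W" "i \<in> I" "len w < len (w \<otimes> s i)"
  shows "positive (root w i)"
  using assms
proof (induction "len w" arbitrary: w i rule: less_induct)
  case less
  note w = less.prems(1) and i = less.prems(2) and up = less.prems(3)
  show ?case
  proof (cases "w = \<one>")
    case True
    then show ?thesis
      using i by (simp add: positive_def root_def)
  next
    case False
    then obtain r where r: "r \<in> I" "len w = len (w \<otimes> s r) + 1"
      using right_descent_exists w by blast
    have ri: "r \<noteq> i"
      using r(2) up by auto
    define A where "A = {k. \<exists>v\<in>carrier W. w = v \<otimes> val (alternating r i k) \<and> len w = len v + k}"
    have lists: "alternating r i k \<in> lists I" "alternating i r k \<in> lists I" for k
      using r i alternating_in_lists by metis+
    have "finite A"
      by (rule finite_subset[of _ "{..len w}"]) (auto simp: A_def)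
    moreover have "1 \<in> A"
      using w r by (auto simp: A_def intro!: bexI[of _ "w \<otimes> s r"])
    ultimately have Max: "Max A \<in> A" "1 \<le> Max A" and max: "Suc (Max A) \<notin> A"
      by (auto intro: Max_in dest: Max_ge)
    then obtain k where k: "Max A = Suc k"
      by (metis One_nat_def Suc_le_D)
    then obtain v where v: "v \<in> carrier W" "w = v \<otimes> val (alternating r i (Suc k))" "len w = len v + Suc k"
      using Max(1) unfolding A_def by auto
    \<comment> \<open>\<open>x\<close> is the letter that would be peeled next and \<open>y\<close>
      the one peeled last. Going down under \<open>x\<close> would contradict the maximality of
      \<open>Suc k\<close>; going down under \<open>y\<close> would make \<open>w\<close> too
      short.\<close>
    define x where "x = (if even (Suc k) then r else i)"
    define y where "y = (if even k then r else i)"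
    have xy: "x \<in> I" "y \<in> I" "{x, y} = {r, i}"
      using r i by (auto simp: x_def y_def)
    have "len v < len (v \<otimes> s x)"
    proof (rule ccontr)
      assume "\<not> ?thesis"
      then have "len v = len (v \<otimes> s x) + 1"
        using len_mult_simple[OF v(1) xy(1)] by auto
      moreover have "w = (v \<otimes> s x) \<otimes> val (alternating r i (Suc (Suc k)))"
        using v(1) xy(1) lists[of "Suc k"] v(2) by (simp add: x_def m_assoc)
      ultimately have "Suc (Suc k) \<in> A"
        unfolding A_def using v xy by fastforce
      then show False
        using max k by simp
    qed
    moreover have "len v < len (v \<otimes> s y)"
    proof (rule ccontr)
      assume "\<not> ?thesis"
      then have "len v = len (v \<otimes> s y) + 1"
        using len_mult_simple[OF v(1) xy(2)] by auto
      moreover have "w = (v \<otimes> s y) \<otimes> val (alternating r i k)"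
        using v(1,2) xy(2) lists[of k] by (simp add: y_def m_assoc)
      then have "len w \<le> len (v \<otimes> s y) + len (val (alternating r i k))"
        using len_mult_le v(1) xy(2) lists by simp
      moreover have "len (val (alternating r i k)) \<le> k"
        using len_val_le lists length_alternating by metis
      ultimately show False
        using v(3) by linarith
    qed
    moreover have "len v < len w"
      using v by simp
    ultimately have "positive (root v x)" "positive (root v y)"
      using less.hyps v(1) xy by auto
    then have pos: "positive (root v r)" "positive (root v i)"
      using xy(3) by (auto simp: doubleton_eq_iff)
    \<comment> \<open>Otherwise the braid relation would rewrite the end of the peeled word so that
      it ends in the other letter's place by \<open>i\<close>, and \<open>w\<close> would go down
      under \<open>s i\<close>.\<close>
    have "\<not> m r i \<le> enat (Suc k)"
    proof
      assume "m r i \<le> enat (Suc k)"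
      then obtain n where n: "m r i = enat n" "n \<le> Suc k"
        by (cases "m r i") auto
      have "n \<ge> 2"
        using m_ge_2 r i ri n by blast
      then obtain n' where n': "n = Suc n'"
        by (cases n) auto
      define p where "p = (if even n then alternating r i (Suc k - n) else alternating i r (Suc k - n))"
      have p: "p \<in> lists I" "length p = Suc k - n"
        using lists by (auto simp: p_def)
      have "alternating r i (Suc k) = p @ alternating r i n"
        unfolding p_def using alternating_add[of r i "Suc k - n" n] n(2) by simp
      then have "w = v \<otimes> (val p \<otimes> val (alternating r i n))"
        using v(2) lists p by (simp add: val_append)
      also have "val (alternating r i n) = val (alternating r i n') \<otimes> s i"
        using val_alternating_swap[OF r(1) i n(1)] alternating_snoc[of i r n'] lists i
        by (simp add: n' val_append del: alternating.simps)
      finally have "w \<otimes> s i = v \<otimes> val p \<otimes> val (alternating r i n')"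
        using v(1) p lists i by (simp add: m_assoc)
      also have "len \<dots> \<le> len v + (Suc k - n) + n'"
        using len_mult_le[of "v \<otimes> val p" "val (alternating r i n')"] len_mult_le[of v "val p"]
          len_val_le[OF p(1)] len_val_le[OF lists(1), of n'] v(1) p lists by simp
      finally show False
        using up v(3) n' n(2) by simp
    qed
    then have bound: "enat (Suc (Suc k)) \<le> m r i"
      by (metis Suc_ile_eq not_le)
    show ?thesis
      unfolding positive_def
    proof (intro allI impI)
      fix f :: "'i \<Rightarrow> real" assume f: "\<forall>i\<in>I. 0 \<le> f i"
      have "root w i f = fold refl (alternating r i (Suc k)) (act f v) i"
        unfolding root_def v(2) using v(1) lists by (simp add: act_mult act_val del: alternating.simps)
      moreover have "0 \<le> act f v r" "0 \<le> act f v i"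
        using pos f unfolding positive_def root_def by auto
      ultimately show "0 \<le> root w i f"
        using fold_refl_alternating_nonneg[OF r(1) i ri bound] by simp
    qed
  qed
qed

end

section \<open>Reflections and reflection orders\<close>

context coxeter_system
begin

lemma inv_mult_cancel [simp]: "x \<in> carrier W \<Longrightarrow> y \<in> carrier W \<Longrightarrow> inv x \<otimes> (x \<otimes> y) = y"
  by (simp add: m_assoc[symmetric])

lemma mult_inv_cancel [simp]: "x \<in> carrier W \<Longrightarrow> y \<in> carrier W \<Longrightarrow> x \<otimes> (inv x \<otimes> y) = y"
  by (simp add: m_assoc[symmetric])

section \<open>Roots as linear functionals and the invariance of the bilinear form\<close>

abbreviation unit_vector :: "'i \<Rightarrow> 'i \<Rightarrow> real" where
  "unit_vector j \<equiv> (\<lambda>k. if k = j then 1 else 0)"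

definition is_root :: "(('i \<Rightarrow> real) \<Rightarrow> real) \<Rightarrow> bool" where
  "is_root \<beta> \<longleftrightarrow> (\<exists>x\<in>carrier W. \<exists>i\<in>I. \<beta> = root x i)"

lemma is_rootI [intro]: "x \<in> carrier W \<Longrightarrow> i \<in> I \<Longrightarrow> is_root (root x i)"
  by (auto simp: is_root_def)

lemma root_one: "root \<one> i = (\<lambda>f. f i)"
  by (simp add: root_def)

lemma root_mult: "x \<in> carrier W \<Longrightarrow> y \<in> carrier W \<Longrightarrow> root (x \<otimes> y) i = (\<lambda>f. root y i (act f x))"
  by (simp add: root_def act_mult)

lemma root_mult_simple: "x \<in> carrier W \<Longrightarrow> i \<in> I \<Longrightarrow> root (x \<otimes> s i) i = (\<lambda>f. - root x i f)"
  by (simp add: root_def act_mult refl_def)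

lemma is_root_linear:
  assumes "is_root \<beta>"
  shows "\<beta> (\<lambda>j. a * f j + b * g j) = a * \<beta> f + b * \<beta> g"
  using assms by (auto simp: is_root_def root_def act_linear)

lemma is_root_act: "is_root \<beta> \<Longrightarrow> x \<in> carrier W \<Longrightarrow> is_root (\<lambda>f. \<beta> (act f x))"
proof -
  assume "is_root \<beta>" "x \<in> carrier W"
  then obtain y i where y: "y \<in> carrier W" "i \<in> I" "\<beta> = root y i"
    unfolding is_root_def by blast
  then have "(\<lambda>f. \<beta> (act f x)) = root (x \<otimes> y) i"
    using \<open>x \<in> carrier W\<close> by (simp add: root_mult)
  then show "is_root (\<lambda>f. \<beta> (act f x))"
    using y(1,2) \<open>x \<in> carrier W\<close> by (simp add: is_rootI)
qed

lemma is_root_refl: "is_root \<beta> \<Longrightarrow> i \<in> I \<Longrightarrow> is_root (\<lambda>f. \<beta> (refl i f))"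
  using is_root_act[of \<beta> "s i"] by simp

text \<open>Invariance of the bilinear form under \<open>W\<close>. Since \<open>form a\<close> is
  the functional paired with the simple root of \<open>a\<close>, a group element on one side can be
  moved to the other as its inverse.\<close>

lemma act_form_sym: "w \<in> carrier W \<Longrightarrow> act (form a) w b = act (form b) (inv w) a"
proof -
  have "act (form a) (val u) b = act (form b) (inv (val u)) a" if "u \<in> lists I" for u
    using that
  proof (induction u arbitrary: a b)
    case Nil
    then show ?case
      by (simp add: form_sym)
  next
    case (Cons i u)
    then have i: "i \<in> I" "u \<in> lists I"
      by auto
    have "refl i (form a) = (\<lambda>j. 1 * form a j + (- 2 * form a i) * form i j)"
      by (auto simp: refl_def)
    then have "act (form a) (val (i # u)) b = act (\<lambda>j. 1 * form a j + (- 2 * form a i) * form i j) (val u) b"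
      using i by (simp add: act_mult)
    also have "\<dots> = act (form a) (val u) b - 2 * form a i * act (form i) (val u) b"
      using i by (subst act_linear) auto
    also have "\<dots> = act (form b) (inv (val u)) a - 2 * form a i * act (form b) (inv (val u)) i"
      using Cons.IH i by simp
    also have "\<dots> = act (form b) (inv (val u) \<otimes> s i) a"
      using i form_sym[of a i] by (simp add: act_mult refl_def)
    also have "inv (val u) \<otimes> s i = inv (val (i # u))"
      using i by (simp add: inv_mult_group)
    finally show ?case .
  qed
  then show "w \<in> carrier W \<Longrightarrow> ?thesis"
    using word_exists by blast
qed

lemma coroot_root: "x \<in> carrier W \<Longrightarrow> (\<lambda>j. root x i (form j)) = act (form i) (inv x)"
  unfolding root_def by (rule ext) (rule act_form_sym)

text \<open>The inner function is the functional that the bilinear form associates with the root, so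
  the value is the norm of the root. By invariance it equals \<open>form i i\<close>.\<close>

lemma is_root_norm: "is_root \<beta> \<Longrightarrow> \<beta> (\<lambda>j. \<beta> (form j)) = 1"
  by (auto simp: is_root_def coroot_root) (simp add: root_def flip: act_mult)

lemma act_reflection:
  assumes "x \<in> carrier W" "i \<in> I"
  shows "act f (x \<otimes> s i \<otimes> inv x) = (\<lambda>j. f j - 2 * root x i f * root x i (form j))"
proof -
  have "refl i (act f x) = (\<lambda>j. 1 * act f x j + (- 2 * act f x i) * form i j)"
    by (auto simp: refl_def)
  then have "act f (x \<otimes> s i \<otimes> inv x) = act (\<lambda>j. 1 * act f x j + (- 2 * act f x i) * form i j) (inv x)"
    using assms by (simp add: act_mult)
  also have "\<dots> = (\<lambda>j. act (act f x) (inv x) j + (- 2 * act f x i) * act (form i) (inv x) j)"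
    using assms by (subst act_linear) auto
  also have "act (act f x) (inv x) = f"
    using assms by (simp flip: act_mult)
  finally show ?thesis
    unfolding coroot_root[OF assms(1), of i, symmetric] by (simp add: root_def)
qed

text \<open>A right descent \<open>i\<close> of \<open>x\<close> makes \<open>root x i\<close>
  negative, so it cannot be the coordinate functional that a trivial action would give.\<close>

lemma act_faithful:
  assumes "x \<in> carrier W" and trivial: "\<And>f. act f x = f"
  shows "x = \<one>"
proof (rule ccontr)
  assume "x \<noteq> \<one>"
  then obtain i where i: "i \<in> I" "len x = len (x \<otimes> s i) + 1"
    using right_descent_exists assms(1) by blast
  then have "positive (root (x \<otimes> s i) i)"
    using assms by (intro positive_root) auto
  then have "positive (\<lambda>f. - root x i f)"
    using root_mult_simple assms(1) i by simp
  then have "0 \<le> - root x i (\<lambda>_. 1)"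
    unfolding positive_def by auto
  then show False
    by (simp add: root_def trivial)
qed

lemma act_eqD:
  assumes "x \<in> carrier W" "y \<in> carrier W" "\<And>f. act f x = act f y"
  shows "x = y"
proof -
  have "x \<otimes> inv y = \<one>"
  proof (rule act_faithful)
    show "act f (x \<otimes> inv y) = f" for f
      using assms by (simp add: act_mult) (simp flip: act_mult)
  qed (use assms in auto)
  then show ?thesis
    using assms by (metis inv_closed inv_inv inv_equality)
qed

lemma root_positive_or_negative:
  assumes "is_root \<beta>"
  shows "positive \<beta> \<or> positive (\<lambda>f. - \<beta> f)"
proof -
  obtain x i where x: "x \<in> carrier W" "i \<in> I" "\<beta> = root x i"
    using assms by (auto simp: is_root_def)
  show ?thesis
    using len_mult_simple[OF x(1,2)] positive_root[of x i] positive_root[of "x \<otimes> s i" i] x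
    by (auto simp: root_mult_simple)
qed

lemma is_root_expansion:
  assumes "is_root \<beta>"
  shows "finite {j \<in> I. \<beta> (unit_vector j) \<noteq> 0}"
    and "\<beta> f = (\<Sum>j\<in>{j \<in> I. \<beta> (unit_vector j) \<noteq> 0}. \<beta> (unit_vector j) * f j)"
proof -
  obtain F c where F: "finite F" "F \<subseteq> I" "\<And>f. \<beta> f = (\<Sum>j\<in>F. c j * f j)"
    using assms act_finite_support unfolding is_root_def root_def by metis
  have *: "\<beta> (unit_vector j) = (if j \<in> F then c j else 0)" for j
    unfolding F(3) using F(1) by (simp add: if_distrib cong: if_cong)
  show "finite {j \<in> I. \<beta> (unit_vector j) \<noteq> 0}"
    unfolding * by (rule finite_subset[OF _ F(1)]) auto
  show "\<beta> f = (\<Sum>j\<in>{j \<in> I. \<beta> (unit_vector j) \<noteq> 0}. \<beta> (unit_vector j) * f j)"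
    unfolding * F(3)[of f] using F by (intro sum.mono_neutral_cong_right) auto
qed

text \<open>The value at the constant function \<open>1\<close> is the sum of the coordinates, the
  height of the root. The coordinates cannot all vanish because the root has norm
  \<open>1\<close>.\<close>

lemma positive_root_height:
  assumes "is_root \<beta>" "positive \<beta>"
  shows "0 < \<beta> (\<lambda>_. 1)"
proof -
  let ?F = "{j \<in> I. \<beta> (unit_vector j) \<noteq> 0}"
  have ge: "0 \<le> \<beta> (unit_vector j)" for j
    using assms(2) unfolding positive_def by auto
  have "?F \<noteq> {}"
  proof
    assume "?F = {}"
    then have "\<beta> (\<lambda>j. \<beta> (form j)) = 0"
      using is_root_expansion(2)[OF assms(1), of "\<lambda>j. \<beta> (form j)"] by (simp only: sum.empty)
    then show False
      using is_root_norm[OF assms(1)] by simp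
  qed
  then have "0 < (\<Sum>j\<in>?F. \<beta> (unit_vector j) * 1)"
    using ge is_root_expansion(1)[OF assms(1)] by (intro sum_pos) (auto simp: order_less_le)
  then show ?thesis
    using is_root_expansion(2)[OF assms(1), of "\<lambda>_. 1"] by simp
qed

lemma not_positive_and_negative: "is_root \<beta> \<Longrightarrow> positive \<beta> \<Longrightarrow> \<not> positive (\<lambda>f. - \<beta> f)"
  using positive_root_height[of \<beta>] unfolding positive_def by (metis leD neg_0_le_iff_le zero_le_one)

lemma root_proportional:
  assumes "is_root \<beta>" "is_root \<gamma>" and c: "\<beta> = (\<lambda>f. c * \<gamma> f)"
  shows "c = 1 \<or> c = -1"
proof -
  have "1 = \<beta> (\<lambda>j. \<beta> (form j))"
    using is_root_norm assms by simp
  also have "\<dots> = c * \<gamma> (\<lambda>j. c * \<gamma> (form j) + 0 * 0)"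
    by (simp add: c)
  also have "\<dots> = c * c"
    using is_root_linear[OF assms(2), of c "\<lambda>j. \<gamma> (form j)" 0 "\<lambda>_. 0"] is_root_norm[OF assms(2)] by simp
  finally show ?thesis
    by (metis square_eq_1_iff)
qed

lemma root_supported_at:
  assumes "is_root \<beta>" "positive \<beta>" "i \<in> I" and zero: "\<And>j. j \<in> I \<Longrightarrow> j \<noteq> i \<Longrightarrow> \<beta> (unit_vector j) = 0"
  shows "\<beta> = (\<lambda>f. f i)"
proof -
  have eq: "\<beta> f = \<beta> (unit_vector i) * f i" for f
  proof -
    have "\<beta> f = (\<Sum>j\<in>{j \<in> I. \<beta> (unit_vector j) \<noteq> 0}. \<beta> (unit_vector j) * f j)"
      by (rule is_root_expansion(2)[OF assms(1)])
    also have "\<dots> = (\<Sum>j\<in>{i}. \<beta> (unit_vector j) * f j)"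
      using zero assms(3) by (intro sum.mono_neutral_left) auto
    finally show ?thesis
      by simp
  qed
  have *: "\<beta> = (\<lambda>f. \<beta> (unit_vector i) * root \<one> i f)"
    unfolding root_one by (rule ext) (rule eq)
  moreover have "0 \<le> \<beta> (unit_vector i)"
    using assms(2) unfolding positive_def by auto
  ultimately have "\<beta> (unit_vector i) = 1"
    using root_proportional[OF assms(1) is_rootI[OF one_closed assms(3)] *] by auto
  then show ?thesis
    using * unfolding root_one by simp
qed

text \<open>\<open>refl i\<close> fixes the unit vectors other than that of \<open>i\<close>, so
  only the coordinate at \<open>i\<close> can change. If the reflected root is negative, every other
  coordinate is both nonnegative and nonpositive.\<close>

lemma simple_permutes_positive:
  assumes "is_root \<beta>" "positive \<beta>" "i \<in> I" "\<not> positive (\<lambda>f. \<beta> (refl i f))"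
  shows "\<beta> = (\<lambda>f. f i)"
proof (rule root_supported_at)
  fix j assume j: "j \<in> I" "j \<noteq> i"
  have "positive (\<lambda>f. - \<beta> (refl i f))"
    using root_positive_or_negative[OF is_root_refl] assms by blast
  moreover have "refl i (unit_vector j) = unit_vector j"
    using j by (auto simp: refl_def)
  ultimately have "0 \<le> - \<beta> (unit_vector j)"
    unfolding positive_def by (metis (mono_tags, lifting) zero_le_one order_refl)
  moreover have "0 \<le> \<beta> (unit_vector j)"
    using assms(2) unfolding positive_def by auto
  ultimately show "\<beta> (unit_vector j) = 0"
    by simp
qed (use assms in auto)

section \<open>Reflections, their positive roots and the strong exchange condition\<close>

lemma reflectionE:
  assumes "t \<in> reflections"
  obtains x i where "x \<in> carrier W" "i \<in> I" "t = x \<otimes> s i \<otimes> inv x"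
  using assms unfolding reflections_def by blast

lemma reflectionI: "x \<in> carrier W \<Longrightarrow> i \<in> I \<Longrightarrow> x \<otimes> s i \<otimes> inv x \<in> reflections"
  unfolding reflections_def by blast

lemma reflection_closed [simp]: "t \<in> reflections \<Longrightarrow> t \<in> carrier W"
  by (elim reflectionE) simp

lemma simple_reflection [simp]: "i \<in> I \<Longrightarrow> s i \<in> reflections"
  using reflectionI[of \<one> i] by simp

lemma conj_reflection:
  assumes "g \<in> carrier W" "t \<in> reflections"
  shows "g \<otimes> t \<otimes> inv g \<in> reflections"
proof -
  obtain x i where x: "x \<in> carrier W" "i \<in> I" "t = x \<otimes> s i \<otimes> inv x"
    using assms by (elim reflectionE)
  have "g \<otimes> t \<otimes> inv g = (g \<otimes> x) \<otimes> s i \<otimes> inv (g \<otimes> x)"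
    unfolding x(3) using x(1,2) assms(1) by (simp add: m_assoc inv_mult_group)
  then show ?thesis
    using reflectionI[of "g \<otimes> x" i] x assms(1) by simp
qed

lemma reflection_square [simp]: "t \<in> reflections \<Longrightarrow> t \<otimes> t = \<one>"
proof -
  assume "t \<in> reflections"
  then obtain x i where x: "x \<in> carrier W" "i \<in> I" "t = x \<otimes> s i \<otimes> inv x"
    by (elim reflectionE)
  show ?thesis
    unfolding x(3) using x(1,2) by (simp add: m_assoc)
qed

lemma reflection_inv [simp]: "t \<in> reflections \<Longrightarrow> inv t = t"
  by (simp add: inv_equality)

lemma mult_reflection_reflection [simp]: "x \<in> carrier W \<Longrightarrow> t \<in> reflections \<Longrightarrow> x \<otimes> t \<otimes> t = x"
  by (simp add: m_assoc)

lemma one_not_reflection [simp]: "\<one> \<notin> reflections"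
proof
  assume "\<one> \<in> reflections"
  then obtain x i where x: "x \<in> carrier W" "i \<in> I" "\<one> = x \<otimes> s i \<otimes> inv x"
    by (elim reflectionE)
  have "s i = inv x \<otimes> (x \<otimes> s i \<otimes> inv x) \<otimes> x"
    using x(1,2)
    by (simp add: m_assoc)
  also have "\<dots> = \<one>"
    using x(1) unfolding x(3)[symmetric] by simp
  finally show False
    using len_simple[OF x(2)] by simp
qed

text \<open>A reflection is a conjugate of a generator in many ways. \<open>rt\<close> picks the
  positive root of one of them, and \<open>rt_eqI\<close> shows that the choice does not
  matter.\<close>

definition rt :: "'w \<Rightarrow> ('i \<Rightarrow> real) \<Rightarrow> real" where
  "rt t = (SOME \<beta>. positive \<beta> \<and> (\<exists>x\<in>carrier W. \<exists>i\<in>I. t = x \<otimes> s i \<otimes> inv x \<and> \<beta> = root x i))"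

lemma rt_representative:
  assumes "t \<in> reflections"
  obtains x i where "x \<in> carrier W" "i \<in> I" "t = x \<otimes> s i \<otimes> inv x" "rt t = root x i"
    "positive (root x i)"
proof -
  obtain x i where x: "x \<in> carrier W" "i \<in> I" "t = x \<otimes> s i \<otimes> inv x"
    using assms by (elim reflectionE)
  have "\<exists>\<beta>. positive \<beta> \<and> (\<exists>x\<in>carrier W. \<exists>i\<in>I. t = x \<otimes> s i \<otimes> inv x \<and> \<beta> = root x i)"
  proof (cases "positive (root x i)")
    case False
    then have "positive (root (x \<otimes> s i) i)"
      using root_positive_or_negative[of "root x i"] x root_mult_simple by auto
    moreover have "t = (x \<otimes> s i) \<otimes> s i \<otimes> inv (x \<otimes> s i)"
      using x by (simp add: inv_mult_group m_assoc)
    ultimately show ?thesis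
      using x(1,2) by (intro exI[of _ "root (x \<otimes> s i) i"] conjI bexI[of _ "x \<otimes> s i"] bexI[of _ i]) auto
  next
    case True
    then show ?thesis
      using x by (intro exI[of _ "root x i"] conjI bexI[of _ x] bexI[of _ i]) auto
  qed
  from someI_ex[OF this] show ?thesis
    using that unfolding rt_def[symmetric] by metis
qed

lemma rt_root [simp]: "t \<in> reflections \<Longrightarrow> is_root (rt t)"
  by (elim rt_representative) (simp add: is_rootI)

lemma rt_positive [simp]: "t \<in> reflections \<Longrightarrow> positive (rt t)"
  by (elim rt_representative) simp

lemma act_rt:
  assumes "t \<in> reflections"
  shows "act f t = (\<lambda>j. f j - 2 * rt t f * rt t (form j))"
proof -
  obtain x i where x: "x \<in> carrier W" "i \<in> I" "t = x \<otimes> s i \<otimes> inv x" "rt t = root x i"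
    using assms by (rule rt_representative)
  show ?thesis
    unfolding x(4) unfolding x(3) by (rule act_reflection[OF x(1,2)])
qed

lemma rt_linear: "t \<in> reflections \<Longrightarrow> rt t (\<lambda>j. a * f j + b * g j) = a * rt t f + b * rt t g"
  by (simp add: is_root_linear)

text \<open>Two roots with the same reflection satisfy the same reflection formula and are therefore
  proportional; the factor \<open>c\<close> is found by evaluating at the functional dual to the
  second root. Norm \<open>1\<close> leaves only the signs, and positivity decides between
  them.\<close>

lemma rt_eqI:
  assumes "x \<in> carrier W" "i \<in> I" "positive (root x i)"
  shows "rt (x \<otimes> s i \<otimes> inv x) = root x i"
proof -
  let ?t = "x \<otimes> s i \<otimes> inv x"
  have t: "?t \<in> reflections"
    using assms by (simp add: reflectionI)
  define c where "c = rt ?t (\<lambda>j. root x i (form j))"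
  have "rt ?t f = c * root x i f" for f
  proof -
    have "f j - 2 * rt ?t f * rt ?t (form j) = f j - 2 * root x i f * root x i (form j)" for j
      using act_rt[OF t, of f] act_reflection[OF assms(1,2), of f] by (metis (mono_tags))
    then have "(\<lambda>j. rt ?t f * rt ?t (form j) + 0 * 0) = (\<lambda>j. root x i f * root x i (form j) + 0 * 0)"
      by auto
    then have "rt ?t (\<lambda>j. rt ?t f * rt ?t (form j) + 0 * 0)
        = rt ?t (\<lambda>j. root x i f * root x i (form j) + 0 * 0)"
      by simp
    then have "rt ?t f * 1 = root x i f * c"
      using rt_linear[OF t, of _ "\<lambda>j. rt ?t (form j)" 0 "\<lambda>_. 0"] rt_linear[OF t, of _ "\<lambda>j. root x i (form j)" 0 "\<lambda>_. 0"]
      unfolding c_def by (simp add: is_root_norm t)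
    then show ?thesis
      by simp
  qed
  then have eq: "rt ?t = (\<lambda>f. c * root x i f)"
    by blast
  moreover have "0 < rt ?t (\<lambda>_. 1)" "0 < root x i (\<lambda>_. 1)"
    using positive_root_height t assms by (simp_all add: is_rootI)
  then have "c > 0"
    unfolding eq by (simp add: zero_less_mult_iff)
  ultimately have "c = 1"
    using root_proportional[OF rt_root[OF t] is_rootI[OF assms(1,2)] eq] by auto
  then show ?thesis
    using eq by simp
qed

lemma rt_simple [simp]: "i \<in> I \<Longrightarrow> rt (s i) = (\<lambda>f. f i)"
  using rt_eqI[of \<one> i] by (simp add: root_one positive_def)

lemma rt_proportional_eq:
  assumes "t \<in> reflections" "t' \<in> reflections" "rt t = (\<lambda>f. c * rt t' f)"
  shows "t = t'"
proof (rule act_eqD)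
  have "c * c = 1"
    using root_proportional[OF _ _ assms(3)] assms(1,2) by auto
  have "2 * (c * x) * (c * y) = (c * c) * (2 * x * y)" for x y
    by simp
  then have "2 * (c * x) * (c * y) = 2 * x * y" for x y
    unfolding \<open>c * c = 1\<close> by simp
  then show "act f t = act f t'" for f
    unfolding act_rt[OF assms(1)] act_rt[OF assms(2)] by (simp only: assms(3))
qed (use assms in auto)

lemma rt_inj: "t \<in> reflections \<Longrightarrow> t' \<in> reflections \<Longrightarrow> rt t = rt t' \<Longrightarrow> t = t'"
  using rt_proportional_eq[of t t' 1] by simp

lemma rt_act_self: "t \<in> reflections \<Longrightarrow> rt t (act f t) = - rt t f"
  using rt_linear[of t 1 f "- 2 * rt t f" "\<lambda>j. rt t (form j)"] act_rt[of t f]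
  by (simp add: is_root_norm)

text \<open>The pair \<open>(x, t)\<close> is \<open>positive_at\<close> iff \<open>x\<close> maps the positive root of \<open>t\<close> to a positive root.\<close>

definition positive_at :: "'w \<Rightarrow> 'w \<Rightarrow> bool" where
  "positive_at x t \<longleftrightarrow> positive (\<lambda>f. rt t (act f x))"

lemma not_positive_at_iff:
  assumes "x \<in> carrier W" "t \<in> reflections"
  shows "\<not> positive_at x t \<longleftrightarrow> positive (\<lambda>f. - rt t (act f x))"
  using root_positive_or_negative[OF is_root_act[of "rt t" x]]
    not_positive_and_negative[OF is_root_act[of "rt t" x]] assms
  unfolding positive_at_def by auto

lemma positive_at_mult:
  assumes "x \<in> carrier W" "t \<in> reflections"
  shows "positive_at (x \<otimes> t) t \<longleftrightarrow> \<not> positive_at x t"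
  unfolding not_positive_at_iff[OF assms] unfolding positive_at_def
  using assms by (simp add: act_mult rt_act_self)

text \<open>Follow the root of \<open>t\<close> through the word from its right end. At the letter
  where it turns negative it is the simple root of that letter, by
  \<open>simple_permutes_positive\<close>. Hence conjugating \<open>t\<close> by the remaining
  suffix gives this letter, and multiplication by \<open>t\<close> deletes it.\<close>

lemma strong_exchange:
  assumes "u \<in> lists I" "t \<in> reflections" "\<not> positive_at (val u) t"
  shows "\<exists>a i b. u = a @ i # b \<and> val u \<otimes> t = val (a @ b)"
  using assms
proof (induction u)
  case Nil
  then show ?case
    by (simp add: positive_at_def)
next
  case (Cons i u)
  then have i: "i \<in> I" "u \<in> lists I"
    by auto
  show ?case
  proof (cases "positive_at (val u) t")
    case False
    then obtain a k b where *: "u = a @ k # b" "val u \<otimes> t = val (a @ b)"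
      using Cons i by auto
    have "val (i # u) \<otimes> t = s i \<otimes> (val u \<otimes> t)"
      using i assms(2) by (simp add: m_assoc)
    then have "val (i # u) \<otimes> t = val ((i # a) @ b)"
      unfolding *(2) by simp
    then show ?thesis
      using *(1) by (intro exI[of _ "i # a"]) auto
  next
    case True
    obtain y j where y: "y \<in> carrier W" "j \<in> I" "t = y \<otimes> s j \<otimes> inv y" "rt t = root y j"
      using assms(2) by (rule rt_representative)
    let ?g = "val u \<otimes> y"
    have g: "?g \<in> carrier W" "root ?g j = (\<lambda>f. rt t (act f (val u)))"
      using i y by (simp_all add: root_mult)
    then have pos: "positive (root ?g j)"
      using True by (simp add: positive_at_def)
    have "\<not> positive (\<lambda>f. root ?g j (refl i f))"
      using Cons.prems(2) i by (simp add: g positive_at_def act_mult)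
    then have "root ?g j = root \<one> i"
      using simple_permutes_positive[OF is_rootI pos i(1)] g(1) y(2) by (simp add: root_one)
    then have "rt (?g \<otimes> s j \<otimes> inv ?g) = rt (s i)"
      using rt_eqI[OF g(1) y(2) pos] i by (simp add: root_one)
    then have "?g \<otimes> s j \<otimes> inv ?g = s i"
      using rt_inj g y i by (simp add: conj_reflection)
    moreover have "?g \<otimes> s j \<otimes> inv ?g \<otimes> val u = val u \<otimes> t"
      using i y by (simp add: inv_mult_group m_assoc)
    ultimately have "val (i # u) \<otimes> t = val u"
      using i assms(2) by (simp add: m_assoc)
    then show ?thesis
      by (intro exI[of _ "[]"]) auto
  qed
qed

text \<open>A negative sign shortens by strong exchange. Of \<open>x\<close> and \<open>x t\<close>
  exactly one is positive at \<open>t\<close>, so the converse follows by applying this to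
  both.\<close>

theorem positive_at_iff_len:
  assumes "x \<in> carrier W" "t \<in> reflections"
  shows "positive_at x t \<longleftrightarrow> len x < len (x \<otimes> t)"
proof -
  have *: "len (y \<otimes> t) < len y" if y: "y \<in> carrier W" "\<not> positive_at y t" for y
  proof -
    obtain u where u: "u \<in> lists I" "val u = y" "length u = len y"
      using reduced_word_exists y by blast
    then obtain a i b where "u = a @ i # b" "val u \<otimes> t = val (a @ b)"
      using strong_exchange assms(2) y by blast
    then show ?thesis
      using u len_val_le[of "a @ b"] by auto
  qed
  show ?thesis
    using *[of x] *[of "x \<otimes> t"] positive_at_mult[OF assms] assms by fastforce
qed

lemma strong_exchange_len:
  assumes "u \<in> lists I" "t \<in> reflections" "len (val u \<otimes> t) < len (val u)"
  shows "\<exists>a i b. u = a @ i # b \<and> val u \<otimes> t = val (a @ b)"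
  using strong_exchange[OF assms(1,2)] positive_at_iff_len[of "val u" t] assms by auto

definition cj :: "'i \<Rightarrow> 'w \<Rightarrow> 'w" where
  "cj i t = s i \<otimes> t \<otimes> s i"

lemma cj_reflection [simp]: "i \<in> I \<Longrightarrow> t \<in> reflections \<Longrightarrow> cj i t \<in> reflections"
  unfolding cj_def using conj_reflection[of "s i" t] by simp

lemma cj_cj [simp]: "i \<in> I \<Longrightarrow> t \<in> carrier W \<Longrightarrow> cj i (cj i t) = t"
  by (simp add: cj_def m_assoc)

lemma cj_simple [simp]: "i \<in> I \<Longrightarrow> cj i (s i) = s i"
  by (simp add: cj_def)

lemma cj_eq_simple_iff [simp]: "i \<in> I \<Longrightarrow> t \<in> carrier W \<Longrightarrow> cj i t = s i \<longleftrightarrow> t = s i"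
  by (metis cj_cj cj_simple)

lemma mult_cj: "x \<in> carrier W \<Longrightarrow> i \<in> I \<Longrightarrow> t \<in> carrier W \<Longrightarrow> x \<otimes> s i \<otimes> cj i t = x \<otimes> t \<otimes> s i"
  by (simp add: cj_def m_assoc)

lemma cj_representative:
  assumes "t \<in> reflections" "i \<in> I" "t \<noteq> s i" "x \<in> carrier W" "k \<in> I" "t = x \<otimes> s k \<otimes> inv x"
    "positive (root x k)"
  shows "cj i t = (s i \<otimes> x) \<otimes> s k \<otimes> inv (s i \<otimes> x)" and "positive (root (s i \<otimes> x) k)"
proof -
  show "cj i t = (s i \<otimes> x) \<otimes> s k \<otimes> inv (s i \<otimes> x)"
    using assms by (simp add: cj_def inv_mult_group m_assoc)
  have "positive (\<lambda>f. root x k (refl i f))"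
  proof (rule ccontr)
    assume "\<not> ?thesis"
    then have "root x k = rt (s i)"
      using simple_permutes_positive[of "root x k" i] assms by (simp add: is_rootI)
    then show False
      using rt_eqI[of x k] rt_inj[of t "s i"] assms by simp
  qed
  then show "positive (root (s i \<otimes> x) k)"
    using assms by (simp add: root_mult)
qed

lemma rt_cj:
  assumes "t \<in> reflections" "i \<in> I" "t \<noteq> s i"
  shows "rt (cj i t) = (\<lambda>f. rt t (refl i f))"
proof -
  obtain x k where x: "x \<in> carrier W" "k \<in> I" "t = x \<otimes> s k \<otimes> inv x" "rt t = root x k"
    "positive (root x k)"
    using assms(1) by (rule rt_representative)
  show ?thesis
    using rt_eqI[of "s i \<otimes> x" k] cj_representative[OF assms x(1,2,3,5)] x assms
    by (simp add: root_mult)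
qed

text \<open>The second axiom of a height function, for the length. Conjugation by \<open>s i\<close>
  permutes the positive roots other than that of \<open>s i\<close>, so \<open>x\<close> at
  \<open>t\<close> and \<open>x s i\<close> at \<open>cj i t\<close> have the same sign.\<close>

lemma len_height_cond:
  assumes "x \<in> carrier W" "t \<in> reflections" "i \<in> I" "t \<noteq> s i"
  shows "len x < len (x \<otimes> t) \<longleftrightarrow> len (x \<otimes> s i) < len (x \<otimes> t \<otimes> s i)"
proof -
  have "positive_at (x \<otimes> s i) (cj i t) \<longleftrightarrow> positive_at x t"
    unfolding positive_at_def using assms by (simp add: rt_cj act_mult)
  then show ?thesis
    using positive_at_iff_len[of x t] positive_at_iff_len[of "x \<otimes> s i" "cj i t"] assms
    by (simp add: mult_cj)
qed

section \<open>The bilinear form on positive roots and reflection orders\<close>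

definition pairing :: "'w \<Rightarrow> 'w \<Rightarrow> real" where
  "pairing a b = rt b (\<lambda>j. rt a (form j))"

lemma pairing_representative:
  assumes "x \<in> carrier W" "i \<in> I" "positive (root x i)" "y \<in> carrier W" "k \<in> I" "positive (root y k)"
  shows "pairing (x \<otimes> s i \<otimes> inv x) (y \<otimes> s k \<otimes> inv y) = act (form i) (inv x \<otimes> y) k"
  using assms by (simp add: pairing_def rt_eqI coroot_root act_mult) (simp add: root_def)

lemma pairing_sym:
  assumes "a \<in> reflections" "b \<in> reflections"
  shows "pairing a b = pairing b a"
proof -
  obtain x i where x: "x \<in> carrier W" "i \<in> I" "a = x \<otimes> s i \<otimes> inv x" "positive (root x i)"
    using assms(1) by (rule rt_representative)
  obtain y k where y: "y \<in> carrier W" "k \<in> I" "b = y \<otimes> s k \<otimes> inv y" "positive (root y k)"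
    using assms(2) by (rule rt_representative)
  show ?thesis
    unfolding x(3) y(3) using x y act_form_sym[of "inv x \<otimes> y" i k]
    by (simp add: pairing_representative inv_mult_group)
qed

lemma pairing_cj:
  assumes "a \<in> reflections" "b \<in> reflections" "i \<in> I" "a \<noteq> s i" "b \<noteq> s i"
  shows "pairing (cj i a) (cj i b) = pairing a b"
proof -
  obtain x j where x: "x \<in> carrier W" "j \<in> I" "a = x \<otimes> s j \<otimes> inv x" "positive (root x j)"
    using assms(1) by (rule rt_representative)
  obtain y k where y: "y \<in> carrier W" "k \<in> I" "b = y \<otimes> s k \<otimes> inv y" "positive (root y k)"
    using assms(2) by (rule rt_representative)
  note x' = cj_representative[OF assms(1,3,4) x]
  note y' = cj_representative[OF assms(2,3,5) y]
  have "inv (s i \<otimes> x) \<otimes> (s i \<otimes> y) = inv x \<otimes> y"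
    using x y assms by (simp add: inv_mult_group m_assoc)
  then show ?thesis
    unfolding x'(1) y'(1) using pairing_representative[OF _ x(2) x'(2) _ y(2) y'(2)]
      pairing_representative[OF x(1,2,4) y(1,2,4)] x y assms(3) by simp
qed

lemma rt_cj_pairing:
  assumes "t \<in> reflections" "i \<in> I" "t \<noteq> s i"
  shows "rt (cj i t) f = rt t f - 2 * f i * pairing (s i) t"
  using rt_linear[of t 1 f "- 2 * f i" "\<lambda>j. form j i"] assms form_sym[of i]
  by (simp add: rt_cj refl_def pairing_def)

lemma pairing_simple_cj:
  assumes "b \<in> reflections" "i \<in> I" "b \<noteq> s i"
  shows "pairing (s i) (cj i b) = - pairing (s i) b"
  using rt_cj_pairing[OF assms, of "\<lambda>j. form j i"] assms(2)
  by (simp add: pairing_def)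

text \<open>Dyer's condition on positive combinations of two roots. The relation \<open>lt\<close>
  is constrained on \<open>reflections\<close> only, so membership in \<open>reflections\<close> has
  to be carried along wherever transitivity is used.\<close>

definition reflection_order :: "('w \<Rightarrow> 'w \<Rightarrow> bool) \<Rightarrow> bool" where
  "reflection_order lt \<longleftrightarrow>
     (\<forall>a\<in>reflections. \<not> lt a a) \<and>
     (\<forall>a\<in>reflections. \<forall>b\<in>reflections. \<forall>c\<in>reflections. lt a b \<longrightarrow> lt b c \<longrightarrow> lt a c) \<and>
     (\<forall>a\<in>reflections. \<forall>b\<in>reflections. a = b \<or> lt a b \<or> lt b a) \<and>
     (\<forall>a\<in>reflections. \<forall>b\<in>reflections. \<forall>c\<in>reflections. \<forall>p>0. \<forall>q>0.
        rt c = (\<lambda>f. p * rt a f + q * rt b f) \<longrightarrow> lt a b \<longrightarrow> lt a c \<and> lt c b)"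

lemma reflection_orderD:
  assumes "reflection_order lt" "a \<in> reflections" "b \<in> reflections" "c \<in> reflections"
  shows "\<not> lt a a" "lt a b \<Longrightarrow> lt b c \<Longrightarrow> lt a c" "a = b \<or> lt a b \<or> lt b a"
    "\<lbrakk>p > 0; q > 0; rt c = (\<lambda>f. p * rt a f + q * rt b f); lt a b\<rbrakk> \<Longrightarrow> lt a c"
    "\<lbrakk>p > 0; q > 0; rt c = (\<lambda>f. p * rt a f + q * rt b f); lt a b\<rbrakk> \<Longrightarrow> lt c b"
proof -
  note parts = assms(1)[unfolded reflection_order_def]
  note irrefl = parts[THEN conjunct1]
    and trans = parts[THEN conjunct2, THEN conjunct1]
    and total = parts[THEN conjunct2, THEN conjunct2, THEN conjunct1]
    and between = parts[THEN conjunct2, THEN conjunct2, THEN conjunct2]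
  show "\<not> lt a a"
    using irrefl assms(2) by (rule bspec)
  show "lt a b \<Longrightarrow> lt b c \<Longrightarrow> lt a c"
    using trans[rule_format, OF assms(2-4)] .
  show "a = b \<or> lt a b \<or> lt b a"
    using total[rule_format, OF assms(2,3)] .
  show "\<lbrakk>p > 0; q > 0; rt c = (\<lambda>f. p * rt a f + q * rt b f); lt a b\<rbrakk> \<Longrightarrow> lt a c"
    "\<lbrakk>p > 0; q > 0; rt c = (\<lambda>f. p * rt a f + q * rt b f); lt a b\<rbrakk> \<Longrightarrow> lt c b"
    using between[rule_format, OF assms(2-4)] by simp_all
qed

lemma reflection_order_converse:
  assumes "reflection_order lt"
  shows "reflection_order (\<lambda>a b. lt b a)"
  unfolding reflection_order_def
proof (intro conjI ballI allI impI)
  fix a b c and p q :: real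
  assume "a \<in> reflections" "b \<in> reflections" "c \<in> reflections" "0 < p" "0 < q" "lt b a"
    and "rt c = (\<lambda>f. p * rt a f + q * rt b f)"
  then show "lt c a" "lt b c"
    using reflection_orderD(4,5)[OF assms, of b a c q p] by (simp_all add: add.commute)
qed (use reflection_orderD[OF assms] in \<open>blast+\<close>)

text \<open>The roots of \<open>t\<close>, \<open>cj i t\<close> and \<open>s i\<close> lie in one
  plane. According to the sign of the pairing, \<open>cj i t\<close> lies between \<open>t\<close>
  and \<open>s i\<close>, or equals \<open>t\<close>, or \<open>t\<close> lies between
  \<open>cj i t\<close> and \<open>s i\<close>. In each case both are on the same side of
  \<open>s i\<close>.\<close>

lemma less_cj_simple:
  assumes lt: "reflection_order lt" and t: "t \<in> reflections" "i \<in> I" "lt t (s i)"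
  shows "lt (cj i t) (s i)"
proof -
  have ne: "t \<noteq> s i"
    using reflection_orderD(1)[OF lt] t by blast
  define k where "k = pairing (s i) t"
  have eq: "rt (cj i t) f = rt t f - 2 * k * f i" for f
    using rt_cj_pairing[OF t(1,2) ne] by (simp add: k_def)
  consider "k < 0" | "k = 0" | "k > 0"
    by linarith
  then show ?thesis
  proof cases
    case 1
    then show ?thesis
      using reflection_orderD(5)[OF lt t(1) simple_reflection[OF t(2)] cj_reflection[OF t(2,1)], of 1 "- 2 * k"] eq t
      by (auto simp: fun_eq_iff)
  next
    case 2
    then have "cj i t = t"
      using eq rt_inj t by (simp add: fun_eq_iff)
    then show ?thesis
      using t by simp
  next
    case 3
    have *: "rt t = (\<lambda>f. 1 * rt (cj i t) f + 2 * k * rt (s i) f)"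
      using eq t(2) by (auto simp: fun_eq_iff)
    have "lt (s i) t" if "lt (s i) (cj i t)"
      using reflection_orderD(4)[OF lt simple_reflection[OF t(2)] cj_reflection[OF t(2,1)] t(1), of "2 * k" 1] 3 * that
      by (simp add: add.commute)
    then have "\<not> lt (s i) (cj i t)"
      using reflection_orderD(1,2)[OF lt t(1) simple_reflection[OF t(2)] t(1)] t(3) by blast
    then show ?thesis
      using reflection_orderD(3)[OF lt cj_reflection[OF t(2,1)] simple_reflection[OF t(2)] t(1)] ne t
      by auto
  qed
qed

lemma less_cj_simple_iff:
  assumes "reflection_order lt" "t \<in> reflections" "i \<in> I"
  shows "lt (cj i t) (s i) \<longleftrightarrow> lt t (s i)"
  using less_cj_simple[OF assms] less_cj_simple[OF assms(1) _ assms(3), of "cj i t"] assms by auto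

text \<open>Dyer's upper conjugate: the part above \<open>s i\<close> is conjugated and \<open>s i\<close> becomes the maximum.\<close>

definition upper_conjugate :: "'i \<Rightarrow> ('w \<Rightarrow> 'w \<Rightarrow> bool) \<Rightarrow> 'w \<Rightarrow> 'w \<Rightarrow> bool" where
  "upper_conjugate i lt a b \<longleftrightarrow> a \<noteq> s i \<and> (b = s i \<or>
     (if lt a (s i) then lt b (s i) \<longrightarrow> lt a b else \<not> lt b (s i) \<and> lt (cj i a) (cj i b)))"

text \<open>Conjugation by \<open>s i\<close> preserves each side of \<open>s i\<close> and acts
  linearly on the roots of the other reflections. Within one side betweenness is thus inherited;
  what needs care is \<open>b = s i\<close>, whose root changes sign, and pairs on different
  sides.\<close>

lemma reflection_order_upper_conjugate:
  assumes lt: "reflection_order lt" and i: "i \<in> I"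
  shows "reflection_order (upper_conjugate i lt)"
proof -
  note D = reflection_orderD[OF lt]
  note [simp] = less_cj_simple_iff[OF lt _ i]
  have simple: "s i \<in> reflections"
    using i by simp
  have inj: "cj i a = cj i b \<longleftrightarrow> a = b" if "a \<in> reflections" "b \<in> reflections" for a b
    using that i by (metis cj_cj reflection_closed)
  have asym: "lt a b \<Longrightarrow> \<not> lt b a" if "a \<in> reflections" "b \<in> reflections" for a b
    using that D by blast
  have above: "\<not> lt a (s i) \<longleftrightarrow> lt (s i) a" if "a \<in> reflections" "a \<noteq> s i" for a
    using that D(3)[OF that(1) simple simple] asym[OF that(1) simple] by blast
  let ?uc = "upper_conjugate i lt"
  show ?thesis
    unfolding reflection_order_def
  proof (intro conjI ballI allI impI)
    show "\<not> ?uc a a" if "a \<in> reflections" for a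
      using that D(1) i unfolding upper_conjugate_def by auto
    show "?uc a c" if "a \<in> reflections" "b \<in> reflections" "c \<in> reflections" "?uc a b" "?uc b c" for a b c
    proof -
      have "lt a b \<Longrightarrow> lt b c \<Longrightarrow> lt a c" "lt (cj i a) (cj i b) \<Longrightarrow> lt (cj i b) (cj i c) \<Longrightarrow> lt (cj i a) (cj i c)"
        using D(2) that i cj_reflection by meson+
      then show ?thesis
        using that unfolding upper_conjugate_def by (auto split: if_splits)
    qed
    show "a = b \<or> ?uc a b \<or> ?uc b a" if "a \<in> reflections" "b \<in> reflections" for a b
      using D(3)[OF that that(1)] D(3)[OF cj_reflection[OF i that(1)] cj_reflection[OF i that(2)] that(1)] inj[OF that]
      unfolding upper_conjugate_def by auto
  next
    fix a b c and p q :: real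
    assume abc: "a \<in> reflections" "b \<in> reflections" "c \<in> reflections" and pq: "0 < p" "0 < q"
      and c: "rt c = (\<lambda>f. p * rt a f + q * rt b f)" and uc: "?uc a b"
    have a: "a \<noteq> s i"
      using uc by (simp add: upper_conjugate_def)
    \<comment> \<open>A simple root spans an extremal ray of the positive cone: if it is a positive
      combination of two positive roots, both are equal to it.\<close>
    have cs: "c \<noteq> s i"
    proof
      assume "c = s i"
      have "rt a (unit_vector j) = 0" if "j \<in> I" "j \<noteq> i" for j
      proof -
        have "p * rt a (unit_vector j) + q * rt b (unit_vector j) = 0"
          using c \<open>c = s i\<close> i that by (metis (mono_tags, lifting) rt_simple)
        moreover have "0 \<le> rt a (unit_vector j)" "0 \<le> rt b (unit_vector j)"
          using rt_positive[OF abc(1)] rt_positive[OF abc(2)] unfolding positive_def by auto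
        ultimately have "p * rt a (unit_vector j) = 0"
          using pq by (smt (verit) mult_nonneg_nonneg)
        then show ?thesis
          using pq by simp
      qed
      then have "rt a = rt (s i)"
        using root_supported_at[of "rt a" i] abc i by simp
      then show False
        using rt_inj a abc simple by blast
    qed
    have btw: "lt a b \<Longrightarrow> lt a c \<and> lt c b" "lt b a \<Longrightarrow> lt b c \<and> lt c a"
      using D(4,5)[OF abc pq c] D(4,5)[OF abc(2,1,3) pq(2,1)] c by (auto simp: add.commute)
    have conj: "rt (cj i c) = (\<lambda>f. p * rt (cj i a) f + q * (if b = s i then - rt b f else rt (cj i b) f))"
      using abc cs a i c by (auto simp: rt_cj refl_def)
    show "?uc a c" "?uc c b"
      unfolding atomize_conj
    proof (cases "b = s i")
      case True
      have low: "lt a c" if "lt a (s i)"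
        using btw(1) True that by simp
      have "\<not> lt c (s i) \<and> lt (cj i a) (cj i c)" if "\<not> lt a (s i)"
      proof -
        have "lt (s i) c"
          using that above[OF abc(1) a] btw(2) True by simp
        then have c': "\<not> lt c (s i)"
          using asym[OF simple abc(3)] by simp
        then have "lt (s i) (cj i a)" "lt (s i) (cj i c)"
          using that above[of "cj i a"] above[of "cj i c"] abc a cs i by simp_all
        \<comment> \<open>Under conjugation the root of \<open>s i\<close> changes sign, so its term
          moves to the other side of the equation: now \<open>cj i a\<close> lies between
          \<open>s i\<close> and \<open>cj i c\<close>.\<close>
        moreover have "rt (cj i a) = (\<lambda>f. (q / p) * rt (s i) f + (1 / p) * rt (cj i c) f)"
          using conj True pq i by (auto simp: field_simps fun_eq_iff)
        ultimately show ?thesis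
          using D(5)[OF simple cj_reflection[OF i abc(3)] cj_reflection[OF i abc(1)], of "q / p" "1 / p"] pq c' by simp
      qed
      then show "?uc a c \<and> ?uc c b"
        using True a cs low unfolding upper_conjugate_def by simp
    next
      case False
      have btw': "lt (cj i a) (cj i b) \<Longrightarrow> lt (cj i a) (cj i c) \<and> lt (cj i c) (cj i b)"
        using D(4,5)[OF cj_reflection[OF i abc(1)] cj_reflection[OF i abc(2)] cj_reflection[OF i abc(3)] pq]
          conj False by simp
      have tr: "lt x y \<Longrightarrow> lt y z \<Longrightarrow> lt x z" if "x \<in> reflections" "y \<in> reflections" "z \<in> reflections" for x y z
        using that D(2) by blast
      show "?uc a c \<and> ?uc c b"
      proof (cases "lt a (s i)")
        case lta: True
        show ?thesis
        proof (cases "lt b (s i)")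
          case True
          then have "lt a b"
            using uc lta False by (simp add: upper_conjugate_def)
          then show ?thesis
            using btw True lta tr[OF abc(3,2) simple] a cs False unfolding upper_conjugate_def by auto
        next
          \<comment> \<open>Here \<open>a\<close> is below \<open>s i\<close> and \<open>b\<close>
            above, so \<open>a\<close> precedes \<open>b\<close> both before and after conjugation.
            Then \<open>c\<close> lies between them in both orders, whichever side of
            \<open>s i\<close> it is on.\<close>
          case ltb: False
          then have sb: "lt (s i) b"
            using above abc False by blast
          then have "lt a b"
            using tr[OF abc(1) simple abc(2)] lta by blast
          moreover have "lt (cj i a) (s i)" "lt (s i) (cj i b)"
            using lta ltb above[of "cj i b"] abc i False by auto
          then have "lt (cj i a) (cj i b)"
            using tr[of "cj i a" "s i" "cj i b"] abc i by simp
          ultimately show ?thesis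
            using btw btw' lta ltb a cs False unfolding upper_conjugate_def by auto
        qed
      next
        case lta: False
        then have ltb: "\<not> lt b (s i)" and *: "lt (cj i a) (cj i b)"
          using uc False by (simp_all add: upper_conjugate_def)
        have "lt (s i) a" "lt (s i) b"
          using lta ltb above abc a False by blast+
        moreover have "a = b \<or> lt a b \<or> lt b a"
          using D(3)[OF abc(1,2,3)] .
        moreover have "a \<noteq> b"
          using * D(1)[of "cj i a"] abc i by auto
        ultimately have "lt (s i) c"
          using btw tr[OF simple abc(1,3)] tr[OF simple abc(2,3)] by blast
        then have "\<not> lt c (s i)"
          using asym abc simple by blast
        then show ?thesis
          using btw' * lta ltb a cs False unfolding upper_conjugate_def by auto
      qed
    qed
  qed
qed

text \<open>
  Compare the projectivised positive roots, normalised to height \<open>1\<close>, lexicographically in their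
  coordinates: a positive combination of two roots becomes a convex combination.
\<close>

theorem reflection_order_exists: "\<exists>lt. reflection_order lt"
proof -
  obtain r :: "'i rel" where r: "Well_order r" "Field r = UNIV"
    using well_ordering by metis
  define \<kappa> where "\<kappa> t j = rt t (unit_vector j) / rt t (\<lambda>_. 1)" for t j
  define less where "less j k \<longleftrightarrow> (j, k) \<in> r - Id" for j k
  have wf: "wf {(j, k). less j k}"
    using r by (auto simp: less_def well_order_on_def wf_def)
  have lin: "j = k \<or> less j k \<or> less k j" for j k
    using r by (auto simp: less_def well_order_on_def linear_order_on_def total_on_def)
  have trans: "less j k \<Longrightarrow> less k l \<Longrightarrow> less j l" for j k l
    using r unfolding less_def well_order_on_def linear_order_on_def partial_order_on_def preorder_on_def
    by (auto dest: transD antisymD)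
  have height: "0 < rt t (\<lambda>_. 1)" if "t \<in> reflections" for t
    using that positive_root_height by simp
  define lt where "lt a b \<longleftrightarrow> (\<exists>k\<in>I. \<kappa> a k < \<kappa> b k \<and> (\<forall>j\<in>I. less j k \<longrightarrow> \<kappa> a j = \<kappa> b j))" for a b
  have "reflection_order lt"
    unfolding reflection_order_def
  proof (intro conjI ballI allI impI)
    show "\<not> lt a a" for a
      by (simp add: lt_def)
    show "lt a c" if ab: "lt a b" and bc: "lt b c" for a b c
    proof -
      obtain k where k: "k \<in> I" "\<kappa> a k < \<kappa> b k" "\<forall>j\<in>I. less j k \<longrightarrow> \<kappa> a j = \<kappa> b j"
        using ab unfolding lt_def by blast
      obtain l where l: "l \<in> I" "\<kappa> b l < \<kappa> c l" "\<forall>j\<in>I. less j l \<longrightarrow> \<kappa> b j = \<kappa> c j"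
        using bc unfolding lt_def by blast
      consider "less k l" | "k = l" | "less l k"
        using lin by blast
      then show ?thesis
      proof cases
        case 1
        then have "\<kappa> b k = \<kappa> c k" "\<forall>j\<in>I. less j k \<longrightarrow> \<kappa> b j = \<kappa> c j"
          using k(1) l(3) trans by blast+
        then show ?thesis
          using k unfolding lt_def by (intro bexI[of _ k]) auto
      next
        case 2
        then show ?thesis
          using k l unfolding lt_def by (intro bexI[of _ k]) auto
      next
        case 3
        then have "\<kappa> a l = \<kappa> b l" "\<forall>j\<in>I. less j l \<longrightarrow> \<kappa> a j = \<kappa> b j"
          using l(1) k(3) trans by blast+
        then show ?thesis
          using l unfolding lt_def by (intro bexI[of _ l]) auto
      qed
    qed
    show "a = b \<or> lt a b \<or> lt b a" if ab: "a \<in> reflections" "b \<in> reflections" for a b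
    proof (cases "\<exists>k\<in>I. \<kappa> a k \<noteq> \<kappa> b k")
      case True
      then obtain k where k: "k \<in> {k\<in>I. \<kappa> a k \<noteq> \<kappa> b k}" "\<And>j. (j, k) \<in> {(j, k). less j k} \<Longrightarrow> j \<notin> {k\<in>I. \<kappa> a k \<noteq> \<kappa> b k}"
        using wfE_min[OF wf] by (metis (mono_tags, lifting) mem_Collect_eq)
      then have "\<forall>j\<in>I. less j k \<longrightarrow> \<kappa> a j = \<kappa> b j"
        by auto
      then show ?thesis
        using k(1) unfolding lt_def by (metis (mono_tags, lifting) linorder_neqE_linordered_idom mem_Collect_eq)
    next
      case False
      define c where "c = rt a (\<lambda>_. 1) / rt b (\<lambda>_. 1)"
      have c: "c \<noteq> 0"
        using height ab by (force simp: c_def)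
      have eq: "rt a (unit_vector j) = c * rt b (unit_vector j)" if "j \<in> I" for j
        using False that height ab by (force simp: \<kappa>_def c_def field_simps)
      have "rt a f = c * rt b f" for f
      proof -
        have "{j \<in> I. rt a (unit_vector j) \<noteq> 0} = {j \<in> I. rt b (unit_vector j) \<noteq> 0}"
          using eq c by auto
        then show ?thesis
          unfolding is_root_expansion(2)[OF rt_root[OF ab(1)], of f] is_root_expansion(2)[OF rt_root[OF ab(2)], of f]
          using eq by (auto simp: sum_distrib_left mult.assoc intro!: sum.cong)
      qed
      then show ?thesis
        using rt_proportional_eq[OF ab, of c] by auto
    qed
  next
    fix a b c and p q :: real
    assume abc: "a \<in> reflections" "b \<in> reflections" "c \<in> reflections" and pq: "0 < p" "0 < q"
      and c: "rt c = (\<lambda>f. p * rt a f + q * rt b f)" and "lt a b"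
    define P R where "P = p * rt a (\<lambda>_. 1)" and "R = q * rt b (\<lambda>_. 1)"
    have PR: "0 < P" "0 < R"
      using height abc pq by (auto simp: P_def R_def)
    have \<kappa>: "\<kappa> c j = (P * \<kappa> a j + R * \<kappa> b j) / (P + R)" for j
      using height[OF abc(1)] height[OF abc(2)] by (simp add: \<kappa>_def c P_def R_def)
    have lt: "\<kappa> a j < \<kappa> c j" "\<kappa> c j < \<kappa> b j" if "\<kappa> a j < \<kappa> b j" for j
      using PR that by (auto simp: \<kappa> field_simps)
    have eq: "\<kappa> c j = \<kappa> a j" "\<kappa> c j = \<kappa> b j" if "\<kappa> a j = \<kappa> b j" for j
      using PR that by (auto simp: \<kappa> field_simps)
    show "lt a c" "lt c b"
      using \<open>lt a b\<close> lt eq unfolding lt_def by metis+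
  qed
  then show ?thesis
    by blast
qed

end

section \<open>Height functions and cover paths\<close>

text \<open>
  A height function behaves like the length with respect to right multiplication by simple
  reflections. Besides the length itself this covers the height of the twisted Bruhat order relative
  to a parabolic subgroup, in which the parabolic part is counted negatively.
\<close>

locale coxeter_height = coxeter_system W I m s
  for W :: "('w, 'b) monoid_scheme" (structure) and I :: "'i set" and m s +
  fixes h :: "'w \<Rightarrow> int"
  assumes height_simple: "x \<in> carrier W \<Longrightarrow> i \<in> I \<Longrightarrow> h (x \<otimes> s i) = h x + 1 \<or> h (x \<otimes> s i) = h x - 1"
    and height_reflection: "\<lbrakk>x \<in> carrier W; t \<in> reflections; i \<in> I; t \<noteq> s i\<rbrakk> \<Longrightarrow>
      h x < h (x \<otimes> t) \<longleftrightarrow> h (x \<otimes> s i) < h (x \<otimes> t \<otimes> s i)"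
begin

definition edge :: "'w \<Rightarrow> 'w \<Rightarrow> bool" where
  "edge x y \<longleftrightarrow> x \<in> carrier W \<and> (\<exists>t\<in>reflections. y = x \<otimes> t) \<and> h x < h y"

definition le :: "'w \<Rightarrow> 'w \<Rightarrow> bool" where
  "le x y \<longleftrightarrow> x \<in> carrier W \<and> y \<in> carrier W \<and> edge\<^sup>*\<^sup>* x y"

definition lower :: "'i \<Rightarrow> 'w \<Rightarrow> 'w" where
  "lower i x = (if h (x \<otimes> s i) < h x then x \<otimes> s i else x)"

definition upper :: "'i \<Rightarrow> 'w \<Rightarrow> 'w" where
  "upper i x = (if h (x \<otimes> s i) < h x then x else x \<otimes> s i)"

lemma le_closed: "le x y \<Longrightarrow> x \<in> carrier W" "le x y \<Longrightarrow> y \<in> carrier W"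
  by (simp_all add: le_def)

lemma le_refl [simp]: "x \<in> carrier W \<Longrightarrow> le x x"
  by (simp add: le_def)

lemma le_trans [trans]: "le x y \<Longrightarrow> le y z \<Longrightarrow> le x z"
  unfolding le_def by auto

lemma edge_closed: "edge x y \<Longrightarrow> x \<in> carrier W \<and> y \<in> carrier W"
  by (auto simp: edge_def)

lemma edge_le: "edge x y \<Longrightarrow> le x y"
  using edge_closed by (auto simp: le_def)

lemma le_induct [consumes 1, case_names refl step]:
  assumes "le x y" "P x" "\<And>y z. le x y \<Longrightarrow> edge y z \<Longrightarrow> P y \<Longrightarrow> P z"
  shows "P y"
proof -
  have x: "x \<in> carrier W" and "edge\<^sup>*\<^sup>* x y"
    using assms(1) by (simp_all add: le_def)
  from this(2) have "le x y \<and> P y"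
  proof (induction rule: rtranclp_induct)
    case base
    then show ?case
      using x assms(2) by simp
  next
    case (step y z)
    then show ?case
      using assms(3) edge_le le_trans by blast
  qed
  then show ?thesis
    by simp
qed

lemma le_height: "le x y \<Longrightarrow> x = y \<or> h x < h y"
  by (induction rule: le_induct) (auto simp: edge_def)

lemma le_antisym: "le x y \<Longrightarrow> le y x \<Longrightarrow> x = y"
  using le_height[of x y] le_height[of y x] by auto

lemma edge_shift:
  assumes "edge x z" "i \<in> I"
  shows "z = x \<otimes> s i \<or> edge (x \<otimes> s i) (z \<otimes> s i)"
proof -
  obtain t where t: "t \<in> reflections" "z = x \<otimes> t" "x \<in> carrier W" "h x < h z"
    using assms by (auto simp: edge_def)
  show ?thesis
  proof (cases "t = s i")
    case False
    then have "h (x \<otimes> s i) < h (z \<otimes> s i)"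
      using height_reflection[of x t i] t assms(2) by simp
    moreover have "z \<otimes> s i = x \<otimes> s i \<otimes> cj i t"
      using t assms(2) by (simp add: mult_cj)
    ultimately show ?thesis
      using t assms(2) unfolding edge_def by auto
  qed (use t in simp)
qed

lemma simple_edge:
  assumes "x \<in> carrier W" "i \<in> I"
  shows "h (x \<otimes> s i) < h x \<Longrightarrow> edge (x \<otimes> s i) x" "\<not> h (x \<otimes> s i) < h x \<Longrightarrow> edge x (x \<otimes> s i)"
  using height_simple[OF assms] assms by (auto simp: edge_def intro!: bexI[of _ "s i"])

lemma lower_upper_le:
  assumes "x \<in> carrier W" "i \<in> I"
  shows "le (lower i x) x" "le x (upper i x)" "le (lower i x) (upper i x)"
  using simple_edge[OF assms] edge_le assms by (auto simp: lower_def upper_def)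

text \<open>The lifting property of the Bruhat order. Right multiplication by \<open>s i\<close>
  maps an edge to an edge unless it joins \<open>y\<close> and \<open>y s i\<close>
  (\<open>edge_shift\<close>), and an edge of that kind is collapsed by \<open>lower\<close> and
  \<open>upper\<close>.\<close>

lemma lower_upper_mono:
  assumes "le x y" "i \<in> I"
  shows "le (lower i x) (lower i y) \<and> le (upper i x) (upper i y)"
  using assms(1)
proof (induction rule: le_induct)
  case refl
  then show ?case
    using le_closed[OF assms(1)] assms(2) by (simp add: lower_def upper_def)
next
  case (step y z)
  have closed: "y \<in> carrier W" "z \<in> carrier W"
    using edge_closed step by auto
  have "le (lower i y) (lower i z) \<and> le (upper i y) (upper i z)"
  proof (cases "z = y \<otimes> s i")
    case True
    then have "h (y \<otimes> s i) > h y"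
      using step by (simp add: edge_def)
    then show ?thesis
      using True closed assms(2) by (simp add: lower_def upper_def)
  next
    case False
    then have "le (y \<otimes> s i) (z \<otimes> s i)" "le y z"
      using edge_shift step assms(2) edge_le by blast+
    then show ?thesis
      using simple_edge[OF closed(1) assms(2)] simple_edge[OF closed(2) assms(2)]
      unfolding lower_def upper_def by (auto dest!: edge_le intro: le_trans)
  qed
  then show ?case
    using step.IH le_trans by blast
qed

lemmas lower_mono = lower_upper_mono[THEN conjunct1]
  and upper_mono = lower_upper_mono[THEN conjunct2]

section \<open>Parity of heights and cover paths\<close>

lemma height_parity: "u \<in> lists I \<Longrightarrow> x \<in> carrier W \<Longrightarrow> even (h (x \<otimes> val u) - h x - int (length u))"
proof (induction u arbitrary: x)
  case (Cons i u)
  then have i: "i \<in> I" "u \<in> lists I"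
    by auto
  then have "even (h (x \<otimes> s i \<otimes> val u) - h (x \<otimes> s i) - int (length u))"
    using Cons by simp
  then show ?case
    using height_simple[OF Cons.prems(2) i(1)] i Cons.prems(2) by (auto simp: m_assoc)
qed simp

text \<open>A conjugate of a generator is the value of a palindrome of odd length.\<close>

lemma reflection_word_odd:
  assumes "t \<in> reflections"
  obtains u where "u \<in> lists I" "val u = t" "odd (length u)"
proof -
  obtain x i where x: "x \<in> carrier W" "i \<in> I" "t = x \<otimes> s i \<otimes> inv x"
    using assms by (rule reflectionE)
  obtain u where u: "u \<in> lists I" "val u = x"
    using word_exists x(1) by blast
  have "rev u \<in> lists I"
    using u by auto
  then have "val (u @ i # rev u) = t"
    using u x by (simp add: val_append val_rev m_assoc)
  then show ?thesis
    using that[of "u @ i # rev u"] u x \<open>rev u \<in> lists I\<close> by simp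
qed

lemma height_reflection_neq:
  assumes "x \<in> carrier W" "t \<in> reflections"
  shows "h (x \<otimes> t) \<noteq> h x"
proof -
  obtain u where "u \<in> lists I" "val u = t" "odd (length u)"
    using reflection_word_odd assms by metis
  then show ?thesis
    using height_parity[of u x] assms by auto
qed

text \<open>Only the labels are recorded, read upwards from the start, so that multiplication of all
  vertices by \<open>s i\<close> acts on the list by \<open>map (cj i)\<close>. That steps of height
  one are the cover relations is established in \<open>covers_iff\<close>.\<close>

fun path :: "'w \<Rightarrow> 'w list \<Rightarrow> bool" where
  "path x [] \<longleftrightarrow> x \<in> carrier W"
| "path x (t # ts) \<longleftrightarrow> x \<in> carrier W \<and> t \<in> reflections \<and> h (x \<otimes> t) = h x + 1 \<and> path (x \<otimes> t) ts"

abbreviation endpoint :: "'w \<Rightarrow> 'w list \<Rightarrow> 'w" where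
  "endpoint \<equiv> foldl (\<otimes>)"

definition paths :: "'w \<Rightarrow> 'w \<Rightarrow> 'w list set" where
  "paths x y = {ts. path x ts \<and> endpoint x ts = y}"

definition increasing_paths :: "('w \<Rightarrow> 'w \<Rightarrow> bool) \<Rightarrow> 'w \<Rightarrow> 'w \<Rightarrow> 'w list set" where
  "increasing_paths lt x y = {ts \<in> paths x y. sorted_wrt lt ts}"

lemma path_closed: "path x ts \<Longrightarrow> x \<in> carrier W"
  by (cases ts) auto

lemma path_append: "path x (ts @ us) \<longleftrightarrow> path x ts \<and> path (endpoint x ts) us"
  by (induction ts arbitrary: x) (auto dest: path_closed)

lemma path_reflections: "path x ts \<Longrightarrow> set ts \<subseteq> reflections"
  by (induction ts arbitrary: x) auto

lemma path_height: "path x ts \<Longrightarrow> h (endpoint x ts) = h x + int (length ts)"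
  by (induction ts arbitrary: x) auto

lemma path_le: "path x ts \<Longrightarrow> le x (endpoint x ts)"
proof (induction ts arbitrary: x)
  case (Cons t ts)
  then have "edge x (x \<otimes> t)"
    by (auto simp: edge_def)
  then show ?case
    using Cons edge_le le_trans by simp blast
qed simp

lemma endpoint_closed: "path x ts \<Longrightarrow> endpoint x ts \<in> carrier W"
  using path_le le_closed by blast

lemma paths_self: "x \<in> carrier W \<Longrightarrow> paths x x = {[]}"
  using path_height by (fastforce simp: paths_def)

lemma endpoint_cj:
  "\<lbrakk>x \<in> carrier W; set ts \<subseteq> reflections; i \<in> I\<rbrakk> \<Longrightarrow>
    endpoint (x \<otimes> s i) (map (cj i) ts) = endpoint x ts \<otimes> s i"
  by (induction ts arbitrary: x) (auto simp: mult_cj)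

text \<open>If \<open>x t\<close> went down under \<open>s i\<close>, then \<open>x t s i\<close>
  would have the height of \<open>x\<close>, below that of \<open>x s i\<close>; but
  \<open>height_reflection\<close> places it above \<open>x s i\<close>.\<close>

lemma cover_up:
  assumes "x \<in> carrier W" "t \<in> reflections" "i \<in> I" "t \<noteq> s i" "h (x \<otimes> t) = h x + 1" "h x < h (x \<otimes> s i)"
  shows "h (x \<otimes> t) < h (x \<otimes> t \<otimes> s i)"
  using height_reflection[OF assms(1-4)] height_simple[OF assms(1,3)] height_simple[of "x \<otimes> t" i] assms
  by auto

text \<open>A cover path can move up across \<open>x < x s i\<close> only along that edge itself.\<close>

lemma path_up:
  assumes "path x ts" "i \<in> I" "s i \<notin> set ts" "h x < h (x \<otimes> s i)"
  shows "h (endpoint x ts) < h (endpoint x ts \<otimes> s i)"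
    and "path (x \<otimes> s i) (map (cj i) ts)"
proof -
  have "h (endpoint x ts) < h (endpoint x ts \<otimes> s i) \<and> path (x \<otimes> s i) (map (cj i) ts)"
    using assms(1,3,4)
  proof (induction ts arbitrary: x)
    case (Cons t ts)
    then have t: "x \<in> carrier W" "t \<in> reflections" "t \<noteq> s i" "h (x \<otimes> t) = h x + 1"
      by auto
    have up: "h (x \<otimes> t) < h (x \<otimes> t \<otimes> s i)"
      using cover_up t assms(2) Cons.prems(3) by blast
    then have "h (x \<otimes> t \<otimes> s i) = h (x \<otimes> s i) + 1"
      using height_simple[of "x \<otimes> t" i] height_simple[of x i] t assms(2) Cons.prems(3) by auto
    then show ?case
      using Cons.IH[of "x \<otimes> t"] Cons.prems up t assms(2) by (simp add: mult_cj)
  qed (use assms(2) in auto)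
  then show "h (endpoint x ts) < h (endpoint x ts \<otimes> s i)" "path (x \<otimes> s i) (map (cj i) ts)"
    by auto
qed

lemma path_down:
  assumes "path x ts" "i \<in> I" "s i \<notin> set ts" "h (endpoint x ts \<otimes> s i) < h (endpoint x ts)"
  shows "h (x \<otimes> s i) < h x" and "path (x \<otimes> s i) (map (cj i) ts)"
proof -
  have "h (x \<otimes> s i) < h x \<and> path (x \<otimes> s i) (map (cj i) ts)"
    using assms(1,3,4)
  proof (induction ts arbitrary: x)
    case (Cons t ts)
    then have t: "x \<in> carrier W" "t \<in> reflections" "t \<noteq> s i" "h (x \<otimes> t) = h x + 1"
      by auto
    have IH: "h (x \<otimes> t \<otimes> s i) < h (x \<otimes> t)" "path (x \<otimes> t \<otimes> s i) (map (cj i) ts)"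
      using Cons.IH[of "x \<otimes> t"] Cons.prems by auto
    then have "\<not> h x < h (x \<otimes> s i)"
      using cover_up[OF t(1,2) assms(2) t(3,4)] by linarith
    then have "h (x \<otimes> s i) < h x"
      using height_simple[OF t(1) assms(2)] by linarith
    moreover have "h (x \<otimes> t \<otimes> s i) = h (x \<otimes> s i) + 1"
      using calculation IH(1) height_simple[of "x \<otimes> t" i] height_simple[of x i] t assms(2) by auto
    ultimately show ?case
      using IH t assms(2) by (simp add: mult_cj)
  qed (use assms(2) in auto)
  then show "h (x \<otimes> s i) < h x" "path (x \<otimes> s i) (map (cj i) ts)"
    by auto
qed

text \<open>\<open>x\<close> goes up under \<open>s i\<close> and \<open>y\<close> goes down, so by
  \<open>path_up\<close> the path must use the label \<open>s i\<close>. Monotonicity puts the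
  smaller labels before it and the larger ones after it. Removing \<open>s i\<close> and conjugating
  the later labels gives a path to \<open>y s i\<close>, increasing for the upper conjugate.\<close>

lemma upper_conjugate_path_split:
  assumes lt: "reflection_order lt" and i: "i \<in> I"
    and up: "h x < h (x \<otimes> s i)" and down: "h (y \<otimes> s i) < h y"
    and ts: "ts \<in> increasing_paths lt x y"
  obtains as bs where "ts = as @ s i # bs" "\<forall>a\<in>set as. lt a (s i)" "\<forall>b\<in>set bs. \<not> lt (cj i b) (s i)"
    "as @ map (cj i) bs \<in> increasing_paths (upper_conjugate i lt) x (y \<otimes> s i)"
proof -
  have path: "path x ts" "endpoint x ts = y" "sorted_wrt lt ts"
    using ts by (auto simp: increasing_paths_def paths_def)
  have "s i \<in> set ts"
    using path_up(1)[OF path(1) i] up down path(2) by fastforce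
  then obtain as bs where split: "ts = as @ s i # bs"
    by (meson split_list)
  have refl: "set as \<subseteq> reflections" "set bs \<subseteq> reflections" "s i \<in> reflections"
    using path_reflections[OF path(1)] split i by auto
  note D = reflection_orderD[OF lt]
  have as: "\<forall>a\<in>set as. lt a (s i)" and bs: "\<forall>b\<in>set bs. lt (s i) b"
    and sorted: "sorted_wrt lt as" "sorted_wrt lt bs"
    using path(3) by (auto simp: split sorted_wrt_append)
  have ne: "s i \<notin> set as" "s i \<notin> set bs"
    using as bs D(1)[OF refl(3,3,3)] by auto
  have bs': "\<not> lt (cj i b) (s i)" if "b \<in> set bs" for b
    using less_cj_simple_iff[OF lt _ i, of b] D(1,2)[OF refl(3) _ refl(3), of b] bs refl that by blast
  define z where "z = endpoint x as"
  have z: "path x as" "z \<in> carrier W" "h z < h (z \<otimes> s i)" "path (z \<otimes> s i) bs" "endpoint (z \<otimes> s i) bs = y"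
    using path split path_up(1)[of x as i] i up ne(1) endpoint_closed[of x as]
    by (auto simp: path_append z_def)
  then have "path (z \<otimes> s i \<otimes> s i) (map (cj i) bs)"
    using path_down(2)[OF z(4) i ne(2)] down by simp
  moreover have "endpoint (z \<otimes> s i \<otimes> s i) (map (cj i) bs) = y \<otimes> s i"
    using endpoint_cj[of "z \<otimes> s i" bs i] z i refl(2) by auto
  ultimately have "as @ map (cj i) bs \<in> paths x (y \<otimes> s i)"
    using z i by (simp add: paths_def path_append z_def)
  moreover have "sorted_wrt (upper_conjugate i lt) (as @ map (cj i) bs)"
    unfolding sorted_wrt_append sorted_wrt_map
  proof (intro conjI ballI)
    show "sorted_wrt (upper_conjugate i lt) as"
      by (rule sorted_wrt_mono_rel[OF _ sorted(1)]) (use as ne in \<open>auto simp: upper_conjugate_def\<close>)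
    show "sorted_wrt (\<lambda>x y. upper_conjugate i lt (cj i x) (cj i y)) bs"
      by (rule sorted_wrt_mono_rel[OF _ sorted(2)])
        (use bs' ne refl i in \<open>auto simp: upper_conjugate_def subset_iff\<close>)
    show "upper_conjugate i lt a b" if "a \<in> set as" "b \<in> set (map (cj i) bs)" for a b
      using that as bs' ne by (auto simp: upper_conjugate_def)
  qed
  ultimately show ?thesis
    using that[OF split as] bs' by (simp add: increasing_paths_def)
qed

text \<open>The inverse construction. The place where \<open>s i\<close> must be inserted is the end
  of the initial segment of labels below \<open>s i\<close>.\<close>

lemma upper_conjugate_path_join:
  assumes lt: "reflection_order lt" and i: "i \<in> I"
    and up: "h x < h (x \<otimes> s i)" and down: "h (y \<otimes> s i) < h y" and y: "y \<in> carrier W"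
    and ts: "ts \<in> increasing_paths (upper_conjugate i lt) x (y \<otimes> s i)"
  shows "increasing_paths lt x y \<noteq> {}"
proof -
  have path: "path x ts" "endpoint x ts = y \<otimes> s i" "sorted_wrt (upper_conjugate i lt) ts"
    using ts by (auto simp: increasing_paths_def paths_def)
  note D = reflection_orderD[OF lt]
  have refl: "set ts \<subseteq> reflections" "s i \<in> reflections"
    using path_reflections[OF path(1)] i by auto
  \<comment> \<open>In the upper conjugate \<open>s i\<close> is the maximum, so it could only be
    the last label. Then the vertex before it would be \<open>y\<close>, which goes down under
    \<open>s i\<close>, while \<open>path_up\<close> makes that vertex go up.\<close>
  have ne: "s i \<notin> set ts"
  proof
    assume "s i \<in> set ts"
    then obtain as bs where split: "ts = as @ s i # bs"
      by (meson split_list)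
    have "bs = []"
      using path(3) unfolding split by (cases bs) (auto simp: sorted_wrt_append upper_conjugate_def)
    moreover have "s i \<notin> set as"
      using path(3) unfolding split by (auto simp: sorted_wrt_append upper_conjugate_def)
    ultimately have "h (endpoint x as) < h (endpoint x as \<otimes> s i)" "endpoint x as \<otimes> s i = y \<otimes> s i"
      "endpoint x as \<in> carrier W"
      using path_up(1)[of x as i] path(1,2) split i up endpoint_closed[of x as] by (auto simp: path_append)
    then show False
      using down y i by auto
  qed
  define as cs where "as = takeWhile (\<lambda>a. lt a (s i)) ts" and "cs = dropWhile (\<lambda>a. lt a (s i)) ts"
  have split: "ts = as @ cs"
    by (simp add: as_def cs_def)
  have as: "\<forall>a\<in>set as. lt a (s i)"
    by (auto simp: as_def dest: set_takeWhileD)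
  have sorted: "sorted_wrt (upper_conjugate i lt) as" "sorted_wrt (upper_conjugate i lt) cs"
    using path(3) by (auto simp: split sorted_wrt_append)
  have cs: "\<not> lt c (s i)" if "c \<in> set cs" for c
  proof (cases cs)
    case (Cons d ds)
    then have "\<not> lt d (s i)"
      using hd_dropWhile[of "\<lambda>a. lt a (s i)" ts] by (auto simp: cs_def)
    then show ?thesis
      using that sorted(2) ne split Cons by (auto simp: upper_conjugate_def)
  qed (use that in simp)
  have ne': "s i \<notin> set as" "s i \<notin> set cs"
    using ne split by auto
  define z where "z = endpoint x as"
  have z: "path x as" "z \<in> carrier W" "h z < h (z \<otimes> s i)" "path z cs" "endpoint z cs = y \<otimes> s i"
    using path split path_up(1)[of x as i] i up ne'(1) endpoint_closed[of x as]
    by (auto simp: path_append z_def)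
  have "path (z \<otimes> s i) (map (cj i) cs)"
    using path_up(2)[OF z(4) i ne'(2) z(3)] .
  moreover have "endpoint (z \<otimes> s i) (map (cj i) cs) = y"
    using endpoint_cj[of z cs i] z i refl(1) split y by auto
  moreover have "h (z \<otimes> s i) = h z + 1"
    using height_simple[OF z(2) i] z(3) by auto
  ultimately have "as @ s i # map (cj i) cs \<in> paths x y"
    using z i by (simp add: paths_def path_append z_def)
  moreover have "sorted_wrt lt (as @ s i # map (cj i) cs)"
  proof -
    have "sorted_wrt lt as"
      by (rule sorted_wrt_mono_rel[OF _ sorted(1)]) (use as ne' in \<open>auto simp: upper_conjugate_def\<close>)
    moreover have "sorted_wrt (\<lambda>x y. lt (cj i x) (cj i y)) cs"
      by (rule sorted_wrt_mono_rel[OF _ sorted(2)]) (use cs ne' in \<open>auto simp: upper_conjugate_def\<close>)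
    moreover have low: "lt (s i) (cj i c)" if "c \<in> set cs" for c
    proof -
      have c: "c \<in> reflections" "c \<noteq> s i" "\<not> lt c (s i)"
        using that cs refl split ne' by auto
      then have "\<not> lt (cj i c) (s i)" "cj i c \<noteq> s i"
        using less_cj_simple_iff[OF lt c(1) i] i by auto
      then show ?thesis
        using D(3)[OF cj_reflection[OF i c(1)] refl(2,2)] by blast
    qed
    moreover have "lt a (cj i c)" if "a \<in> set as" "c \<in> set cs" for a c
    proof -
      have "a \<in> reflections" "cj i c \<in> reflections"
        using that refl split i by auto
      then show ?thesis
        using D(2)[OF _ refl(2)] as low that by blast
    qed
    ultimately show ?thesis
      using as by (auto simp: sorted_wrt_append sorted_wrt_map)
  qed
  ultimately show ?thesis
    by (auto simp: increasing_paths_def)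
qed

text \<open>Comparison with \<open>s i\<close> recovers the cut from the shortened path, because
  conjugation does not change the side of \<open>s i\<close> on which a label lies. Hence shortening
  is injective.\<close>

lemma unique_increasing_path_up_down:
  assumes lt: "reflection_order lt" and i: "i \<in> I"
    and up: "h x < h (x \<otimes> s i)" and down: "h (y \<otimes> s i) < h y" and y: "y \<in> carrier W"
    and unique: "\<exists>!ts. ts \<in> increasing_paths (upper_conjugate i lt) x (y \<otimes> s i)"
  shows "\<exists>!ts. ts \<in> increasing_paths lt x y"
proof -
  have "increasing_paths lt x y \<noteq> {}"
    using upper_conjugate_path_join[OF lt i up down y] unique by blast
  moreover have "ts = ts'" if ts: "ts \<in> increasing_paths lt x y" "ts' \<in> increasing_paths lt x y" for ts ts'
  proof -
    obtain as bs where 1: "ts = as @ s i # bs" "\<forall>a\<in>set as. lt a (s i)" "\<forall>b\<in>set bs. \<not> lt (cj i b) (s i)"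
      "as @ map (cj i) bs \<in> increasing_paths (upper_conjugate i lt) x (y \<otimes> s i)"
      using upper_conjugate_path_split[OF lt i up down ts(1)] .
    obtain as' bs' where 2: "ts' = as' @ s i # bs'" "\<forall>a\<in>set as'. lt a (s i)" "\<forall>b\<in>set bs'. \<not> lt (cj i b) (s i)"
      "as' @ map (cj i) bs' \<in> increasing_paths (upper_conjugate i lt) x (y \<otimes> s i)"
      using upper_conjugate_path_split[OF lt i up down ts(2)] .
    have eq: "as @ map (cj i) bs = as' @ map (cj i) bs'"
      using unique 1(4) 2(4) by blast
    have tw: "takeWhile (\<lambda>a. lt a (s i)) (as @ map (cj i) bs) = as"
      if "\<forall>a\<in>set as. lt a (s i)" "\<forall>b\<in>set bs. \<not> lt (cj i b) (s i)" for as bs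
      using that by (cases bs) (auto simp: takeWhile_append2)
    have "as = as'"
      using tw[OF 1(2,3)] tw[OF 2(2,3)] eq by simp
    then have "map (cj i) bs = map (cj i) bs'"
      using eq by simp
    moreover have "set bs \<subseteq> reflections" "set bs' \<subseteq> reflections"
      using path_reflections[of x ts] path_reflections[of x ts'] ts
      unfolding 1(1) 2(1) increasing_paths_def paths_def by auto
    then have "set bs \<subseteq> carrier W" "set bs' \<subseteq> carrier W"
      using reflection_closed by blast+
    then have "map (cj i) (map (cj i) bs) = bs" "map (cj i) (map (cj i) bs') = bs'"
      using i by (auto intro!: map_idI)
    ultimately have "bs = bs'"
      by metis
    then show ?thesis
      using 1(1) 2(1) \<open>as = as'\<close> by simp
  qed
  ultimately show ?thesis
    by blast
qed

lemma finite_paths: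
  assumes "finite {z. le x z \<and> le z y}"
  shows "finite (paths x y)"
proof -
  let ?Z = "{z. le x z \<and> le z y}"
  have labels: "set ts \<subseteq> (\<lambda>(z, z'). inv z \<otimes> z') ` (?Z \<times> ?Z)" if "path x ts" "endpoint x ts = y" for ts
  proof
    fix t assume "t \<in> set ts"
    then obtain as bs where ts: "ts = as @ t # bs"
      by (meson split_list)
    define z where "z = endpoint x as"
    have z: "path x as" "z \<in> carrier W" "t \<in> reflections" "path (z \<otimes> t) bs" "endpoint (z \<otimes> t) bs = y" "path z [t]"
      using that ts endpoint_closed[of x as] path_closed[of "endpoint x as \<otimes> t" bs]
      by (auto simp: path_append z_def)
    have "le x z" "le z (z \<otimes> t)" "le (z \<otimes> t) y"
      using path_le[OF z(1)] path_le[OF z(6)] path_le[OF z(4)] z(5) by (simp_all add: z_def)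
    then have "z \<in> ?Z" "z \<otimes> t \<in> ?Z"
      using le_trans by blast+
    moreover have "t = inv z \<otimes> (z \<otimes> t)"
      using z(2,3) by simp
    ultimately show "t \<in> (\<lambda>(z, z'). inv z \<otimes> z') ` (?Z \<times> ?Z)"
      by (intro image_eqI[of _ _ "(z, z \<otimes> t)"]) auto
  qed
  have "paths x y \<subseteq> {ts. set ts \<subseteq> (\<lambda>(z, z'). inv z \<otimes> z') ` (?Z \<times> ?Z) \<and> length ts = nat (h y - h x)}"
    using labels path_height by (fastforce simp: paths_def)
  then show ?thesis
    using finite_lists_length_eq[of "(\<lambda>(z, z'). inv z \<otimes> z') ` (?Z \<times> ?Z)" "nat (h y - h x)"] assms
    by (auto intro: finite_subset)
qed

text \<open>
  Cut every cover path into a decreasing part followed by an increasing part. A path admitting such a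
  cut admits exactly two, at adjacent places, so the alternating number of cuts vanishes.
\<close>

lemma alternating_sum_cuts:
  assumes lt: "reflection_order lt" and "x \<noteq> y" and fin: "finite {z. le x z \<and> le z y}"
  shows "(\<Sum>z\<in>{z. le x z \<and> le z y}. (-1) ^ nat (h z - h x) *
    int (card (increasing_paths (\<lambda>a b. lt b a) x z)) * int (card (increasing_paths lt z y))) = 0"
proof -
  let ?gt = "\<lambda>a b. lt b a"
  define Z where "Z = {z. le x z \<and> le z y}"
  define S where "S = {(ts, us). ts @ us \<in> paths x y \<and> sorted_wrt ?gt ts \<and> sorted_wrt lt us}"
  \<comment> \<open>\<open>A\<close> marks the cuts whose last decreasing label can be moved to the
    front of the increasing part. This move is inverse to the opposite move available at all other
    cuts, and it changes the sign.\<close>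
  define A where "A = (\<lambda>(ts, us). ts \<noteq> [] \<and> (us = [] \<or> lt (last ts) (hd us)))"
  define g where "g = (\<lambda>(ts :: 'w list, us :: 'w list). (-1 :: int) ^ length ts)"
  note D = reflection_orderD[OF lt]
  have "finite S"
  proof -
    have "S \<subseteq> (\<lambda>(n, ts). (take n ts, drop n ts)) ` ({..nat (h y - h x)} \<times> paths x y)"
    proof
      fix p assume "p \<in> S"
      then obtain ts us where p: "p = (ts, us)" "ts @ us \<in> paths x y"
        by (auto simp: S_def)
      then have "length ts \<le> nat (h y - h x)"
        using path_height[of x "ts @ us"] by (auto simp: paths_def)
      then show "p \<in> (\<lambda>(n, ts). (take n ts, drop n ts)) ` ({..nat (h y - h x)} \<times> paths x y)"
        using p by (intro image_eqI[of _ _ "(length ts, ts @ us)"]) auto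
    qed
    then show ?thesis
      using finite_paths[OF fin] by (auto intro: finite_subset)
  qed
  have nonempty: "ts @ us \<noteq> []" if "(ts, us) \<in> S" for ts us
    using that \<open>x \<noteq> y\<close> by (auto simp: S_def paths_def)
  have "sum g {p \<in> S. A p} = sum (\<lambda>p. - g p) {p \<in> S. \<not> A p}"
  proof (rule sum.reindex_bij_witness[where i = "\<lambda>(ts, us). (ts @ [hd us], tl us)"
        and j = "\<lambda>(ts, us). (butlast ts, last ts # us)"])
    fix p assume "p \<in> {p \<in> S. A p}"
    then obtain ts us where p: "p = (ts, us)" "(ts, us) \<in> S" "A (ts, us)"
      by (cases p) auto
    then obtain vs a where ts: "ts = vs @ [a]"
      unfolding A_def by (cases ts rule: rev_cases) auto
    have path: "path x ((vs @ [a]) @ us)" "sorted_wrt ?gt (vs @ [a])" "sorted_wrt lt us"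
      using p by (auto simp: S_def paths_def ts)
    have refl: "set vs \<subseteq> reflections" "a \<in> reflections" "set us \<subseteq> reflections"
      using path_reflections[OF path(1)] by auto
    show "(\<lambda>(ts, us). (ts @ [hd us], tl us)) ((\<lambda>(ts, us). (butlast ts, last ts # us)) p) = p"
      by (simp add: p ts)
    have "lt a b" if "b \<in> set us" for b
    proof (cases us)
      case (Cons c cs)
      then have c: "lt a c"
        using p by (simp add: A_def ts)
      show ?thesis
      proof (cases "b = c")
        case False
        then have "lt c b"
          using that path(3) Cons by auto
        then show ?thesis
          using c D(2)[of a c b] refl Cons that by auto
      qed (use c in simp)
    qed (use that in simp)
    then have "(vs, a # us) \<in> S"
      using p path by (auto simp: S_def ts sorted_wrt_append)
    moreover have "\<not> A (vs, a # us)"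
    proof -
      have "\<not> lt b a" if "vs \<noteq> []" "b = last vs" for b
      proof -
        have b: "b \<in> set vs"
          using that by simp
        then have "lt a b" "b \<in> reflections"
          using path(2) refl by (auto simp: sorted_wrt_append)
        then show ?thesis
          using D(1,2)[of a b a] refl by blast
      qed
      then show ?thesis
        by (auto simp: A_def)
    qed
    ultimately show "(\<lambda>(ts, us). (butlast ts, last ts # us)) p \<in> {p \<in> S. \<not> A p}"
      by (simp add: p ts)
    show "- g ((\<lambda>(ts, us). (butlast ts, last ts # us)) p) = g p"
      by (simp add: p ts g_def)
  next
    fix p assume "p \<in> {p \<in> S. \<not> A p}"
    then obtain ts us where p: "p = (ts, us)" "(ts, us) \<in> S" "\<not> A (ts, us)"
      by (cases p) auto
    then obtain a vs where us: "us = a # vs"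
      using nonempty[of ts us] unfolding A_def by (cases us) auto
    have path: "path x (ts @ a # vs)" "sorted_wrt ?gt ts" "sorted_wrt lt (a # vs)"
      using p by (auto simp: S_def paths_def us)
    have refl: "set vs \<subseteq> reflections" "a \<in> reflections" "set ts \<subseteq> reflections"
      using path_reflections[OF path(1)] by auto
    show "(\<lambda>(ts, us). (butlast ts, last ts # us)) ((\<lambda>(ts, us). (ts @ [hd us], tl us)) p) = p"
      by (simp add: p us)
    have "lt a b" if "b \<in> set ts" for b
    proof (cases ts rule: rev_cases)
      case (snoc ws c)
      have "\<not> lt c a"
        using p by (simp add: A_def us snoc)
      \<comment> \<open>Two equal consecutive labels would return to the same vertex although the
        height has grown by two.\<close>
      moreover have "c \<noteq> a"
      proof
        assume "c = a"
        define z where "z = endpoint x ws"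
        have z: "z \<in> carrier W" "h (z \<otimes> a) = h z + 1" "h (z \<otimes> a \<otimes> a) = h (z \<otimes> a) + 1"
          using path(1) path_closed unfolding snoc \<open>c = a\<close> by (auto simp: path_append z_def)
        then show False
          using refl by simp
      qed
      ultimately have c: "lt a c"
        using D(3)[of a c a] refl snoc by auto
      show ?thesis
      proof (cases "b = c")
        case False
        then have "lt c b"
          using that path(2) snoc by (auto simp: sorted_wrt_append)
        then show ?thesis
          using c D(2)[of a c b] refl snoc that by auto
      qed (use c in simp)
    qed (use that in simp)
    then have "(ts @ [a], vs) \<in> S"
      using p path by (auto simp: S_def us sorted_wrt_append)
    moreover have "A (ts @ [a], vs)"
      using path(3) by (cases vs) (auto simp: A_def)
    ultimately show "(\<lambda>(ts, us). (ts @ [hd us], tl us)) p \<in> {p \<in> S. A p}"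
      by (simp add: p us)
  qed
  moreover have "S = {p \<in> S. A p} \<union> {p \<in> S. \<not> A p}"
    by blast
  then have "sum g S = sum g {p \<in> S. A p} + sum g {p \<in> S. \<not> A p}"
    using \<open>finite S\<close> sum.union_disjoint[of "{p \<in> S. A p}" "{p \<in> S. \<not> A p}" g] by auto
  ultimately have "sum g S = 0"
    by (simp add: sum_negf)
  have "sum g S = (\<Sum>z\<in>Z. sum g {p \<in> S. endpoint x (fst p) = z})"
  proof (rule sum.group[symmetric])
    show "(\<lambda>p. endpoint x (fst p)) ` S \<subseteq> Z"
      using path_le by (fastforce simp: S_def Z_def paths_def path_append)
  qed (use \<open>finite S\<close> fin in \<open>auto simp: Z_def\<close>)
  also have "\<dots> = (\<Sum>z\<in>Z. (-1) ^ nat (h z - h x) *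
    int (card (increasing_paths ?gt x z)) * int (card (increasing_paths lt z y)))"
  proof (rule sum.cong[OF refl])
    fix z assume "z \<in> Z"
    have "{p \<in> S. endpoint x (fst p) = z} = increasing_paths ?gt x z \<times> increasing_paths lt z y"
      by (auto simp: S_def increasing_paths_def paths_def path_append)
    moreover have "sum g (increasing_paths ?gt x z \<times> increasing_paths lt z y)
      = sum (\<lambda>_. (-1) ^ nat (h z - h x)) (increasing_paths ?gt x z \<times> increasing_paths lt z y)"
      using path_height by (intro sum.cong) (fastforce simp: g_def increasing_paths_def paths_def)+
    ultimately show "sum g {p \<in> S. endpoint x (fst p) = z} = (-1) ^ nat (h z - h x) *
      int (card (increasing_paths ?gt x z)) * int (card (increasing_paths lt z y))"
      by (simp add: card_cartesian_product)
  qed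
  finally show ?thesis
    using \<open>sum g S = 0\<close> by (simp add: Z_def)
qed

end

section \<open>Unique increasing paths\<close>

context coxeter_system
begin

text \<open>
  The relation between the two label pairs of a length-two interval. The matrix expressing the roots
  of \<open>a'\<close>, \<open>b'\<close> in those of \<open>a\<close>, \<open>b\<close> is symmetric of determinant \<open>-1\<close>: symmetry makes the
  increasing pair lexicographically first.
\<close>

definition dihedral_exchange :: "'w \<Rightarrow> 'w \<Rightarrow> 'w \<Rightarrow> 'w \<Rightarrow> bool" where
  "dihedral_exchange a b a' b' \<longleftrightarrow> (\<exists>k n l.
     rt a' = (\<lambda>f. k * rt a f + n * rt b f) \<and> rt b' = (\<lambda>f. n * rt a f + l * rt b f) \<and>
     k * l - n * n = -1 \<and> k + l = - 2 * pairing a b * n \<and> pairing a' b' = - pairing a b)"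

lemma dihedral_exchangeI:
  assumes "\<And>f. rt a' f = k * rt a f + n * rt b f" "\<And>f. rt b' f = n * rt a f + l * rt b f"
    "k * l - n * n = -1" "k + l = - 2 * pairing a b * n" "pairing a' b' = - pairing a b"
  shows "dihedral_exchange a b a' b'"
  unfolding dihedral_exchange_def
  by (rule exI[of _ k], rule exI[of _ n], rule exI[of _ l]) (intro conjI ext assms)

lemma dihedral_exchangeE:
  assumes "dihedral_exchange a b a' b'"
  obtains k n l where "rt a' = (\<lambda>f. k * rt a f + n * rt b f)" "rt b' = (\<lambda>f. n * rt a f + l * rt b f)"
    "k * l - n * n = -1" "k + l = - 2 * pairing a b * n" "pairing a' b' = - pairing a b"
  using assms unfolding dihedral_exchange_def by (elim exE conjE)

lemma dihedral_exchange_sym: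
  assumes "dihedral_exchange a b a' b'"
  shows "dihedral_exchange a' b' a b"
proof -
  obtain k n l where *: "rt a' = (\<lambda>f. k * rt a f + n * rt b f)" "rt b' = (\<lambda>f. n * rt a f + l * rt b f)"
     "k * l - n * n = -1" "k + l = - 2 * pairing a b * n" "pairing a' b' = - pairing a b"
    using assms by (rule dihedral_exchangeE)
  have "- l * rt a' f + n * rt b' f = (n * n - k * l) * rt a f" for f
    by (simp add: *(1,2) algebra_simps)
  moreover have "n * rt a' f + - k * rt b' f = (n * n - k * l) * rt b f" for f
    by (simp add: *(1,2) algebra_simps)
  moreover have "n * n - k * l = 1"
    using *(3) by simp
  ultimately show ?thesis
    using *(3-5) by (intro dihedral_exchangeI[of a "- l" a' n b' b "- k"]) (simp_all add: algebra_simps)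
qed

lemma dihedral_exchange_flip:
  assumes "dihedral_exchange a b a' b'" "a \<in> reflections" "b \<in> reflections" "a' \<in> reflections" "b' \<in> reflections"
  shows "dihedral_exchange b a b' a'"
proof -
  obtain k n l where *: "rt a' = (\<lambda>f. k * rt a f + n * rt b f)" "rt b' = (\<lambda>f. n * rt a f + l * rt b f)"
     "k * l - n * n = -1" "k + l = - 2 * pairing a b * n" "pairing a' b' = - pairing a b"
    using assms(1) by (rule dihedral_exchangeE)
  show ?thesis
    using *(3-5) pairing_sym[of a b] pairing_sym[of a' b'] assms(2-5)
    by (intro dihedral_exchangeI[of b' l b n a a' k]) (simp_all add: *(1,2) algebra_simps)
qed

text \<open>If \<open>b'\<close> preceded \<open>b\<close>, the common coefficient \<open>n\<close>
  would give a contradiction. For \<open>n > 0\<close> the equation for \<open>b'\<close> either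
  puts \<open>b'\<close> after \<open>b\<close>, or makes it \<open>a\<close>, or puts
  \<open>a\<close> between \<open>b'\<close> and \<open>b\<close>. For \<open>n < 0\<close> the
  equation for \<open>a'\<close> puts \<open>a\<close> between \<open>a'\<close> and
  \<open>b\<close>. The same \<open>n\<close> occurs in both equations because the matrix is
  symmetric.\<close>

lemma dihedral_exchange_less:
  assumes lt: "reflection_order lt" and ex: "dihedral_exchange a b a' b'"
    and refl: "a \<in> reflections" "b \<in> reflections" "a' \<in> reflections" "b' \<in> reflections"
    and less: "lt b a" "lt a' b'" and "b \<noteq> b'"
  shows "lt b b'"
proof (rule ccontr)
  note D = reflection_orderD[OF lt]
  assume "\<not> lt b b'"
  then have b'b: "lt b' b"
    using D(3)[OF refl(2,4,4)] \<open>b \<noteq> b'\<close> by blast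
  have "\<not> lt a b"
    using D(1,2)[OF refl(1,2,1)] less(1) by blast
  have "lt a' b"
    using D(2)[OF refl(3,4,2) less(2) b'b] .
  obtain k n l where *: "rt a' = (\<lambda>f. k * rt a f + n * rt b f)" "rt b' = (\<lambda>f. n * rt a f + l * rt b f)"
     "k * l - n * n = -1"
    using ex by (rule dihedral_exchangeE)
  consider "n > 0" "l > 0" | "n > 0" "l = 0" | "n > 0" "l < 0" | "n = 0" | "n < 0"
    by linarith
  then show False
  proof cases
    case 1
    then have "lt b b'"
      using D(4)[OF refl(2,1,4) 1(2,1)] less(1) *(2) by (simp add: add.commute)
    then show False
      using \<open>\<not> lt b b'\<close> by simp
  next
    case 2
    then have "b' = a"
      using rt_proportional_eq[OF refl(4,1), of n] *(2) by simp
    then show False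
      using b'b \<open>\<not> lt a b\<close> by simp
  next
    case 3
    have a: "rt a = (\<lambda>f. 1 / n * rt b' f + (- l / n) * rt b f)"
      using 3 by (auto simp: *(2) field_simps fun_eq_iff)
    have "lt a b"
      by (rule D(5)[OF refl(4,2,1) _ _ a b'b]) (use 3 in \<open>auto simp: divide_neg_pos\<close>)
    then show False
      using \<open>\<not> lt a b\<close> by simp
  next
    case 4
    then have "b' = b"
      using rt_proportional_eq[OF refl(4,2), of l] *(2) by simp
    then show False
      using \<open>b \<noteq> b'\<close> by simp
  next
    case 5
    have pos: "0 < rt a (\<lambda>_. 1)" "0 < rt b (\<lambda>_. 1)" "0 < rt a' (\<lambda>_. 1)"
      using refl positive_root_height by auto
    have "n * rt b (\<lambda>_. 1) < 0"
      using 5 pos by (simp add: mult_neg_pos)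
    then have "0 < k * rt a (\<lambda>_. 1)"
      using pos(3) unfolding *(1) by linarith
    then have "k > 0"
      using pos by (simp add: zero_less_mult_iff)
    then have a: "rt a = (\<lambda>f. 1 / k * rt a' f + (- n / k) * rt b f)"
      by (auto simp: *(1) field_simps fun_eq_iff)
    have "lt a b"
      by (rule D(5)[OF refl(3,2,1) _ _ a \<open>lt a' b\<close>]) (use 5 \<open>k > 0\<close> in \<open>auto simp: divide_neg_pos\<close>)
    then show False
      using \<open>\<not> lt a b\<close> by simp
  qed
qed

text \<open>The pairs of a length-two interval whose lower end goes up and whose upper end goes down
  under \<open>s i\<close>. The first row of the matrix is the reflection formula for
  \<open>cj i b\<close>.\<close>

lemma dihedral_exchange_simple:
  assumes "i \<in> I" "b \<in> reflections" "b \<noteq> s i"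
  shows "dihedral_exchange (s i) b (cj i b) (s i)"
proof (rule dihedral_exchangeI[of "cj i b" "- 2 * pairing (s i) b" "s i" 1 b "s i" 0])
  show "rt (cj i b) f = - 2 * pairing (s i) b * rt (s i) f + 1 * rt b f" for f
    using rt_cj_pairing[of b i] assms by simp
  show "pairing (cj i b) (s i) = - pairing (s i) b"
    using pairing_simple_cj[of b i] pairing_sym[of "cj i b" "s i"] assms by simp
qed (use assms in auto)

lemma dihedral_exchange_cj:
  assumes i: "i \<in> I" and refl: "a \<in> reflections" "b \<in> reflections" "a' \<in> reflections" "b' \<in> reflections"
    and ne: "a \<noteq> s i" "b \<noteq> s i" "a' \<noteq> s i" "b' \<noteq> s i"
    and ex: "dihedral_exchange (cj i a) (cj i b) (cj i a') (cj i b')"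
  shows "dihedral_exchange a b a' b'"
proof -
  have rt: "rt t = (\<lambda>f. rt (cj i t) (local.refl i f))" if "t \<in> reflections" "t \<noteq> s i" for t
    using rt_cj[OF that(1) i that(2)] i by simp
  obtain k n l where *: "rt (cj i a') = (\<lambda>f. k * rt (cj i a) f + n * rt (cj i b) f)"
     "rt (cj i b') = (\<lambda>f. n * rt (cj i a) f + l * rt (cj i b) f)"
     "k * l - n * n = -1" "k + l = - 2 * pairing (cj i a) (cj i b) * n"
     "pairing (cj i a') (cj i b') = - pairing (cj i a) (cj i b)"
    using ex by (rule dihedral_exchangeE)
  show ?thesis
  proof (rule dihedral_exchangeI)
    show "rt a' f = k * rt a f + n * rt b f" "rt b' f = n * rt a f + l * rt b f" for f
      unfolding rt[OF refl(3) ne(3)] rt[OF refl(4) ne(4)] *(1,2)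
      unfolding rt[OF refl(1) ne(1)] rt[OF refl(2) ne(2)] by (rule HOL.refl)+
  qed (use *(3-5) pairing_cj i refl ne in simp_all)
qed

text \<open>Shifting an interval by \<open>s i\<close> turns the pair \<open>(a, s i)\<close> into
  \<open>(s i, a)\<close> while the other pair is conjugated. Expressing the roots again in
  \<open>a\<close> and \<open>s i\<close> gives a new matrix, and the trace condition in
  \<open>dihedral_exchange\<close> is exactly what keeps it symmetric.\<close>

lemma dihedral_exchange_cj_mixed:
  assumes i: "i \<in> I" and refl: "a \<in> reflections" "a' \<in> reflections" "b' \<in> reflections"
    and ne: "a \<noteq> s i" "a' \<noteq> s i" "b' \<noteq> s i"
    and ex: "dihedral_exchange (s i) a (cj i a') (cj i b')"
  shows "dihedral_exchange a (s i) a' b'"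
proof -
  have rt: "rt t = (\<lambda>f. rt (cj i t) (local.refl i f))" if "t \<in> reflections" "t \<noteq> s i" for t
    using rt_cj[OF that(1) i that(2)] i by simp
  define p where "p = pairing (s i) a"
  have a: "rt a (refl i f) = rt a f - 2 * p * f i" for f
    using rt_cj[of a i] rt_cj_pairing[of a i f] refl i ne by (simp add: p_def)
  obtain k n l where *: "rt (cj i a') = (\<lambda>f. k * rt (s i) f + n * rt a f)"
     "rt (cj i b') = (\<lambda>f. n * rt (s i) f + l * rt a f)"
     "k * l - n * n = -1" "k + l = - 2 * p * n"
     "pairing (cj i a') (cj i b') = - p"
    using ex unfolding p_def by (rule dihedral_exchangeE)
  have l: "l = - k - 2 * p * n"
    using *(4) by simp
  have "refl i f i = - f i" for f
    using i by (simp add: refl_def)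
  then have "rt a' f = n * rt a f + l * rt (s i) f" "rt b' f = l * rt a f + (- n - 2 * p * l) * rt (s i) f" for f
    unfolding rt[OF refl(2) ne(2)] rt[OF refl(3) ne(3)] *(1,2) using i by (simp_all add: a l algebra_simps)
  moreover have "n * (- n - 2 * p * l) - l * l = -1"
    using *(3) by (simp add: l algebra_simps)
  moreover have "pairing a (s i) = p"
    using pairing_sym[of a "s i"] refl i by (simp add: p_def)
  moreover have "pairing a' b' = - p"
    using pairing_cj[OF refl(2,3) i ne(2,3)] *(5) by simp
  ultimately show ?thesis
    using l by (intro dihedral_exchangeI[of a' n a l "s i" b' "- n - 2 * p * l"]) simp_all
qed

end

section \<open>Induction along right descents of the upper end\<close>

context coxeter_height
begin

lemma paths_two_iff:
  "[a, b] \<in> paths x y \<longleftrightarrow> x \<in> carrier W \<and> a \<in> reflections \<and> b \<in> reflections \<and>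
     h (x \<otimes> a) = h x + 1 \<and> h (x \<otimes> a \<otimes> b) = h x + 2 \<and> y = x \<otimes> a \<otimes> b"
  by (auto simp: paths_def)

end

text \<open>The rank \<open>\<mu>\<close> measures the distance from the region where everything is
  already known. It is instantiated by the length, with the identity as that region, and by
  \<open>coset_len\<close>, with the parabolic subgroup.\<close>

locale coxeter_height_descent = coxeter_height W I m s h
  for W :: "('w, 'b) monoid_scheme" (structure) and I :: "'i set" and m s h +
  fixes \<mu> :: "'w \<Rightarrow> nat"
  assumes mu_mono: "edge x y \<Longrightarrow> \<mu> x \<le> \<mu> y"
    and mu_descent: "\<lbrakk>y \<in> carrier W; 0 < \<mu> y\<rbrakk> \<Longrightarrow> \<exists>i\<in>I. h (y \<otimes> s i) < h y \<and> \<mu> (y \<otimes> s i) < \<mu> y"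
    and base_finite: "\<lbrakk>\<mu> y = 0; le x y\<rbrakk> \<Longrightarrow> finite {z. le x z \<and> le z y}"
    and base_unique: "\<lbrakk>\<mu> y = 0; le x y; reflection_order lt\<rbrakk> \<Longrightarrow> \<exists>!ts. ts \<in> increasing_paths lt x y"
    and base_exchange: "\<lbrakk>\<mu> y = 0; [a, b] \<in> paths x y; [a', b'] \<in> paths x y; a \<noteq> a'\<rbrakk> \<Longrightarrow>
      dihedral_exchange a b a' b'"
begin

lemma mu_le: "le x y \<Longrightarrow> \<mu> x \<le> \<mu> y"
  by (induction rule: le_induct) (use mu_mono order_trans in blast)+

text \<open>By lifting, \<open>lower i\<close> maps the interval into the one from
  \<open>lower i x\<close> to \<open>y s i\<close>, and at most two elements have the same
  image.\<close>

lemma finite_interval: "le x y \<Longrightarrow> finite {z. le x z \<and> le z y}"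
proof (induction "\<mu> y" arbitrary: x y rule: less_induct)
  case less
  show ?case
  proof (cases "\<mu> y = 0")
    case True
    then show ?thesis
      using base_finite less.prems by blast
  next
    case False
    have y: "x \<in> carrier W" "y \<in> carrier W"
      using le_closed less.prems by auto
    then obtain i where i: "i \<in> I" "h (y \<otimes> s i) < h y" "\<mu> (y \<otimes> s i) < \<mu> y"
      using mu_descent False by blast
    let ?Z = "{z. le (lower i x) z \<and> le z (y \<otimes> s i)}"
    have low: "lower i y = y \<otimes> s i"
      using i by (simp add: lower_def)
    have "finite ?Z"
      using less.hyps[OF i(3)] lower_mono[OF less.prems i(1)] low by simp
    moreover have "{z. le x z \<and> le z y} \<subseteq> ?Z \<union> (\<lambda>z. z \<otimes> s i) ` ?Z"
    proof
      fix z assume z: "z \<in> {z. le x z \<and> le z y}"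
      then have "lower i z \<in> ?Z"
        using lower_mono[of x z i] lower_mono[of z y i] i(1) low by auto
      moreover have "z \<in> carrier W"
        using z le_closed by blast
      ultimately show "z \<in> ?Z \<union> (\<lambda>z. z \<otimes> s i) ` ?Z"
        using i(1) unfolding lower_def by (cases "h (z \<otimes> s i) < h z") (auto intro!: image_eqI[of _ _ "z \<otimes> s i"])
    qed
    ultimately show ?thesis
      by (meson finite_UnI finite_imageI finite_subset)
  qed
qed

text \<open>By lifting, the interval is closed under right multiplication by \<open>s i\<close>,
  which pairs elements whose heights differ by one.\<close>

lemma alternating_sum_interval:
  assumes i: "i \<in> I" and up: "h x < h (x \<otimes> s i)" and down: "h (y \<otimes> s i) < h y" and "le x y"
  shows "(\<Sum>z\<in>{z. le x z \<and> le z y}. (-1 :: int) ^ nat (h z - h x)) = 0"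
proof -
  let ?Z = "{z. le x z \<and> le z y}"
  have closed: "x \<in> carrier W" "y \<in> carrier W"
    using le_closed assms by auto
  have xy: "lower i x = x" "upper i y = y"
    using up down by (auto simp: lower_def upper_def)
  have mem: "z \<otimes> s i \<in> ?Z" if "z \<in> ?Z" for z
  proof -
    have z: "z \<in> carrier W" "le x z" "le z y"
      using that le_closed by auto
    have "le x (lower i z)" "le (upper i z) y"
      using lower_mono[OF z(2) i] upper_mono[OF z(3) i] xy by auto
    then have "le x (lower i z) \<and> le (lower i z) y" "le x (upper i z) \<and> le (upper i z) y"
      using lower_upper_le[OF z(1) i] z le_trans by blast+
    then show ?thesis
      unfolding lower_def upper_def by (auto split: if_splits)
  qed
  have "(\<Sum>z\<in>?Z. (-1 :: int) ^ nat (h z - h x)) = (\<Sum>z\<in>?Z. - ((-1) ^ nat (h z - h x)))"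
  proof (rule sum.reindex_bij_witness[where i = "\<lambda>z. z \<otimes> s i" and j = "\<lambda>z. z \<otimes> s i"])
    fix z assume z: "z \<in> ?Z"
    then have c: "z \<in> carrier W"
      using le_closed by blast
    show "z \<otimes> s i \<otimes> s i = z" "z \<otimes> s i \<otimes> s i = z"
      using c i by auto
    show "z \<otimes> s i \<in> ?Z" "z \<otimes> s i \<in> ?Z"
      using mem z by auto
    have "h x \<le> h z" "h x \<le> h (z \<otimes> s i)"
      using le_height[of x z] le_height[of x "z \<otimes> s i"] z mem[OF z] by auto
    then have "nat (h (z \<otimes> s i) - h x) = Suc (nat (h z - h x)) \<or> nat (h z - h x) = Suc (nat (h (z \<otimes> s i) - h x))"
      using height_simple[OF c i] by auto
    then show "- ((-1 :: int) ^ nat (h (z \<otimes> s i) - h x)) = (-1) ^ nat (h z - h x)"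
      by auto
  qed
  then show ?thesis
    by (simp add: sum_negf)
qed

text \<open>
  If \<open>x\<close> goes up under \<open>s i\<close> then \<open>unique_increasing_path_up_down\<close> applies. Otherwise \<open>x\<close> is
  an atom of the interval from \<open>p = x s i\<close> to \<open>y\<close>, and in the alternating sum of cuts for that
  interval all terms except the one of \<open>x\<close> are known to be \<open>\<plusminus>1\<close>.
\<close>

theorem unique_increasing_path:
  assumes "le x y" "reflection_order lt"
  shows "\<exists>!ts. ts \<in> increasing_paths lt x y"
  using assms
\<comment> \<open>The rank of the upper end comes first, then the height of the interval. The order
  \<open>lt\<close> is generalised because the induction passes to its converse and to upper
  conjugates.\<close>
proof (induction "(x, y)" arbitrary: x y lt rule:
    wf_induct_rule[OF wf_measures[of "[\<lambda>(x, y). \<mu> y, \<lambda>(x, y). nat (h y - h x)]"]])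
  case (1 x y lt)
  note xy = 1(2) and lt = 1(3)
  have IH: "\<exists>!ts. ts \<in> increasing_paths lt' x' y'"
    if "le x' y'" "reflection_order lt'" "\<mu> y' \<le> \<mu> y" "\<mu> y' < \<mu> y \<or> h y' - h x' < h y - h x" for x' y' lt'
  proof (rule 1(1)[OF _ that(1,2)])
    show "((x', y'), (x, y)) \<in> measures [\<lambda>(x, y). \<mu> y, \<lambda>(x, y). nat (h y - h x)]"
      using that(3,4) le_height[OF xy] le_height[OF that(1)] by auto
  qed
  have closed: "x \<in> carrier W" "y \<in> carrier W"
    using le_closed xy by auto
  show ?case
  proof (cases "\<mu> y = 0 \<or> x = y")
    case True
    then show ?thesis
      using base_unique[OF _ xy lt] closed by (auto simp: increasing_paths_def paths_self)
  next
    case False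
    then obtain i where i: "i \<in> I" "h (y \<otimes> s i) < h y" "\<mu> (y \<otimes> s i) < \<mu> y"
      using mu_descent closed by blast
    have lowy: "lower i y = y \<otimes> s i"
      using i by (simp add: lower_def)
    have up_down: "\<exists>!ts. ts \<in> increasing_paths lt' x' y"
      if "le x' y" "h x' < h (x' \<otimes> s i)" "reflection_order lt'" for x' lt'
    proof (rule unique_increasing_path_up_down[OF that(3) i(1) that(2) i(2) closed(2)])
      show "\<exists>!ts. ts \<in> increasing_paths (upper_conjugate i lt') x' (y \<otimes> s i)"
        using lower_mono[OF that(1) i(1)] that(2) lowy i(3)
        by (intro IH reflection_order_upper_conjugate that(3) i(1)) (auto simp: lower_def)
    qed
    show ?thesis
    proof (cases "h x < h (x \<otimes> s i)")
      case True
      then show ?thesis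
        using up_down xy lt by blast
    next
      case x_down: False
      define p where "p = x \<otimes> s i"
      have p: "p \<in> carrier W" "h x = h p + 1" "x = p \<otimes> s i" "h p < h (p \<otimes> s i)"
        using height_simple[OF closed(1) i(1)] x_down closed i(1) by (auto simp: p_def)
      have px: "le p x" and py: "le p y"
        using simple_edge(2)[OF p(1) i(1)] p edge_le le_trans[OF _ xy] by auto
      have lowp: "lower i p = p" "upper i p = x"
        using p by (auto simp: lower_def upper_def)
      have hxy: "h x < h y"
        using le_height[OF xy] False by auto
      let ?gt = "\<lambda>a b. lt b a"
      have gt: "reflection_order ?gt"
        using reflection_order_converse[OF lt] .
      let ?Z = "{z. le p z \<and> le z y}"
      \<comment> \<open>If \<open>z\<close> goes up, lifting puts it below \<open>y s i\<close>:
        either \<open>z\<close> is \<open>y s i\<close>, of smaller rank, or the interval from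
        \<open>p\<close> to \<open>z\<close> is shorter than that from \<open>x\<close> to
        \<open>y\<close>. If \<open>z\<close> goes down, the up-down case reduces to
        \<open>z s i\<close>, which has smaller rank or lies close enough to
        \<open>p\<close>.\<close>
      have D: "\<exists>!ts. ts \<in> increasing_paths ?gt p z" if z: "le p z" "le z y" for z
      proof -
        have zc: "z \<in> carrier W"
          using le_closed z by blast
        have hz: "h z < h y \<or> z = y"
          using le_height[OF z(2)] by auto
        have muz: "\<mu> z \<le> \<mu> y"
          using mu_le z by blast
        show ?thesis
        proof (cases "h z < h (z \<otimes> s i)")
          case True
          then have zy: "le z (y \<otimes> s i)"
            using lower_mono[OF z(2) i(1)] lowy by (simp add: lower_def)
          then have "z = y \<otimes> s i \<or> h z < h (y \<otimes> s i)"
            using le_height by blast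
          then show ?thesis
            using height_simple[OF closed(2) i(1)] i p(2) muz by (intro IH z(1) gt) auto
        next
          case False
          then have down: "h (z \<otimes> s i) = h z - 1"
            using height_simple[OF zc i(1)] by auto
          have lez: "le (z \<otimes> s i) z"
            using simple_edge(1)[OF zc i(1)] down edge_le by simp
          show ?thesis
          proof (rule unique_increasing_path_up_down[OF gt i(1) p(4) _ zc])
            show "\<exists>!ts. ts \<in> increasing_paths (upper_conjugate i ?gt) p (z \<otimes> s i)"
              using lower_mono[OF z(1) i(1)] lowp down mu_le[OF lez] muz hz i(3) p(2)
              by (intro IH reflection_order_upper_conjugate gt i(1)) (auto simp: lower_def)
          qed (use down in simp)
        qed
      qed
      \<comment> \<open>If \<open>z\<close> goes down, lifting the relation between \<open>p\<close>
        and \<open>z\<close> puts \<open>x\<close> below \<open>z\<close>, so for \<open>z\<close>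
        different from \<open>x\<close> the interval up to \<open>y\<close> is shorter.\<close>
      have U: "\<exists>!us. us \<in> increasing_paths lt z y" if z: "le p z" "le z y" "z \<noteq> x" for z
      proof (cases "h z < h (z \<otimes> s i)")
        case True
        then show ?thesis
          using up_down z lt by blast
      next
        case False
        then have "le x z"
          using upper_mono[OF z(1) i(1)] lowp by (simp add: upper_def split: if_splits)
            (use height_simple[OF le_closed(2)[OF z(1)] i(1)] in auto)
        then have "h x < h z"
          using le_height z by blast
        then show ?thesis
          using z hxy by (intro IH lt) auto
      qed
      have card_D: "card (increasing_paths ?gt p z) = 1" if "z \<in> ?Z" for z
        using D[of z] that by (auto simp: card_1_singleton_iff)
      have card_U: "card (increasing_paths lt z y) = 1" if "z \<in> ?Z" "z \<noteq> x" for z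
        using U[of z] that by (auto simp: card_1_singleton_iff)
      have fin: "finite ?Z"
        using finite_interval[OF py] .
      have "p \<noteq> y"
        using p(2) hxy by auto
      let ?sg = "\<lambda>z. (-1 :: int) ^ nat (h z - h p)"
      have x: "x \<in> ?Z"
        using px xy by simp
      have "0 = (\<Sum>z\<in>?Z. ?sg z * int (card (increasing_paths ?gt p z)) * int (card (increasing_paths lt z y)))"
        using alternating_sum_cuts[OF lt \<open>p \<noteq> y\<close> fin] by simp
      also have "\<dots> = (\<Sum>z\<in>?Z. ?sg z * int (card (increasing_paths lt z y)))"
        using card_D by (intro sum.cong) auto
      also have "\<dots> = ?sg x * int (card (increasing_paths lt x y)) + (\<Sum>z\<in>?Z - {x}. ?sg z * int (card (increasing_paths lt z y)))"
        using fin x by (rule sum.remove)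
      also have "(\<Sum>z\<in>?Z - {x}. ?sg z * int (card (increasing_paths lt z y))) = (\<Sum>z\<in>?Z - {x}. ?sg z)"
        using card_U by (intro sum.cong) auto
      also have "(\<Sum>z\<in>?Z - {x}. ?sg z) = (\<Sum>z\<in>?Z. ?sg z) - ?sg x"
        using sum.remove[OF fin x, of ?sg] by simp
      also have "(\<Sum>z\<in>?Z. ?sg z) = 0"
        using alternating_sum_interval[OF i(1) p(4) i(2) py] .
      finally have "card (increasing_paths lt x y) = 1"
        using p(2) by simp
      then show ?thesis
        by (metis (no_types, lifting) card_1_singletonE singleton_iff)
    qed
  qed
qed

text \<open>Choose a descent \<open>s i\<close> of \<open>y\<close>. If \<open>x\<close> goes up,
  \<open>path_up\<close> makes \<open>s i\<close> occur in both paths, first in one and last in the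
  other. If \<open>x\<close> goes down, both paths are shifted by \<open>s i\<close>; a final label
  \<open>s i\<close> becomes the first one, which is the mixed case.\<close>

theorem path_two_exchange:
  assumes "[a, b] \<in> paths x y" "[a', b'] \<in> paths x y" "a \<noteq> a'"
  shows "dihedral_exchange a b a' b'"
  using assms
proof (induction "\<mu> y" arbitrary: x y a b a' b' rule: less_induct)
  case less
  note P = less.prems(1,2)
  show ?case
  proof (cases "\<mu> y = 0")
    case True
    then show ?thesis
      using base_exchange less.prems by blast
  next
    case False
    have c: "x \<in> carrier W" "a \<in> reflections" "b \<in> reflections" "a' \<in> reflections" "b' \<in> reflections"
      and hx: "h (x \<otimes> a) = h x + 1" "h (x \<otimes> a') = h x + 1" "h y = h x + 2"
      and y: "y = x \<otimes> a \<otimes> b" "x \<otimes> a' \<otimes> b' = x \<otimes> a \<otimes> b"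
      using P by (auto simp: paths_two_iff)
    have ca: "x \<otimes> a \<in> carrier W" "x \<otimes> a' \<in> carrier W" "y \<in> carrier W"
      using c y by auto
    have ab: "a \<otimes> b = a' \<otimes> b'"
      using y c by (simp add: m_assoc)
    then have bb: "b \<noteq> b'"
      using c less.prems(3) by auto
    obtain i where i: "i \<in> I" "h (y \<otimes> s i) < h y" "\<mu> (y \<otimes> s i) < \<mu> y"
      using mu_descent[OF ca(3)] False by blast
    show ?thesis
    proof (cases "h x < h (x \<otimes> s i)")
      case True
      have simple: "c = s i \<or> d = s i" if "[c, d] \<in> paths x y" for c d
        using path_up(1)[of x "[c, d]" i] that i True unfolding paths_def by fastforce
      have main: "dihedral_exchange c d c' d'" if cd: "c = s i" "d' = s i" "[c, d] \<in> paths x y" "[c', d'] \<in> paths x y" for c d c' d'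
      proof -
        have "x \<otimes> (c' \<otimes> s i) = x \<otimes> (s i \<otimes> d)" "c' \<in> reflections" "d \<in> reflections"
          using that c i by (auto simp: paths_two_iff m_assoc)
        then have "c' \<otimes> s i = s i \<otimes> d"
          using c i by simp
        then have "c' = cj i d"
          unfolding cj_def using \<open>c' \<in> reflections\<close> i by (metis mult_simple_simple reflection_closed)
        moreover have "d \<noteq> s i"
          using that c i by (auto simp: paths_two_iff)
        ultimately show ?thesis
          using dihedral_exchange_simple[OF i(1) \<open>d \<in> reflections\<close>] cd by simp
      qed
      consider "a = s i" "b' = s i" | "a' = s i" "b = s i"
        using simple[OF P(1)] simple[OF P(2)] less.prems(3) bb by auto
      then show ?thesis
        using main[OF _ _ P] dihedral_exchange_sym[OF main[OF _ _ P(2,1)]] by cases auto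
    next
      case False
      then have hxs: "h (x \<otimes> s i) = h x - 1"
        using height_simple[OF c(1) i(1)] by auto
      have ne: "a \<noteq> s i" "a' \<noteq> s i"
        using hxs hx by auto
      have shift: "[cj i c, cj i d] \<in> paths (x \<otimes> s i) (y \<otimes> s i)"
        if "[c, d] \<in> paths x y" "c \<noteq> s i" "d \<noteq> s i" for c d
        using path_down(2)[of x "[c, d]" i] endpoint_cj[of x "[c, d]" i] that i c unfolding paths_def by auto
      have shift_simple: "[s i, c] \<in> paths (x \<otimes> s i) (y \<otimes> s i)" if "[c, s i] \<in> paths x y" for c
      proof -
        have "c \<in> reflections" "h (x \<otimes> c) = h x + 1" "y \<otimes> s i = x \<otimes> c"
          using that c i by (auto simp: paths_two_iff)
        then show ?thesis
          using c i hxs by (simp add: paths_two_iff)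
      qed
      have mixed: "dihedral_exchange c (s i) c' d'"
        if cd: "[c, s i] \<in> paths x y" "[c', d'] \<in> paths x y" "c \<noteq> s i" "c' \<noteq> s i" "d' \<noteq> s i" for c c' d'
      proof -
        have "c \<in> reflections" "c' \<in> reflections" "d' \<in> reflections"
          using cd by (auto simp: paths_two_iff)
        moreover have "s i \<noteq> cj i c'"
          using \<open>c' \<in> reflections\<close> i cd by (metis cj_eq_simple_iff reflection_closed)
        ultimately show ?thesis
          using less.hyps[OF i(3) shift_simple[OF cd(1)] shift[OF cd(2,4,5)]]
            dihedral_exchange_cj_mixed[OF i(1)] cd by blast
      qed
      consider "b \<noteq> s i" "b' \<noteq> s i" | "b = s i" "b' \<noteq> s i" | "b' = s i" "b \<noteq> s i"
        using bb by auto
      then show ?thesis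
      proof cases
        case 1
        moreover have "cj i a \<noteq> cj i a'"
          using c i less.prems(3) by (metis cj_cj reflection_closed)
        ultimately show ?thesis
          using less.hyps[OF i(3) shift[OF P(1)] shift[OF P(2)]] ne
          by (intro dihedral_exchange_cj[OF i(1) c(2-5)]) auto
      next
        case 2
        then show ?thesis
          using mixed[of a a' b'] P ne by simp
      next
        case 3
        then show ?thesis
          using mixed[of a' a b] P ne dihedral_exchange_sym by simp
      qed
    qed
  qed
qed

text \<open>A path that is not decreasing has two consecutive increasing labels. Replacing them by
  the decreasing pair of the same length-two interval makes the reversed list smaller. There are
  finitely many paths, so repetition ends at the only decreasing one.\<close>

theorem decreasing_path_lex_first:
  assumes lt: "reflection_order lt" and ts: "ts \<in> increasing_paths (\<lambda>a b. lt b a) x y"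
    and us: "us \<in> paths x y" "us \<noteq> ts"
  shows "(rev ts, rev us) \<in> lex {(a, b). a \<in> reflections \<and> b \<in> reflections \<and> lt a b}"
proof -
  let ?r = "{(a, b). a \<in> reflections \<and> b \<in> reflections \<and> lt a b}"
  note D = reflection_orderD[OF lt]
  have gt: "reflection_order (\<lambda>a b. lt b a)"
    using reflection_order_converse[OF lt] .
  have "le x y"
    using us path_le by (auto simp: paths_def)
  then have unique: "vs = ts" if "vs \<in> increasing_paths (\<lambda>a b. lt b a) x y" for vs
    using unique_increasing_path[OF _ gt] ts that by blast
  have trans: "trans (lex ?r)"
    using D(2) by (intro lex_transI) (auto simp: trans_def)
  have irrefl: "(as, as) \<notin> lex ?r" for as
    using D(1) by (auto simp: lex_conv)
  have step: "\<exists>vs\<in>paths x y. (rev vs, rev us) \<in> lex ?r" if us: "us \<in> paths x y" "us \<noteq> ts" for us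
  proof -
    have path: "path x us" "endpoint x us = y"
      using us by (auto simp: paths_def)
    have "\<not> sorted_wrt (\<lambda>a b. lt b a) us"
      using unique us by (auto simp: increasing_paths_def)
    moreover have "sorted_wrt (\<lambda>a b. lt b a) us \<longleftrightarrow> successively (\<lambda>a b. lt b a) us"
      using D(2) path_reflections[OF path(1)]
      by (intro successively_iff_sorted_wrt_strong[symmetric]) blast
    ultimately obtain n where n: "Suc n < length us" "\<not> lt (us ! Suc n) (us ! n)"
      by (auto simp: successively_conv_nth)
    define as a b bs where "as = take n us" and "a = us ! n" and "b = us ! Suc n" and "bs = drop (Suc (Suc n)) us"
    have split: "us = as @ [a, b] @ bs"
      unfolding as_def a_def b_def bs_def using n(1)
      by (metis Cons_nth_drop_Suc Suc_lessD append_Cons append_Nil append_take_drop_id)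
    define z where "z = endpoint x as"
    have z: "path x as" "path z ([a, b] @ bs)"
      using path by (auto simp: split path_append z_def)
    then have ab: "[a, b] \<in> paths z (z \<otimes> a \<otimes> b)"
      by (auto simp: paths_def path_append simp del: append.simps)
    then have "le z (z \<otimes> a \<otimes> b)"
      using path_le unfolding paths_def by fastforce
    then obtain vs where vs: "vs \<in> paths z (z \<otimes> a \<otimes> b)" "sorted_wrt (\<lambda>a b. lt b a) vs"
      using unique_increasing_path[OF _ gt] unfolding increasing_paths_def by blast
    then have "length vs = 2"
      using ab path_height[of z vs] by (auto simp: paths_def)
    then obtain a' b' where vs': "vs = [a', b']"
      by (auto simp: numeral_2_eq_2 length_Suc_conv)
    have c: "z \<in> carrier W" "a \<in> reflections" "b \<in> reflections" "a' \<in> reflections" "b' \<in> reflections"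
      and h2: "h (z \<otimes> a) = h z + 1" "h (z \<otimes> a \<otimes> b) = h z + 2"
      and eq: "z \<otimes> a \<otimes> b = z \<otimes> a' \<otimes> b'"
      using ab vs(1) by (auto simp: paths_two_iff vs')
    have "a \<noteq> b"
      using h2 c by auto
    then have "lt a b"
      using n(2) D(3)[OF c(2,3,3)] by (auto simp: a_def b_def)
    have "lt b' a'"
      using vs(2) by (simp add: vs')
    have "a \<otimes> b = a' \<otimes> b'"
      using eq c by (simp add: m_assoc)
    moreover have "\<not> lt b a"
      using \<open>lt a b\<close> D(1,2)[OF c(2,3,2)] by blast
    ultimately have ne: "a' \<noteq> a" "b' \<noteq> b"
      using \<open>lt b' a'\<close> c by auto
    \<comment> \<open>The upper of the two replaced labels decides, since the lists are compared in
      reverse; this is where the relation between the two label pairs enters.\<close>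
    have "lt b' b"
      using dihedral_exchange_less[OF lt path_two_exchange[of a' b' z "z \<otimes> a \<otimes> b" a b]] vs(1) ab c
        \<open>lt b' a'\<close> \<open>lt a b\<close> ne by (simp add: vs')
    define ws where "ws = as @ [a', b'] @ bs"
    have "ws \<in> paths x y"
      using path vs(1) eq unfolding ws_def split by (auto simp: paths_def path_append vs' z_def)
    moreover have "(b' # a' # rev as, b # a # rev as) \<in> lex ?r"
      using \<open>lt b' b\<close> c by simp
    then have "(rev ws, rev us) \<in> lex ?r"
      unfolding ws_def split by (simp del: Cons_in_lex add: lex_append_leftI)
    ultimately show ?thesis
      by blast
  qed
  have fin: "finite {vs \<in> paths x y. (rev vs, rev us) \<in> lex ?r}" for us
    using finite_paths[OF finite_interval[OF \<open>le x y\<close>]] by simp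
  show ?thesis
    using us
  proof (induction "card {vs \<in> paths x y. (rev vs, rev us) \<in> lex ?r}" arbitrary: us rule: less_induct)
    case less
    obtain vs where vs: "vs \<in> paths x y" "(rev vs, rev us) \<in> lex ?r"
      using step less.prems by blast
    show ?case
    proof (cases "vs = ts")
      case False
      have "{ws \<in> paths x y. (rev ws, rev vs) \<in> lex ?r} \<subset> {ws \<in> paths x y. (rev ws, rev us) \<in> lex ?r}"
        using vs irrefl transD[OF trans] by blast
      then have "(rev ts, rev vs) \<in> lex ?r"
        using less.hyps[OF psubset_card_mono[OF fin] vs(1) False] by blast
      then show ?thesis
        using vs(2) transD[OF trans] by blast
    qed (use vs in simp)
  qed
qed

end

section \<open>The Bruhat order and its parabolic twist\<close>

context coxeter_system
begin

sublocale bruhat: coxeter_height W I m s "\<lambda>x. int (len x)"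
proof
  show "int (len (x \<otimes> s i)) = int (len x) + 1 \<or> int (len (x \<otimes> s i)) = int (len x) - 1"
    if "x \<in> carrier W" "i \<in> I" for x i
    using len_mult_simple[OF that] by linarith
  show "int (len x) < int (len (x \<otimes> t)) \<longleftrightarrow> int (len (x \<otimes> s i)) < int (len (x \<otimes> t \<otimes> s i))"
    if "x \<in> carrier W" "t \<in> reflections" "i \<in> I" "t \<noteq> s i" for x t i
    using len_height_cond[OF that] by simp
qed

lemma bruhat_le_one:
  assumes "len y = 0" "bruhat.le x y"
  shows "x = \<one>" "y = \<one>"
proof -
  show "y = \<one>"
    using len_eq_0_iff[of y] bruhat.le_closed(2)[OF assms(2)] assms(1) by simp
  then show "x = \<one>"
    using bruhat.le_height[OF assms(2)] by auto
qed

sublocale bruhat: coxeter_height_descent W I m s "\<lambda>x. int (len x)" len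
proof
  show "len x \<le> len y" if "bruhat.edge x y" for x y
    using that by (simp add: bruhat.edge_def)
  show "\<exists>i\<in>I. int (len (y \<otimes> s i)) < int (len y) \<and> len (y \<otimes> s i) < len y"
    if y: "y \<in> carrier W" "0 < len y" for y
  proof -
    have "y \<noteq> \<one>"
      using y by auto
    then obtain i where "i \<in> I" "len y = len (y \<otimes> s i) + 1"
      using right_descent_exists y by blast
    then show ?thesis
      by (intro bexI[of _ i]) auto
  qed
  show "finite {z. bruhat.le x z \<and> bruhat.le z y}" if "len y = 0" "bruhat.le x y" for x y
    using bruhat_le_one[OF that(1)] by (auto intro: finite_subset[of _ "{\<one>}"])
  show "\<exists>!ts. ts \<in> bruhat.increasing_paths lt x y" if "len y = 0" "bruhat.le x y" for x y lt
    using bruhat_le_one[OF that] by (auto simp: bruhat.increasing_paths_def bruhat.paths_self)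
  show "dihedral_exchange a b a' b'" if "len y = 0" "[a, b] \<in> bruhat.paths x y" for x y a b a' b'
    using that bruhat.path_height[of x "[a, b]"] by (auto simp: bruhat.paths_def)
qed

lemma bruhat_le_iff: "bruhat_le v w \<longleftrightarrow> bruhat.le v w"
proof -
  have "bruhat_step = bruhat.edge"
    by (auto simp: bruhat_step_def bruhat.edge_def fun_eq_iff)
  then show ?thesis
    by (simp add: bruhat_le_def bruhat.le_def)
qed

lemma parabolic_eq_words:
  assumes "J \<subseteq> I"
  shows "parabolic J = val ` lists J"
proof
  have subset: "lists J \<subseteq> lists I"
    using assms by (rule lists_mono)
  show "parabolic J \<subseteq> val ` lists J"
  proof
    fix x assume "x \<in> parabolic J"
    then show "x \<in> val ` lists J"
      unfolding parabolic_def
    proof (induction rule: generate.induct)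
      case one
      show ?case
        by (rule image_eqI[of _ _ "[]"]) auto
    next
      case (incl h)
      then obtain j where "j \<in> J" "h = s j"
        by blast
      then show ?case
        using assms by (intro image_eqI[of _ _ "[j]"]) auto
    next
      case (inv h)
      then obtain j where "j \<in> J" "h = s j"
        by blast
      then show ?case
        using assms by (intro image_eqI[of _ _ "[j]"]) auto
    next
      case (eng h1 h2)
      then obtain u v where "u \<in> lists J" "v \<in> lists J" "h1 = val u" "h2 = val v"
        by blast
      then show ?case
        using subset by (intro image_eqI[of _ _ "u @ v"]) (auto simp: val_append subset_iff)
    qed
  qed
  show "val ` lists J \<subseteq> parabolic J"
  proof (rule image_subsetI)
    fix u assume "u \<in> lists J"
    then show "val u \<in> parabolic J"
      unfolding parabolic_def
      by (induction u) (auto intro: generate.one generate.eng generate.incl)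
  qed
qed

lemma parabolic_subgroup: "J \<subseteq> I \<Longrightarrow> subgroup (parabolic J) W"
  unfolding parabolic_def by (rule generate_is_subgroup) auto

end

section \<open>Parabolic subgroups, minimal coset representatives and the twisted height\<close>

locale coxeter_parabolic = coxeter_system W I m s
  for W :: "('w, 'b) monoid_scheme" (structure) and I :: "'i set" and m s +
  fixes J :: "'i set"
  assumes J_subset: "J \<subseteq> I"
begin

abbreviation P :: "'w set" where
  "P \<equiv> parabolic J"

lemma P_subgroup: "subgroup P W"
  using parabolic_subgroup J_subset .

lemma P_closed [simp]: "a \<in> P \<Longrightarrow> a \<in> carrier W"
  using subgroup.mem_carrier[OF P_subgroup] .

lemma P_one [simp]: "\<one> \<in> P"
  using subgroup.one_closed[OF P_subgroup] .

lemma P_mult [simp]: "a \<in> P \<Longrightarrow> b \<in> P \<Longrightarrow> a \<otimes> b \<in> P"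
  using subgroup.m_closed[OF P_subgroup] .

lemma P_inv [simp]: "a \<in> P \<Longrightarrow> inv a \<in> P"
  using subgroup.m_inv_closed[OF P_subgroup] .

lemma P_mult_iff: "a \<in> P \<Longrightarrow> x \<in> carrier W \<Longrightarrow> a \<otimes> x \<in> P \<longleftrightarrow> x \<in> P"
  by (metis P_closed P_inv P_mult inv_mult_cancel)

lemma P_simple [simp]: "j \<in> J \<Longrightarrow> s j \<in> P"
  unfolding parabolic_def by (auto intro: generate.incl)

lemma J_lists: "u \<in> lists J \<Longrightarrow> u \<in> lists I"
  using J_subset by auto

lemma J_in_I [simp]: "j \<in> J \<Longrightarrow> j \<in> I"
  using J_subset by blast

lemma val_J_closed [simp]: "u \<in> lists J \<Longrightarrow> val u \<in> carrier W"
  using J_lists by (rule val_closed)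

lemma P_word: "u \<in> lists J \<Longrightarrow> val u \<in> P"
  using parabolic_eq_words[OF J_subset] by blast

text \<open>A word in \<open>J\<close> can be shortened to a reduced one without leaving
  \<open>J\<close>, since strong exchange only deletes letters.\<close>

lemma P_reduced_word:
  assumes "a \<in> P"
  obtains u where "u \<in> lists J" "val u = a" "length u = len a"
proof -
  have "\<exists>v\<in>lists J. val v = val u \<and> length v = len (val u)" if "u \<in> lists J" for u
    using that
  proof (induction u rule: rev_induct)
    case Nil
    then show ?case
      by auto
  next
    case (snoc j u)
    then have j: "j \<in> J" "u \<in> lists J"
      by auto
    then obtain v where v: "v \<in> lists J" "val v = val u" "length v = len (val u)"
      using snoc by auto
    have eq: "val (u @ [j]) = val v \<otimes> s j"
      using j J_lists v by (simp add: val_append)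
    have "val v \<in> carrier W"
      using v(1) by (rule val_J_closed)
    then consider "len (val v \<otimes> s j) = len (val v) + 1" | "len (val v) = len (val v \<otimes> s j) + 1"
      using len_mult_simple[of "val v" j] j by auto
    then show ?case
    proof cases
      case 1
      have "val (v @ [j]) = val v \<otimes> s j"
        using j J_lists v by (simp add: val_append)
      then show ?thesis
        using 1 v j eq by (intro bexI[of _ "v @ [j]"]) auto
    next
      case 2
      then obtain a i b where "v = a @ i # b" "val v \<otimes> s j = val (a @ b)"
        using strong_exchange_len[of v "s j"] v j J_lists by auto
      then show ?thesis
        using 2 v eq by (intro bexI[of _ "a @ b"]) auto
    qed
  qed
  then show ?thesis
    using that assms unfolding parabolic_eq_words[OF J_subset] by blast
qed

text \<open>Minimality in the right coset of \<open>P\<close>, whereas \<open>min_reps\<close>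
  concerns left cosets; the two are exchanged by inversion (\<open>min_reps_iff\<close>).\<close>

definition minimal :: "'w \<Rightarrow> bool" where
  "minimal b \<longleftrightarrow> b \<in> carrier W \<and> (\<forall>a\<in>P. len b \<le> len (a \<otimes> b))"

definition coset_len :: "'w \<Rightarrow> nat" where
  "coset_len x = (LEAST n. \<exists>a\<in>P. n = len (a \<otimes> x))"

text \<open>For \<open>x = a b\<close> with \<open>a\<close> in \<open>P\<close> and
  \<open>b\<close> minimal this is the length of \<open>b\<close> minus that of \<open>a\<close>.
  The formula is stated without choosing such a decomposition.\<close>

definition twisted_height :: "'w \<Rightarrow> int" where
  "twisted_height x = 2 * int (coset_len x) - int (len x)"

lemma minimal_closed [simp]: "minimal b \<Longrightarrow> b \<in> carrier W"
  by (simp add: minimal_def)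

lemma minimal_decomposition:
  assumes "x \<in> carrier W"
  obtains a b where "a \<in> P" "minimal b" "x = a \<otimes> b" "coset_len x = len b"
proof -
  have "\<exists>n. \<exists>a\<in>P. n = len (a \<otimes> x)"
    using P_one by blast
  from LeastI_ex[OF this] obtain a where a: "a \<in> P" "coset_len x = len (a \<otimes> x)"
    unfolding coset_len_def by blast
  have "minimal (a \<otimes> x)"
    unfolding minimal_def
  proof (intro conjI ballI)
    fix c assume c: "c \<in> P"
    have "coset_len x \<le> len (c \<otimes> a \<otimes> x)"
      unfolding coset_len_def by (rule Least_le) (use a c in auto)
    then show "len (a \<otimes> x) \<le> len (c \<otimes> (a \<otimes> x))"
      using a c assms by (simp add: m_assoc)
  qed (use a assms in simp)
  then show ?thesis
    using that[of "inv a" "a \<otimes> x"] a assms by simp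
qed

lemma coset_len_mult:
  assumes "a \<in> P" "x \<in> carrier W"
  shows "coset_len (a \<otimes> x) = coset_len x"
proof -
  have "(\<exists>c\<in>P. n = len (c \<otimes> (a \<otimes> x))) \<longleftrightarrow> (\<exists>c\<in>P. n = len (c \<otimes> x))" for n
  proof
    assume "\<exists>c\<in>P. n = len (c \<otimes> (a \<otimes> x))"
    then obtain c where c: "c \<in> P" "n = len (c \<otimes> (a \<otimes> x))"
      by blast
    then show "\<exists>c\<in>P. n = len (c \<otimes> x)"
      using assms by (intro bexI[of _ "c \<otimes> a"]) (simp_all add: m_assoc)
  next
    assume "\<exists>c\<in>P. n = len (c \<otimes> x)"
    then obtain c where c: "c \<in> P" "n = len (c \<otimes> x)"
      by blast
    then show "\<exists>c\<in>P. n = len (c \<otimes> (a \<otimes> x))"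
      using assms by (intro bexI[of _ "c \<otimes> inv a"]) (simp_all add: m_assoc)
  qed
  then show ?thesis
    by (simp add: coset_len_def)
qed

lemma coset_len_minimal: "minimal b \<Longrightarrow> coset_len b = len b"
  unfolding coset_len_def
  by (rule Least_equality) (auto simp: minimal_def intro: bexI[of _ \<one>])

lemma left_exchange:
  assumes "u \<in> lists I" "i \<in> I" "len (s i \<otimes> val u) < len (val u)"
  shows "\<exists>a k b. u = a @ k # b \<and> s i \<otimes> val u = val (a @ b)"
proof -
  let ?x = "val u"
  let ?t = "inv ?x \<otimes> s i \<otimes> ?x"
  have x: "?x \<in> carrier W"
    using assms by simp
  have "?t \<in> reflections"
    using conj_reflection[of "inv ?x" "s i"] x assms by simp
  moreover have eq: "?x \<otimes> ?t = s i \<otimes> ?x"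
    using x assms by (simp add: m_assoc)
  ultimately show ?thesis
    using strong_exchange_len[OF assms(1), of ?t] assms(3) unfolding eq by simp
qed

lemma left_descent_exists:
  assumes "a \<in> P" "a \<noteq> \<one>"
  obtains j a' where "j \<in> J" "a' \<in> P" "a = s j \<otimes> a'" "len a = len a' + 1"
proof -
  obtain u where u: "u \<in> lists J" "val u = a" "length u = len a"
    using P_reduced_word assms by blast
  then obtain j v where v: "u = j # v"
    using assms by (cases u) auto
  then have j: "j \<in> J" "v \<in> lists J"
    using u by auto
  have "a = s j \<otimes> val v"
    using u v by simp
  then have "len a \<le> len (val v) + 1"
    using len_mult_le[of "s j" "val v"] j J_lists by simp
  moreover have "len (val v) \<le> length v"
    using len_val_le J_lists j by blast
  ultimately show ?thesis
    using that[of j "val v"] j P_word u v by simp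
qed

text \<open>Build up \<open>a\<close> letter by letter on the left. If a new letter shortened the
  product, exchange would delete a letter either from the word of \<open>a'\<close>, making
  \<open>a\<close> too short, or from that of \<open>b\<close>, giving a shorter element of the
  coset of \<open>b\<close>.\<close>

lemma len_P_mult_minimal:
  assumes "a \<in> P" "minimal b"
  shows "len (a \<otimes> b) = len a + len b"
  using assms(1)
proof (induction "len a" arbitrary: a rule: less_induct)
  case less
  show ?case
  proof (cases "a = \<one>")
    case True
    then show ?thesis
      using assms by simp
  next
    case False
    then obtain j a' where j: "j \<in> J" "a' \<in> P" "a = s j \<otimes> a'" "len a = len a' + 1"
      using left_descent_exists less.prems by blast
    have IH: "len (a' \<otimes> b) = len a' + len b"
      using less.hyps j by simp
    obtain u where u: "u \<in> lists J" "val u = a'" "length u = len a'"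
      using P_reduced_word j by blast
    obtain v where v: "v \<in> lists I" "val v = b" "length v = len b"
      using reduced_word_exists assms(2) minimal_closed by blast
    have uv: "u @ v \<in> lists I" "val (u @ v) = a' \<otimes> b"
      using u v J_lists by (auto simp: val_append)
    have c: "a' \<in> carrier W" "b \<in> carrier W" "s j \<in> carrier W"
      using j assms by simp_all
    have "\<not> len (s j \<otimes> (a' \<otimes> b)) < len (a' \<otimes> b)"
    proof
      assume "len (s j \<otimes> (a' \<otimes> b)) < len (a' \<otimes> b)"
      then obtain p k q where pq: "u @ v = p @ k # q" "s j \<otimes> (a' \<otimes> b) = val (p @ q)"
        using left_exchange[OF uv(1), of j] uv(2) j by auto
      from pq(1) consider q' where "u = p @ k # q'" "q = q' @ v" | p' where "p = u @ p'" "v = p' @ k # q"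
        by (auto simp: append_eq_append_conv2 append_eq_Cons_conv Cons_eq_append_conv)
      then show False
      proof cases
        case 1
        then have l: "p \<in> lists J" "q' \<in> lists J"
          using u by auto
        then have "val (p @ q) = val (p @ q') \<otimes> b"
          using 1 v c J_lists by (simp add: val_append m_assoc)
        then have "a \<otimes> b = val (p @ q') \<otimes> b"
          using pq(2) j c by (simp add: m_assoc)
        then have "a = val (p @ q')"
          using l c J_lists less.prems by simp
        then have "len a \<le> length (p @ q')"
          using len_val_le[of "p @ q'"] l J_lists by simp
        then show False
          using u 1 j(4) by simp
      next
        case 2
        then have l: "p' \<in> lists I" "q \<in> lists I"
          using v by auto
        then have "val (p @ q) = a' \<otimes> val (p' @ q)"
          using 2 u J_lists by (simp add: val_append m_assoc)
        then have "inv a' \<otimes> (s j \<otimes> (a' \<otimes> b)) = val (p' @ q)"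
          using pq(2) c l by simp
        then have "val (p' @ q) = (inv a' \<otimes> s j \<otimes> a') \<otimes> b"
          using c by (simp add: m_assoc)
        moreover have "inv a' \<otimes> s j \<otimes> a' \<in> P"
          using j by simp
        ultimately have "len b \<le> len (val (p' @ q))"
          using assms(2) unfolding minimal_def by simp
        then show False
          using len_val_le[of "p' @ q"] l v 2 by simp
      qed
    qed
    moreover have "len (s j \<otimes> (a' \<otimes> b)) \<noteq> len (a' \<otimes> b)"
      using even_len_mult[of "s j" "a' \<otimes> b"] c j(1) by auto
    moreover have "len (s j \<otimes> (a' \<otimes> b)) \<le> 1 + len (a' \<otimes> b)"
      using len_mult_le[of "s j" "a' \<otimes> b"] c j(1) by simp
    ultimately show ?thesis
      using IH j c by (simp add: m_assoc)
  qed
qed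

lemma twisted_height_decomposition:
  "a \<in> P \<Longrightarrow> minimal b \<Longrightarrow> twisted_height (a \<otimes> b) = int (len b) - int (len a)"
  by (simp add: twisted_height_def coset_len_mult coset_len_minimal len_P_mult_minimal)

lemma minimalI:
  assumes "b \<in> carrier W" "\<And>j. j \<in> J \<Longrightarrow> len b \<le> len (s j \<otimes> b)"
  shows "minimal b"
proof -
  obtain a c where ac: "a \<in> P" "minimal c" "b = a \<otimes> c"
    using minimal_decomposition assms(1) by blast
  have "a = \<one>"
  proof (rule ccontr)
    assume "a \<noteq> \<one>"
    then obtain j a' where j: "j \<in> J" "a' \<in> P" "a = s j \<otimes> a'" "len a = len a' + 1"
      using left_descent_exists ac by blast
    then have "s j \<otimes> b = a' \<otimes> c"
      using ac by (simp add: m_assoc)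
    then have "len (s j \<otimes> b) < len b"
      using len_P_mult_minimal ac j by simp
    then show False
      using assms(2)[OF j(1)] by simp
  qed
  then show ?thesis
    using ac by simp
qed

text \<open>Deodhar's lemma. If some \<open>s j\<close> shortens \<open>b s i\<close>, exchange
  deletes a letter of a word for \<open>b s i\<close>. Deleting the last letter gives
  \<open>s j b = b s i\<close>; deleting a letter of \<open>b\<close> would make
  \<open>s j b\<close> shorter than \<open>b\<close>.\<close>

lemma minimal_mult_simple:
  assumes "minimal b" "i \<in> I"
  shows "minimal (b \<otimes> s i) \<or> (\<exists>j\<in>J. b \<otimes> s i = s j \<otimes> b)"
proof (cases "\<forall>j\<in>J. len (b \<otimes> s i) \<le> len (s j \<otimes> (b \<otimes> s i))")
  case True
  then show ?thesis
    using minimalI[of "b \<otimes> s i"] assms by simp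
next
  case False
  then obtain j where j: "j \<in> J" "len (s j \<otimes> (b \<otimes> s i)) < len (b \<otimes> s i)"
    by auto
  have b: "b \<in> carrier W" "s j \<in> carrier W"
    using assms j by simp_all
  have lenb: "len b \<le> len (s j \<otimes> b)"
    using assms(1) j(1) by (simp add: minimal_def)
  have "len (s j \<otimes> b) \<le> len (s j \<otimes> (b \<otimes> s i)) + 1"
    using len_mult_le[of "s j \<otimes> (b \<otimes> s i)" "s i"] b assms(2) by (simp add: m_assoc)
  then have up: "len (b \<otimes> s i) = len b + 1"
    using len_mult_simple[OF b(1) assms(2)] lenb j(2) by linarith
  obtain v where v: "v \<in> lists I" "val v = b" "length v = len b"
    using reduced_word_exists b by blast
  have "val (v @ [i]) = b \<otimes> s i"
    using v assms(2) by (simp add: val_append)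
  then obtain p k q where pq: "v @ [i] = p @ k # q" "s j \<otimes> (b \<otimes> s i) = val (p @ q)"
    using left_exchange[of "v @ [i]" j] v assms(2) j by auto
  show ?thesis
  proof (cases q rule: rev_cases)
    case Nil
    then have "s j \<otimes> (b \<otimes> s i) = b"
      using pq v by simp
    then have "b \<otimes> s i = s j \<otimes> b"
      using b assms(2) j(1) by (metis J_in_I m_closed simple_in_carrier simple_simple_mult)
    then show ?thesis
      using j by blast
  next
    case (snoc q' i')
    then have q: "v = p @ k # q'" "q = q' @ [i]"
      using pq(1) by auto
    then have l: "p \<in> lists I" "q' \<in> lists I"
      using v by auto
    then have "val (p @ q) = val (p @ q') \<otimes> s i"
      using q assms(2) by (simp add: val_append m_assoc)
    then have "s j \<otimes> b \<otimes> s i = val (p @ q') \<otimes> s i"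
      using pq(2) b assms(2) by (simp add: m_assoc)
    then have "s j \<otimes> b = val (p @ q')"
      using b assms(2) l by simp
    then have "len (s j \<otimes> b) < len b"
      using len_val_le[of "p @ q'"] l v q by simp
    then show ?thesis
      using lenb by simp
  qed
qed

lemma minimal_descent:
  assumes "minimal b" "i \<in> I" "len (b \<otimes> s i) < len b"
  shows "minimal (b \<otimes> s i)"
proof -
  have "b \<otimes> s i \<noteq> s j \<otimes> b" if "j \<in> J" for j
  proof
    assume "b \<otimes> s i = s j \<otimes> b"
    moreover have "len b \<le> len (s j \<otimes> b)"
      using assms(1) that by (simp add: minimal_def)
    ultimately show False
      using assms(3) by simp
  qed
  then show ?thesis
    using minimal_mult_simple[OF assms(1,2)] by blast
qed

lemma twisted_height_simple:
  assumes "x \<in> carrier W" "i \<in> I"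
  shows "twisted_height (x \<otimes> s i) = twisted_height x + 1 \<or> twisted_height (x \<otimes> s i) = twisted_height x - 1"
proof -
  obtain a b where ab: "a \<in> P" "minimal b" "x = a \<otimes> b"
    using minimal_decomposition assms by blast
  have xs: "x \<otimes> s i = a \<otimes> (b \<otimes> s i)"
    using ab assms by (simp add: m_assoc)
  from minimal_mult_simple[OF ab(2) assms(2)] show ?thesis
  proof
    assume "minimal (b \<otimes> s i)"
    then have "twisted_height (x \<otimes> s i) = int (len (b \<otimes> s i)) - int (len a)"
      unfolding xs by (rule twisted_height_decomposition[OF ab(1)])
    moreover have "twisted_height x = int (len b) - int (len a)"
      unfolding ab(3) by (rule twisted_height_decomposition[OF ab(1,2)])
    ultimately show ?thesis
      using len_mult_simple[OF minimal_closed[OF ab(2)] assms(2)] by auto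
  next
    assume "\<exists>j\<in>J. b \<otimes> s i = s j \<otimes> b"
    then obtain j where j: "j \<in> J" "b \<otimes> s i = s j \<otimes> b"
      by blast
    then have "x \<otimes> s i = (a \<otimes> s j) \<otimes> b"
      using ab xs by (simp add: m_assoc)
    then have "twisted_height (x \<otimes> s i) = int (len b) - int (len (a \<otimes> s j))"
      using twisted_height_decomposition[of "a \<otimes> s j" b] ab j by simp
    moreover have "twisted_height x = int (len b) - int (len a)"
      unfolding ab(3) by (rule twisted_height_decomposition[OF ab(1,2)])
    ultimately show ?thesis
      using len_mult_simple[OF P_closed[OF ab(1)] J_in_I[OF j(1)]] by auto
  qed
qed

lemma twisted_height_parabolic_reflection:
  assumes "x \<in> carrier W" "t \<in> reflections" "x \<otimes> t \<otimes> inv x \<in> P"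
  shows "coset_len (x \<otimes> t) = coset_len x"
    and "twisted_height x < twisted_height (x \<otimes> t) \<longleftrightarrow> len (x \<otimes> t) < len x"
proof -
  have "x \<otimes> t = (x \<otimes> t \<otimes> inv x) \<otimes> x"
    using assms(1,2) by (simp add: m_assoc)
  then show "coset_len (x \<otimes> t) = coset_len x"
    using coset_len_mult[OF assms(3,1)] by simp
  then show "twisted_height x < twisted_height (x \<otimes> t) \<longleftrightarrow> len (x \<otimes> t) < len x"
    by (auto simp: twisted_height_def)
qed

text \<open>Strong exchange deletes a letter from a word of \<open>x t = a b\<close>. A letter of
  \<open>a\<close> would put \<open>x t inv x\<close> into \<open>P\<close>. So the letter comes
  from \<open>b\<close>, and \<open>x = a b'\<close> with \<open>b'\<close> shorter than
  \<open>b\<close>; splitting off the part of \<open>b'\<close> in \<open>P\<close> changes the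
  length of \<open>a\<close> by at most the length of that part.\<close>

lemma twisted_height_other_reflection:
  assumes x: "x \<in> carrier W" and t: "t \<in> reflections" "x \<otimes> t \<otimes> inv x \<notin> P" and less: "len x < len (x \<otimes> t)"
  shows "coset_len x < coset_len (x \<otimes> t)" and "twisted_height x < twisted_height (x \<otimes> t)"
proof -
  obtain a b where ab: "a \<in> P" "minimal b" "x \<otimes> t = a \<otimes> b"
    using minimal_decomposition x t by (metis m_closed reflection_closed)
  obtain u where u: "u \<in> lists J" "val u = a" "length u = len a"
    using P_reduced_word ab by blast
  obtain v where v: "v \<in> lists I" "val v = b" "length v = len b"
    using reduced_word_exists ab minimal_closed by blast
  have uv: "u @ v \<in> lists I" "val (u @ v) = x \<otimes> t"
    using u v ab J_lists by (auto simp: val_append)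
  then obtain p k q where pq: "u @ v = p @ k # q" "x = val (p @ q)"
    using strong_exchange_len[of "u @ v" t] x t less by auto
  from pq(1) consider q' where "u = p @ k # q'" "q = q' @ v" | p' where "p = u @ p'" "v = p' @ k # q"
    by (auto simp: append_eq_append_conv2 append_eq_Cons_conv Cons_eq_append_conv)
  then show "coset_len x < coset_len (x \<otimes> t)" "twisted_height x < twisted_height (x \<otimes> t)"
    unfolding atomize_conj
  proof cases
    case 1
    then have l: "p \<in> lists J" "q' \<in> lists J"
      using u by auto
    then have "val (p @ q') \<in> P"
      using P_word by simp
    have "x = val (p @ q') \<otimes> b"
      using pq(2) 1 l v ab(2) J_lists by (simp add: val_append m_assoc)
    then have "a \<otimes> b \<otimes> inv x = a \<otimes> inv (val (p @ q'))"
      using ab \<open>val (p @ q') \<in> P\<close> by (simp add: inv_mult_group m_assoc)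
    moreover have "a \<otimes> inv (val (p @ q')) \<in> P"
      using ab \<open>val (p @ q') \<in> P\<close> by simp
    ultimately show "coset_len x < coset_len (x \<otimes> t) \<and> twisted_height x < twisted_height (x \<otimes> t)"
      using t(2) ab(3) by simp
  next
    case 2
    then have l: "p' \<in> lists I" "q \<in> lists I"
      using v by auto
    define b' where "b' = val (p' @ q)"
    have b': "b' \<in> carrier W" "len b' < len b" "x = a \<otimes> b'"
      using l len_val_le[of "p' @ q"] v 2 pq(2) u J_lists
      by (simp_all add: b'_def val_append m_assoc)
    obtain c d where cd: "c \<in> P" "minimal d" "b' = c \<otimes> d"
      using minimal_decomposition b' by blast
    then have lenb': "len b' = len c + len d"
      using len_P_mult_minimal by simp
    have xd: "x = (a \<otimes> c) \<otimes> d"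
      using b' cd ab by (simp add: m_assoc)
    have "len a \<le> len (a \<otimes> c) + len c"
      using len_mult_le[of "a \<otimes> c" "inv c"] ab cd by (simp add: m_assoc)
    then have "twisted_height x < twisted_height (x \<otimes> t)"
      using twisted_height_decomposition[of "a \<otimes> c" d] twisted_height_decomposition[of a b]
        ab cd lenb' b'(2) xd by simp
    moreover have "coset_len x = len d" "coset_len (x \<otimes> t) = len b"
      using xd ab cd by (simp_all add: coset_len_mult coset_len_minimal)
    ultimately show "coset_len x < coset_len (x \<otimes> t) \<and> twisted_height x < twisted_height (x \<otimes> t)"
      using lenb' b'(2) by simp
  qed
qed

lemma conj_mult_reflection:
  "x \<in> carrier W \<Longrightarrow> t \<in> reflections \<Longrightarrow> (x \<otimes> t) \<otimes> t \<otimes> inv (x \<otimes> t) = x \<otimes> t \<otimes> inv x"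
  by (simp add: inv_mult_group m_assoc)

text \<open>The usual description of a twisted Bruhat order: an edge is reversed exactly when the
  left reflection \<open>x t inv x\<close> lies in \<open>P\<close>. This condition is unchanged
  when \<open>x\<close> and \<open>t\<close> become \<open>x s i\<close> and \<open>cj i t\<close>,
  so the second height axiom is inherited from the length.\<close>

lemma twisted_height_less_iff:
  assumes x: "x \<in> carrier W" and t: "t \<in> reflections"
  shows "twisted_height x < twisted_height (x \<otimes> t) \<longleftrightarrow>
    (if x \<otimes> t \<otimes> inv x \<in> P then len (x \<otimes> t) < len x else len x < len (x \<otimes> t))"
proof (cases "x \<otimes> t \<otimes> inv x \<in> P")
  case True
  then show ?thesis
    using twisted_height_parabolic_reflection[OF x t] by simp
next
  case False
  have "twisted_height (x \<otimes> t) < twisted_height x" if "len (x \<otimes> t) < len x"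
    using twisted_height_other_reflection(2)[of "x \<otimes> t" t] conj_mult_reflection[OF x t] False that x t by simp
  moreover have "len (x \<otimes> t) \<noteq> len x"
    using bruhat.height_reflection_neq[OF x t] by simp
  ultimately show ?thesis
    using twisted_height_other_reflection(2)[OF x t False] False by force
qed

sublocale twisted: coxeter_height W I m s twisted_height
proof
  show "twisted_height (x \<otimes> s i) = twisted_height x + 1 \<or> twisted_height (x \<otimes> s i) = twisted_height x - 1"
    if "x \<in> carrier W" "i \<in> I" for x i
    using twisted_height_simple[OF that] .
  show "twisted_height x < twisted_height (x \<otimes> t) \<longleftrightarrow> twisted_height (x \<otimes> s i) < twisted_height (x \<otimes> t \<otimes> s i)"
    if a: "x \<in> carrier W" "t \<in> reflections" "i \<in> I" "t \<noteq> s i" for x t i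
  proof -
    have eq: "x \<otimes> s i \<otimes> cj i t = x \<otimes> t \<otimes> s i" "x \<otimes> t \<otimes> s i \<otimes> inv (x \<otimes> s i) = x \<otimes> t \<otimes> inv x"
      using a by (simp_all add: mult_cj) (simp add: inv_mult_group m_assoc)
    have "len (x \<otimes> t \<otimes> s i) \<noteq> len (x \<otimes> s i)" "len (x \<otimes> t) \<noteq> len x"
      using bruhat.height_reflection_neq[of "x \<otimes> s i" "cj i t"] bruhat.height_reflection_neq[of x t] a eq by simp_all
    then show ?thesis
      using twisted_height_less_iff[of x t] twisted_height_less_iff[of "x \<otimes> s i" "cj i t"]
        len_height_cond[OF a] a by (auto simp: eq)
  qed
qed

lemma twisted_edge_coset_len:
  assumes "twisted.edge x y"
  shows "coset_len x \<le> coset_len y"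
proof -
  obtain t where t: "x \<in> carrier W" "t \<in> reflections" "y = x \<otimes> t" "twisted_height x < twisted_height (x \<otimes> t)"
    using assms by (auto simp: twisted.edge_def)
  show ?thesis
  proof (cases "x \<otimes> t \<otimes> inv x \<in> P")
    case False
    then have "len x < len (x \<otimes> t)"
      using twisted_height_less_iff[OF t(1,2)] t(4) by simp
    then show ?thesis
      using twisted_height_other_reflection(1)[OF t(1,2) False] t by simp
  qed (use twisted_height_parabolic_reflection[OF t(1,2)] t in simp)
qed

lemma twisted_le_coset_len: "twisted.le x y \<Longrightarrow> coset_len x \<le> coset_len y"
  by (induction rule: twisted.le_induct) (use twisted_edge_coset_len order_trans in blast)+

lemma coset_len_eq_0_iff:
  assumes "x \<in> carrier W"
  shows "coset_len x = 0 \<longleftrightarrow> x \<in> P"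
proof -
  obtain a b where ab: "a \<in> P" "minimal b" "x = a \<otimes> b" "coset_len x = len b"
    using minimal_decomposition assms by blast
  show ?thesis
  proof
    assume "coset_len x = 0"
    then have "b = \<one>"
      using ab len_eq_0_iff by simp
    then show "x \<in> P"
      using ab by simp
  next
    assume "x \<in> P"
    then have "b \<in> P"
      using ab P_mult_iff by simp
    then have "len b \<le> len (inv b \<otimes> b)"
      using ab(2) unfolding minimal_def by (metis P_inv)
    then show "coset_len x = 0"
      using ab by simp
  qed
qed

section \<open>The twisted order on the parabolic subgroup\<close>

lemma twisted_height_P: "x \<in> P \<Longrightarrow> twisted_height x = - int (len x)"
  using coset_len_eq_0_iff[of x] by (simp add: twisted_height_def)

lemma twisted_edge_P:
  assumes "twisted.edge x y" "y \<in> P"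
  shows "x \<in> P" "bruhat.edge y x"
proof -
  have c: "x \<in> carrier W" "y \<in> carrier W"
    using twisted.edge_closed assms by auto
  show x: "x \<in> P"
    using twisted_edge_coset_len[OF assms(1)] coset_len_eq_0_iff[OF c(1)] coset_len_eq_0_iff[OF c(2)] assms(2) by simp
  obtain t where "t \<in> reflections" "y = x \<otimes> t" "twisted_height x < twisted_height y"
    using assms by (auto simp: twisted.edge_def)
  then show "bruhat.edge y x"
    using x assms c unfolding bruhat.edge_def
    by (auto simp: twisted_height_P intro!: bexI[of _ t])
qed

lemma bruhat_edge_P:
  assumes "bruhat.edge x y" "y \<in> P"
  shows "x \<in> P" "twisted.edge y x"
proof -
  obtain t where t: "x \<in> carrier W" "t \<in> reflections" "y = x \<otimes> t" "len x < len y"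
    using assms by (auto simp: bruhat.edge_def)
  obtain u where u: "u \<in> lists J" "val u = y"
    using P_reduced_word assms by blast
  have "y \<otimes> t = x"
    using t by simp
  then obtain a k b where ab: "u = a @ k # b" "val u \<otimes> t = val (a @ b)"
    using strong_exchange_len[of u t] u t J_lists by auto
  then show x: "x \<in> P"
    using P_word[of "a @ b"] u \<open>y \<otimes> t = x\<close> by auto
  then show "twisted.edge y x"
    using assms t \<open>y \<otimes> t = x\<close> unfolding twisted.edge_def
    by (auto simp: twisted_height_P simp del: mult_reflection_reflection intro!: bexI[of _ t])
qed

text \<open>Going down never increases \<open>coset_len\<close>, so one cannot leave
  \<open>P\<close>, and inside \<open>P\<close> the twisted height is minus the length.\<close>

lemma twisted_le_P:
  assumes "twisted.le x y" "y \<in> P"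
  shows "x \<in> P \<and> bruhat.le y x"
proof -
  have "y \<in> P \<longrightarrow> x \<in> P \<and> bruhat.le y x"
    using assms(1)
  proof (induction rule: twisted.le_induct)
    case refl
    then show ?case
      by simp
  next
    case (step y z)
    then show ?case
      using twisted_edge_P[of y z] bruhat.edge_le bruhat.le_trans by blast
  qed
  then show ?thesis
    using assms(2) by simp
qed

lemma bruhat_le_P:
  assumes "bruhat.le x y" "y \<in> P"
  shows "x \<in> P \<and> twisted.le y x"
proof -
  have "y \<in> P \<longrightarrow> x \<in> P \<and> twisted.le y x"
    using assms(1)
  proof (induction rule: bruhat.le_induct)
    case refl
    then show ?case
      by simp
  next
    case (step y z)
    then show ?case
      using bruhat_edge_P[of y z] twisted.edge_le twisted.le_trans by blast
  qed
  then show ?thesis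
    using assms(2) by simp
qed

lemma twisted_paths_P:
  assumes "ts \<in> twisted.paths x y" "y \<in> P"
  shows "rev ts \<in> bruhat.paths y x"
proof -
  have "bruhat.path y (rev ts) \<and> bruhat.endpoint y (rev ts) = x" if "twisted.path x ts" "twisted.endpoint x ts = y"
    using that
  proof (induction ts arbitrary: x)
    case Nil
    then show ?case
      by simp
  next
    case (Cons t ts)
    then have t: "x \<in> carrier W" "t \<in> reflections" "twisted_height (x \<otimes> t) = twisted_height x + 1"
      and IH: "bruhat.path y (rev ts)" "bruhat.endpoint y (rev ts) = x \<otimes> t"
      by auto
    have "x \<in> P" "x \<otimes> t \<in> P"
      using twisted_le_P[OF _ assms(2)] twisted.path_le[of x "t # ts"] twisted.path_le[of "x \<otimes> t" ts] Cons.prems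
      by auto
    then have "len x = len (x \<otimes> t) + 1"
      using t(3) by (simp add: twisted_height_P)
    then show ?case
      using IH t by (simp add: bruhat.path_append)
  qed
  then show ?thesis
    using assms(1) by (simp add: twisted.paths_def bruhat.paths_def)
qed

lemma bruhat_paths_P:
  assumes "us \<in> bruhat.paths y x" "x \<in> P"
  shows "rev us \<in> twisted.paths x y"
proof -
  have "twisted.path x (rev us) \<and> twisted.endpoint x (rev us) = y" if "bruhat.path y us" "bruhat.endpoint y us = x"
    using that
  proof (induction us arbitrary: y)
    case Nil
    then show ?case
      by simp
  next
    case (Cons t us)
    then have t: "y \<in> carrier W" "t \<in> reflections" "len (y \<otimes> t) = len y + 1"
      and IH: "twisted.path x (rev us)" "twisted.endpoint x (rev us) = y \<otimes> t"
      by auto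
    have "y \<in> P" "y \<otimes> t \<in> P"
      using bruhat_le_P[OF _ assms(2)] bruhat.path_le[of y "t # us"] bruhat.path_le[of "y \<otimes> t" us] Cons.prems
      by auto
    then have "twisted_height y = twisted_height (y \<otimes> t) + 1"
      using t(3) by (simp add: twisted_height_P)
    then show ?case
      using IH t by (simp add: twisted.path_append)
  qed
  then show ?thesis
    using assms(1) by (simp add: twisted.paths_def bruhat.paths_def)
qed

lemma twisted_increasing_paths_P:
  assumes "x \<in> P" "y \<in> P"
  shows "ts \<in> twisted.increasing_paths lt x y \<longleftrightarrow> rev ts \<in> bruhat.increasing_paths (\<lambda>a b. lt b a) y x"
  using twisted_paths_P[of ts x y] bruhat_paths_P[of "rev ts" y x] assms
  by (auto simp: twisted.increasing_paths_def bruhat.increasing_paths_def sorted_wrt_rev)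

text \<open>A right descent of the minimal factor lowers both rank and height. At rank zero the
  interval lies in \<open>P\<close>, and the required facts are those of the Bruhat order with paths
  reversed and the reflection order replaced by its converse.\<close>

sublocale twisted: coxeter_height_descent W I m s twisted_height coset_len
proof
  show "coset_len x \<le> coset_len y" if "twisted.edge x y" for x y
    using twisted_edge_coset_len[OF that] .
  show "\<exists>i\<in>I. twisted_height (y \<otimes> s i) < twisted_height y \<and> coset_len (y \<otimes> s i) < coset_len y"
    if y: "y \<in> carrier W" "0 < coset_len y" for y
  proof -
    obtain a b where ab: "a \<in> P" "minimal b" "y = a \<otimes> b" "coset_len y = len b"
      using minimal_decomposition y by blast
    then have "b \<noteq> \<one>"
      using y by auto
    then obtain i where i: "i \<in> I" "len b = len (b \<otimes> s i) + 1"
      using right_descent_exists ab minimal_closed by blast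
    have "minimal (b \<otimes> s i)"
      using minimal_descent[OF ab(2) i(1)] i(2) by simp
    moreover have "y \<otimes> s i = a \<otimes> (b \<otimes> s i)"
      using ab i by (simp add: m_assoc)
    ultimately show ?thesis
      using i ab by (intro bexI[of _ i]) (simp_all add: twisted_height_decomposition coset_len_mult coset_len_minimal)
  qed
  have base: "x \<in> P" "y \<in> P" "bruhat.le y x" if "coset_len y = 0" "twisted.le x y" for x y
    using twisted_le_P[OF that(2)] that coset_len_eq_0_iff twisted.le_closed by auto
  show "finite {z. twisted.le x z \<and> twisted.le z y}" if "coset_len y = 0" "twisted.le x y" for x y
  proof -
    have "{z. twisted.le x z \<and> twisted.le z y} \<subseteq> {z. bruhat.le y z \<and> bruhat.le z x}"
      using base[OF that] twisted_le_P by blast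
    then show ?thesis
      using bruhat.finite_interval[OF base(3)[OF that]] finite_subset by blast
  qed
  show "\<exists>!ts. ts \<in> twisted.increasing_paths lt x y"
    if "coset_len y = 0" "twisted.le x y" "reflection_order lt" for x y lt
  proof -
    have "\<exists>!us. us \<in> bruhat.increasing_paths (\<lambda>a b. lt b a) y x"
      using bruhat.unique_increasing_path[OF base(3)[OF that(1,2)] reflection_order_converse[OF that(3)]] .
    then show ?thesis
      unfolding twisted_increasing_paths_P[OF base(1,2)[OF that(1,2)]]
      by (metis rev_rev_ident)
  qed
  show "dihedral_exchange a b a' b'"
    if y: "coset_len y = 0" and P: "[a, b] \<in> twisted.paths x y" "[a', b'] \<in> twisted.paths x y" and "a \<noteq> a'"
    for x y a b a' b'
  proof -
    have "twisted.le x y"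
      using twisted.path_le[of x "[a, b]"] P(1) by (simp only: twisted.paths_def mem_Collect_eq)
    then have "y \<in> P"
      using base y by blast
    then have "[b, a] \<in> bruhat.paths y x" "[b', a'] \<in> bruhat.paths y x"
      using twisted_paths_P[OF P(1)] twisted_paths_P[OF P(2)] by simp_all
    moreover have refl: "a \<in> reflections" "b \<in> reflections" "a' \<in> reflections" "b' \<in> reflections"
      and eq: "x \<in> carrier W" "x \<otimes> a \<otimes> b = x \<otimes> a' \<otimes> b'"
      using P by (auto simp: twisted.paths_two_iff)
    have "b \<noteq> b'"
    proof
      assume "b = b'"
      then have "x \<otimes> a = x \<otimes> a'"
        using eq refl by simp
      then show False
        using eq refl \<open>a \<noteq> a'\<close> by simp
    qed
    ultimately have "dihedral_exchange b a b' a'"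
      using bruhat.path_two_exchange by blast
    then show ?thesis
      using dihedral_exchange_flip refl by blast
  qed
qed

end

context coxeter_height
begin

lemma le_mult_simple:
  assumes "le x y" "i \<in> I" "h y < h (y \<otimes> s i)"
  shows "le (x \<otimes> s i) (y \<otimes> s i)"
proof -
  have c: "x \<in> carrier W" "y \<in> carrier W"
    using le_closed assms(1) by auto
  have "upper i y = y \<otimes> s i"
    using assms(3) by (simp add: upper_def)
  then have "le (upper i x) (y \<otimes> s i)"
    using upper_mono[OF assms(1,2)] by simp
  moreover have "le (x \<otimes> s i) (upper i x)"
    using simple_edge(1)[OF c(1) assms(2)] edge_le c assms(2) by (simp add: upper_def)
  ultimately show ?thesis
    using le_trans by blast
qed

end

context coxeter_system
begin

lemma simple_inj: "i \<in> I \<Longrightarrow> j \<in> I \<Longrightarrow> s i = s j \<Longrightarrow> i = j"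
proof -
  assume ij: "i \<in> I" "j \<in> I" "s i = s j"
  have "(\<lambda>f :: 'i \<Rightarrow> real. f i) = (\<lambda>f. f j)"
    using rt_simple[OF ij(1)] rt_simple[OF ij(2)] ij(3) by simp
  from fun_cong[OF this, of "unit_vector i"] show ?thesis
    by (simp split: if_splits)
qed

lemma bruhat_le_inv:
  assumes "bruhat.le x y"
  shows "bruhat.le (inv x) (inv y)"
  using assms
proof (induction rule: bruhat.le_induct)
  case refl
  then show ?case
    using bruhat.le_closed[OF assms] by simp
next
  case (step y z)
  obtain t where t: "y \<in> carrier W" "t \<in> reflections" "z = y \<otimes> t" "len y < len z"
    using step(2) by (auto simp: bruhat.edge_def)
  have "inv z = inv y \<otimes> (y \<otimes> t \<otimes> inv y)"
    using t by (simp add: inv_mult_group m_assoc)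
  moreover have "len (inv y) < len (inv z)"
    using t by simp
  ultimately have "bruhat.edge (inv y) (inv z)"
    unfolding bruhat.edge_def using t(1) conj_reflection[OF t(1,2)]
    by (intro conjI bexI[of _ "y \<otimes> t \<otimes> inv y"]) simp_all
  then show ?case
    using step.IH bruhat.edge_le bruhat.le_trans by blast
qed

end

context coxeter_parabolic
begin

lemma minimal_one [simp]: "minimal \<one>"
  by (simp add: minimal_def)

lemma minimal_decomposition_unique:
  assumes "a \<in> P" "a' \<in> P" "minimal b" "minimal b'" "a \<otimes> b = a' \<otimes> b'"
  shows "a = a'" "b = b'"
proof -
  have c: "a \<in> carrier W" "a' \<in> carrier W" "b \<in> carrier W" "b' \<in> carrier W"
    using assms by simp_all
  have "inv a' \<otimes> (a \<otimes> b) = b'"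
    using assms(5) c by simp
  then have b': "b' = (inv a' \<otimes> a) \<otimes> b"
    using c by (simp add: m_assoc)
  have "len b = len b'"
    using coset_len_mult[of a b] coset_len_mult[of a' b'] coset_len_minimal assms c by simp
  moreover have "len b' = len (inv a' \<otimes> a) + len b"
    unfolding b' using len_P_mult_minimal assms by simp
  ultimately have "inv a' \<otimes> a = \<one>"
    using len_eq_0_iff c by simp
  then show "b = b'"
    using b' c by simp
  then show "a = a'"
    using assms(5) c by simp
qed

lemma min_reps_iff: "w \<in> min_reps J \<longleftrightarrow> w \<in> carrier W \<and> minimal (inv w)"
proof -
  have "(\<forall>x \<in> w <# P. len w \<le> len x) \<longleftrightarrow> (\<forall>a\<in>P. len (inv w) \<le> len (a \<otimes> inv w))" if w: "w \<in> carrier W"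
  proof -
    have eq: "len (a \<otimes> inv w) = len (w \<otimes> inv a)" if "a \<in> P" for a
      using len_inv[of "a \<otimes> inv w"] that w by (simp add: inv_mult_group)
    have "(\<forall>a\<in>P. len w \<le> len (w \<otimes> a)) \<longleftrightarrow> (\<forall>a\<in>P. len w \<le> len (w \<otimes> inv a))"
      by (metis P_closed P_inv inv_inv)
    then show ?thesis
      using w eq by (simp add: l_coset_def)
  qed
  then show ?thesis
    by (auto simp: min_reps_def minimal_def)
qed

text \<open>Strong exchange for a reduced word of \<open>t\<close> and the reflection
  \<open>t\<close> itself: deleting one letter leaves the identity, so the parts before and after
  that letter are mutually inverse.\<close>

lemma parabolic_reflection:
  assumes "t \<in> reflections" "t \<in> P"
  obtains p j where "p \<in> P" "j \<in> J" "t = p \<otimes> s j \<otimes> inv p"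
proof -
  obtain u where u: "u \<in> lists J" "val u = t"
    using P_reduced_word assms(2) by blast
  have "t \<noteq> \<one>"
    using assms(1) one_not_reflection by blast
  then have "len (val u \<otimes> t) < len (val u)"
    using u assms(1) len_eq_0_iff[of t] by simp
  then obtain a k b where ab: "u = a @ k # b" "val u \<otimes> t = val (a @ b)"
    using strong_exchange_len[of u t] u assms J_lists by blast
  then have l: "a \<in> lists J" "k \<in> J" "b \<in> lists J"
    using u(1) by auto
  have c: "val a \<in> carrier W" "val b \<in> carrier W" "s k \<in> carrier W"
    using l by simp_all
  have "val a \<otimes> val b = \<one>"
    using ab(2) u assms(1) l J_lists by (simp add: val_append)
  then have "val b = inv (val a)"
    using c by (metis inv_equality inv_inv inv_closed)
  moreover have "t = val a \<otimes> s k \<otimes> val b"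
    using u(2) ab(1) l J_lists c by (simp add: val_append m_assoc)
  ultimately show ?thesis
    using that[of "val a" k] P_word l by simp
qed

text \<open>Lengths add in \<open>w u\<close>, so each letter of a reduced word of \<open>u\<close> moves up the larger element.\<close>

lemma bruhat_le_mult_P:
  assumes "bruhat.le v w" "minimal (inv w)" "u \<in> P"
  shows "bruhat.le (v \<otimes> u) (w \<otimes> u)"
  using assms(3)
proof (induction "len u" arbitrary: u rule: less_induct)
  case less
  have c: "v \<in> carrier W" "w \<in> carrier W" "u \<in> carrier W"
    using bruhat.le_closed assms(1) less.prems by auto
  have add: "len (w \<otimes> a) = len w + len a" if "a \<in> P" for a
    using len_P_mult_minimal[OF P_inv[OF that] assms(2)] len_inv[of "w \<otimes> a"] that c
    by (simp add: inv_mult_group)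
  show ?case
  proof (cases "u = \<one>")
    case True
    then show ?thesis
      using assms(1) c by simp
  next
    case False
    then have "inv u \<noteq> \<one>"
      using c inv_eq_1_iff by blast
    then obtain j a where j: "j \<in> J" "a \<in> P" "inv u = s j \<otimes> a" "len (inv u) = len a + 1"
      using left_descent_exists[of "inv u"] less.prems by auto
    have ca: "a \<in> carrier W" "s j \<in> carrier W"
      using j by simp_all
    have u: "u = inv a \<otimes> s j"
      using arg_cong[OF j(3), of "\<lambda>x. inv x"] c ca j(1) by (simp add: inv_mult_group)
    have lenu: "len u = len (inv a) + 1"
      using j(4) c ca by simp
    then have "bruhat.le (v \<otimes> inv a) (w \<otimes> inv a)"
      using less.hyps[of "inv a"] j by simp
    moreover have "w \<otimes> inv a \<otimes> s j = w \<otimes> u" "v \<otimes> inv a \<otimes> s j = v \<otimes> u"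
      using u c ca by (simp_all add: m_assoc)
    ultimately show ?thesis
      using bruhat.le_mult_simple[of "v \<otimes> inv a" "w \<otimes> inv a" j] add[of "inv a"] add[of u] lenu j(1,2) less.prems
      by simp
  qed
qed

end

section \<open>Homomorphisms between Coxeter groups and existence of the group of a Coxeter
  matrix\<close>

lemma coxeter_hom_exists:
  assumes "coxeter_system W I m s" "coxeter_system V I' m' s'"
    and g: "\<And>i. i \<in> I \<Longrightarrow> g i \<in> I'"
    and m: "\<And>i j n. i \<in> I \<Longrightarrow> j \<in> I \<Longrightarrow> m i j = enat n \<Longrightarrow> m' (g i) (g j) = enat n"
  shows "\<exists>f. f \<in> hom W V \<and> (\<forall>u\<in>lists I. f (word_value W s u) = word_value V s' (map g u))"
proof -
  interpret W: coxeter_system W I m s by fact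
  interpret V: coxeter_system V I' m' s' by fact
  have lists: "map g u \<in> lists I'" if "u \<in> lists I" for u
    using that g by auto
  define f where "f w = V.val (map g (SOME u. u \<in> lists I \<and> W.val u = w))" for w
  \<comment> \<open>Only finite entries of \<open>m\<close> give relations to be checked, so
    \<open>g\<close> may identify letters joined by an infinite entry, as the folding of the doubled
    graph does.\<close>
  have step: "V.val (map g u) = V.val (map g v)" if st: "word_step I m u v" for u v
  proof (rule V.val_word_step)
    obtain a b i j n where "a \<in> lists I" "b \<in> lists I" "i \<in> I" "j \<in> I" "m i j = enat n"
      "u = a @ concat (replicate n [i, j]) @ b" "v = a @ b"
      using st unfolding word_step_def by blast
    then show "word_step I' m' (map g u) (map g v)"
      unfolding word_step_def using g m lists
      by (intro bexI[of _ "map g a"] bexI[of _ "map g b"] bexI[of _ "g i"] bexI[of _ "g j"] exI[of _ n])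
        (simp_all add: map_concat)
  qed
  have f: "f (W.val u) = V.val (map g u)" if u: "u \<in> lists I" for u
  proof -
    have "(SOME v. v \<in> lists I \<and> W.val v = W.val u) \<in> lists I \<and> W.val (SOME v. v \<in> lists I \<and> W.val v = W.val u) = W.val u"
      by (rule someI[of _ u]) (use u in auto)
    then show ?thesis
      unfolding f_def using u by (intro W.word_invariant[of "\<lambda>u. V.val (map g u)", OF step]) auto
  qed
  have "f \<in> hom W V"
  proof (rule homI)
    fix x assume "x \<in> carrier W"
    then obtain u where "u \<in> lists I" "W.val u = x"
      using W.word_exists by blast
    then show "f x \<in> carrier V"
      using f lists V.val_closed by metis
  next
    fix x y assume "x \<in> carrier W" "y \<in> carrier W"
    then obtain u v where uv: "u \<in> lists I" "W.val u = x" "v \<in> lists I" "W.val v = y"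
      using W.word_exists by metis
    have "f (W.val (u @ v)) = f (W.val u) \<otimes>\<^bsub>V\<^esub> f (W.val v)"
      using uv(1,3) lists by (simp add: f V.val_append del: in_lists_conv_set)
    then show "f (x \<otimes>\<^bsub>W\<^esub> y) = f x \<otimes>\<^bsub>V\<^esub> f y"
      using uv by (simp add: W.val_append)
  qed
  then show ?thesis
    using f by blast
qed

text \<open>The group consists of classes of words under concatenation. Reversal provides inverses,
  since the squares of letters are among the relators. This supplies the group of the glued
  graph.\<close>

theorem coxeter_system_exists:
  fixes I :: "'i set"
  assumes "coxeter_matrix I m"
  shows "\<exists>(W :: 'i list set monoid) s. coxeter_system W I m s"
proof -
  define R where "R = equivclp (word_step I m)"
  define cls where "cls u = {v. R u v}" for u
  have R: "R u u" "R u v \<Longrightarrow> R v u" "R u v \<Longrightarrow> R v w \<Longrightarrow> R u w" for u v w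
    unfolding R_def by (simp, erule equivclp_sym, erule equivclp_trans)
  have step_lists: "u \<in> lists I \<and> v \<in> lists I" if "word_step I m u v" for u v
    using that unfolding word_step_def by (auto split: if_splits)
  have R_lists: "v \<in> lists I" if "R u v" "u \<in> lists I" for u v
    using that unfolding R_def by (induction rule: equivclp_induct) (use step_lists in blast)+
  have cls_eq: "cls u = cls v \<longleftrightarrow> R u v" for u v
    unfolding cls_def using R by blast
  have R_context: "R (a @ u @ b) (a @ v @ b)" if "R u v" "a \<in> lists I" "b \<in> lists I" for a b u v
  proof -
    have step: "word_step I m (a @ u @ b) (a @ v @ b)" if uv: "word_step I m u v" for u v
    proof -
      obtain c d i j n where "c \<in> lists I" "d \<in> lists I" "i \<in> I" "j \<in> I" "m i j = enat n"
        "u = c @ concat (replicate n [i, j]) @ d" "v = c @ d"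
        using uv unfolding word_step_def by blast
      then show ?thesis
        unfolding word_step_def using \<open>a \<in> lists I\<close> \<open>b \<in> lists I\<close>
        by (intro bexI[of _ "a @ c"] bexI[of _ "d @ b"] bexI[of _ i] bexI[of _ j] exI[of _ n]) auto
    qed
    show ?thesis
      using that(1) unfolding R_def
    proof (induction rule: equivclp_induct)
      case (step y z)
      then have "equivclp (word_step I m) (a @ y @ b) (a @ z @ b)"
        using \<open>\<And>v u. word_step I m u v \<Longrightarrow> word_step I m (a @ u @ b) (a @ v @ b)\<close>
        by (metis r_into_equivclp equivclp_sym)
      then show ?case
        using step.IH equivclp_trans by metis
    qed simp
  qed
  have R_append: "R (u @ v) (u' @ v')" if "R u u'" "R v v'" "u \<in> lists I" "v \<in> lists I" for u u' v v'
    using R_context[OF that(1), of "[]" v] R_context[OF that(2), of u' "[]"] R_lists[OF that(1,3)] that(4) R(3) by auto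
  define W :: "'i list set monoid" where
    "W = \<lparr>carrier = cls ` lists I, monoid.mult = (\<lambda>x y. cls ((SOME u. u \<in> x) @ (SOME v. v \<in> y))), one = cls []\<rparr>"
  define s where "s i = cls [i]" for i
  have some: "R u (SOME v. v \<in> cls u)" for u
    using someI[of "\<lambda>v. v \<in> cls u" u] R(1) by (simp add: cls_def)
  have mult: "cls u \<otimes>\<^bsub>W\<^esub> cls v = cls (u @ v)" if "u \<in> lists I" "v \<in> lists I" for u v
    using R_append[OF some[of u] some[of v] that] R(2) by (simp add: W_def cls_eq)
  have one: "\<one>\<^bsub>W\<^esub> = cls []"
    by (simp add: W_def)
  have carrier: "carrier W = cls ` lists I"
    by (simp add: W_def)
  have R_square: "R (a @ [i, i] @ b) (a @ b)" if "i \<in> I" "a \<in> lists I" "b \<in> lists I" for a b i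
  proof -
    have "m i i = enat 1"
      using assms that by (auto simp: coxeter_matrix_def one_enat_def)
    then have "word_step I m (a @ [i, i] @ b) (a @ b)"
      unfolding word_step_def using that
      by (intro bexI[of _ a] bexI[of _ b] bexI[of _ i] exI[of _ 1]) auto
    then show ?thesis
      unfolding R_def by blast
  qed
  have R_rev: "R (rev u @ u) []" if "u \<in> lists I" for u
    using that
  proof (induction u)
    case (Cons i u)
    then have "i \<in> I" "u \<in> lists I" "rev u \<in> lists I"
      by auto
    then show ?case
      using R_square[of i "rev u" u] Cons R(3) by auto
  qed (simp add: R(1))
  have group: "group W"
  proof (rule groupI)
    show "x \<otimes>\<^bsub>W\<^esub> y \<in> carrier W" if xy: "x \<in> carrier W" "y \<in> carrier W" for x y
    proof -
      obtain u v where "u \<in> lists I" "v \<in> lists I" "x = cls u" "y = cls v"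
        using xy unfolding carrier by blast
      then show ?thesis
        unfolding carrier by (intro image_eqI[of _ _ "u @ v"]) (simp_all add: mult)
    qed
    show "\<one>\<^bsub>W\<^esub> \<in> carrier W"
      unfolding one carrier by auto
    show "(x \<otimes>\<^bsub>W\<^esub> y) \<otimes>\<^bsub>W\<^esub> z = x \<otimes>\<^bsub>W\<^esub> (y \<otimes>\<^bsub>W\<^esub> z)" if xyz: "x \<in> carrier W" "y \<in> carrier W" "z \<in> carrier W" for x y z
    proof -
      obtain u v w where "u \<in> lists I" "v \<in> lists I" "w \<in> lists I" "x = cls u" "y = cls v" "z = cls w"
        using xyz unfolding carrier by blast
      then show ?thesis
        using mult[of u v] mult[of "u @ v" w] mult[of v w] mult[of u "v @ w"] by (simp del: in_lists_conv_set)
    qed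
    show "\<one>\<^bsub>W\<^esub> \<otimes>\<^bsub>W\<^esub> x = x" if "x \<in> carrier W" for x
      using that mult[of "[]"] unfolding carrier one by auto
    show "\<exists>y\<in>carrier W. y \<otimes>\<^bsub>W\<^esub> x = \<one>\<^bsub>W\<^esub>" if x: "x \<in> carrier W" for x
    proof -
      obtain u where u: "u \<in> lists I" "x = cls u"
        using x unfolding carrier by blast
      moreover have "rev u \<in> lists I"
        using u by auto
      ultimately show ?thesis
        using mult[of "rev u" u] R_rev[OF u(1)] unfolding carrier one
        by (intro bexI[of _ "cls (rev u)"]) (auto simp: cls_eq)
    qed
  qed
  have word: "word_value W s u = cls u" if "u \<in> lists I" for u
    using that
  proof (induction u)
    case (Cons i u)
    then show ?case
      using mult[of "[i]" u] by (simp add: word_value_def s_def)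
  qed (simp add: word_value_def one)
  have "coxeter_system W I m s"
    unfolding coxeter_system_def coxeter_system_axioms_def
  proof (intro conjI allI impI)
    show "s ` I \<subseteq> carrier W"
      unfolding carrier s_def by auto
    show "word_value W s ` lists I = carrier W"
      unfolding carrier using word by (rule image_cong[OF HOL.refl])
    show "(word_value W s u = word_value W s v) = equivclp (word_step I m) u v"
      if "u \<in> lists I" "v \<in> lists I" for u v
      using word that cls_eq unfolding R_def by simp
  qed (use group assms in auto)
  then show ?thesis
    by blast
qed

section \<open>Gluing two copies along \<open>K\<close>\<close>

text \<open>
  Two copies of the Coxeter graph of \<open>W\<close> glued along \<open>K\<close>: the letters are \<open>Inl i\<close> for \<open>i \<in> I\<close> and
  \<open>Inr i\<close> for \<open>i \<in> I - K\<close>, and letters outside \<open>K\<close> from different copies satisfy no relation.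
\<close>

fun double_matrix :: "'i set \<Rightarrow> ('i \<Rightarrow> 'i \<Rightarrow> enat) \<Rightarrow> 'i + 'i \<Rightarrow> 'i + 'i \<Rightarrow> enat" where
  "double_matrix K m (Inl i) (Inl j) = m i j"
| "double_matrix K m (Inr i) (Inr j) = m i j"
| "double_matrix K m (Inl i) (Inr j) = (if i \<in> K then m i j else \<infinity>)"
| "double_matrix K m (Inr i) (Inl j) = (if j \<in> K then m i j else \<infinity>)"

lemma coxeter_matrix_double:
  assumes "coxeter_matrix I m" "K \<subseteq> I"
  shows "coxeter_matrix (Inl ` I \<union> Inr ` (I - K)) (double_matrix K m)"
proof -
  have m: "m i j = m j i \<and> m i j \<ge> 1 \<and> (m i j = 1 \<longleftrightarrow> i = j)" if "i \<in> I" "j \<in> I" for i j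
    using assms(1) that unfolding coxeter_matrix_def by blast
  show ?thesis
    unfolding coxeter_matrix_def
  proof (intro ballI)
    fix x y assume xy: "x \<in> Inl ` I \<union> Inr ` (I - K)" "y \<in> Inl ` I \<union> Inr ` (I - K)"
    obtain i where i: "i \<in> I" "x = Inl i \<or> x = Inr i \<and> i \<notin> K"
      using xy(1) by blast
    obtain j where j: "j \<in> I" "y = Inl j \<or> y = Inr j \<and> j \<notin> K"
      using xy(2) by blast
    show "double_matrix K m x y = double_matrix K m y x \<and> 1 \<le> double_matrix K m x y \<and>
      (double_matrix K m x y = 1 \<longleftrightarrow> x = y)"
      using i(2) j(2) m[OF i(1) j(1)] by (elim disjE conjE) (auto simp: one_enat_def)
  qed
qed

locale coxeter_double =
  W: coxeter_parabolic W I m s K +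
  V: coxeter_parabolic V "Inl ` I \<union> Inr ` (I - K)" "double_matrix K m" S "Inl ` I"
  for W :: "('w, 'b) monoid_scheme" and I :: "'i set" and m s K
    and V :: "('v, 'c) monoid_scheme" and S
begin

text \<open>The inclusion of the second copy of the graph, which shares the letters of
  \<open>K\<close> with the first copy \<open>Inl\<close>.\<close>

definition letter :: "'i \<Rightarrow> 'i + 'i" where
  "letter i = (if i \<in> K then Inl i else Inr i)"

definition alpha :: "'w \<Rightarrow> 'v" where
  "alpha = (SOME f. f \<in> hom W V \<and> (\<forall>u\<in>lists I. f (W.val u) = V.val (map Inl u)))"

definition beta :: "'w \<Rightarrow> 'v" where
  "beta = (SOME f. f \<in> hom W V \<and> (\<forall>u\<in>lists I. f (W.val u) = V.val (map letter u)))"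

definition retract :: "'v \<Rightarrow> 'w" where
  "retract = (SOME f. f \<in> hom V W \<and>
     (\<forall>u\<in>lists (Inl ` I \<union> Inr ` (I - K)). f (V.val u) = W.val (map (case_sum id id) u)))"

lemma alpha: "alpha \<in> hom W V" "u \<in> lists I \<Longrightarrow> alpha (W.val u) = V.val (map Inl u)"
proof -
  have "\<exists>f. f \<in> hom W V \<and> (\<forall>u\<in>lists I. f (W.val u) = V.val (map Inl u))"
    by (rule coxeter_hom_exists[OF W.coxeter_system_axioms V.coxeter_system_axioms]) auto
  from someI_ex[OF this] show "alpha \<in> hom W V" "u \<in> lists I \<Longrightarrow> alpha (W.val u) = V.val (map Inl u)"
    unfolding alpha_def by blast+
qed

lemma letter_in: "i \<in> I \<Longrightarrow> letter i \<in> Inl ` I \<union> Inr ` (I - K)"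
  by (auto simp: letter_def)

lemma beta: "beta \<in> hom W V" "u \<in> lists I \<Longrightarrow> beta (W.val u) = V.val (map letter u)"
proof -
  have "\<exists>f. f \<in> hom W V \<and> (\<forall>u\<in>lists I. f (W.val u) = V.val (map letter u))"
    by (rule coxeter_hom_exists[OF W.coxeter_system_axioms V.coxeter_system_axioms letter_in])
      (auto simp: letter_def)
  from someI_ex[OF this] show "beta \<in> hom W V" "u \<in> lists I \<Longrightarrow> beta (W.val u) = V.val (map letter u)"
    unfolding beta_def by blast+
qed

lemma retract: "retract \<in> hom V W"
  "u \<in> lists (Inl ` I \<union> Inr ` (I - K)) \<Longrightarrow> retract (V.val u) = W.val (map (case_sum id id) u)"
proof -
  have "\<exists>f. f \<in> hom V W \<and> (\<forall>u\<in>lists (Inl ` I \<union> Inr ` (I - K)). f (V.val u) = W.val (map (case_sum id id) u))"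
    by (rule coxeter_hom_exists[OF V.coxeter_system_axioms W.coxeter_system_axioms])
      (auto split: if_splits)
  from someI_ex[OF this] show "retract \<in> hom V W"
    "u \<in> lists (Inl ` I \<union> Inr ` (I - K)) \<Longrightarrow> retract (V.val u) = W.val (map (case_sum id id) u)"
    unfolding retract_def by blast+
qed

lemma lists_Inl: "u \<in> lists I \<Longrightarrow> map Inl u \<in> lists (Inl ` I \<union> Inr ` (I - K))"
  by auto

lemma lists_letter: "u \<in> lists I \<Longrightarrow> map letter u \<in> lists (Inl ` I \<union> Inr ` (I - K))"
  unfolding in_lists_conv_set set_map using letter_in by blast

lemma alpha_closed [simp]: "x \<in> carrier W \<Longrightarrow> alpha x \<in> carrier V"
  using alpha(1) by (rule hom_in_carrier)

lemma beta_closed [simp]: "x \<in> carrier W \<Longrightarrow> beta x \<in> carrier V"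
  using beta(1) by (rule hom_in_carrier)

lemma alpha_mult [simp]: "x \<in> carrier W \<Longrightarrow> y \<in> carrier W \<Longrightarrow> alpha (x \<otimes>\<^bsub>W\<^esub> y) = alpha x \<otimes>\<^bsub>V\<^esub> alpha y"
  using hom_mult[OF alpha(1)] .

lemma beta_mult [simp]: "x \<in> carrier W \<Longrightarrow> y \<in> carrier W \<Longrightarrow> beta (x \<otimes>\<^bsub>W\<^esub> y) = beta x \<otimes>\<^bsub>V\<^esub> beta y"
  using hom_mult[OF beta(1)] .

lemma alpha_one [simp]: "alpha \<one>\<^bsub>W\<^esub> = \<one>\<^bsub>V\<^esub>"
  using alpha(2)[of "[]"] by simp

lemma beta_one [simp]: "beta \<one>\<^bsub>W\<^esub> = \<one>\<^bsub>V\<^esub>"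
  using beta(2)[of "[]"] by simp

lemma alpha_inv [simp]: "x \<in> carrier W \<Longrightarrow> alpha (inv\<^bsub>W\<^esub> x) = inv\<^bsub>V\<^esub> (alpha x)"
  by (rule V.inv_equality[symmetric]) (simp_all flip: alpha_mult)

lemma beta_inv [simp]: "x \<in> carrier W \<Longrightarrow> beta (inv\<^bsub>W\<^esub> x) = inv\<^bsub>V\<^esub> (beta x)"
  by (rule V.inv_equality[symmetric]) (simp_all flip: beta_mult)

lemma alpha_simple [simp]: "i \<in> I \<Longrightarrow> alpha (s i) = S (Inl i)"
  using alpha(2)[of "[i]"] by simp

lemma beta_simple [simp]: "i \<in> I \<Longrightarrow> beta (s i) = S (letter i)"
  using beta(2)[of "[i]"] letter_in by simp

lemma retract_alpha [simp]: "x \<in> carrier W \<Longrightarrow> retract (alpha x) = x"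
proof -
  assume "x \<in> carrier W"
  then obtain u where "u \<in> lists I" "W.val u = x"
    using W.word_exists by blast
  moreover have "map (case_sum id id) (map Inl u) = u"
    by (simp add: comp_def)
  ultimately show ?thesis
    using alpha(2)[of u] retract(2)[OF lists_Inl[of u]] by metis
qed

lemma retract_beta [simp]: "x \<in> carrier W \<Longrightarrow> retract (beta x) = x"
proof -
  assume "x \<in> carrier W"
  then obtain u where "u \<in> lists I" "W.val u = x"
    using W.word_exists by blast
  moreover have "map (case_sum id id) (map letter u) = u"
    by (rule nth_equalityI) (auto simp: letter_def)
  ultimately show ?thesis
    using beta(2)[of u] retract(2)[OF lists_letter[of u]] by metis
qed

text \<open>Folding the two copies onto each other keeps the number of letters. As
  \<open>retract\<close> is a left inverse of \<open>alpha\<close> and \<open>beta\<close>, which do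
  not lengthen either, both preserve lengths.\<close>

lemma len_retract_le:
  assumes "y \<in> carrier V"
  shows "W.len (retract y) \<le> V.len y"
proof -
  obtain u where u: "u \<in> lists (Inl ` I \<union> Inr ` (I - K))" "V.val u = y" "length u = V.len y"
    using V.reduced_word_exists assms by blast
  have "case_sum id id x \<in> I" if "x \<in> Inl ` I \<union> Inr ` (I - K)" for x
    using that by auto
  then have "map (case_sum id id) u \<in> lists I"
    using u(1) unfolding in_lists_conv_set set_map by blast
  then show ?thesis
    using W.len_val_le[of "map (case_sum id id) u"] retract(2)[OF u(1)] u by simp
qed

lemma len_alpha [simp]:
  assumes "x \<in> carrier W"
  shows "V.len (alpha x) = W.len x"
proof -
  obtain u where u: "u \<in> lists I" "W.val u = x" "length u = W.len x"
    using W.reduced_word_exists assms by blast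
  have "V.len (alpha x) \<le> W.len x"
    using V.len_val_le[OF lists_Inl[OF u(1)]] alpha(2)[OF u(1)] u by simp
  then show ?thesis
    using len_retract_le[of "alpha x"] assms by simp
qed

lemma len_beta [simp]:
  assumes "x \<in> carrier W"
  shows "V.len (beta x) = W.len x"
proof -
  obtain u where u: "u \<in> lists I" "W.val u = x" "length u = W.len x"
    using W.reduced_word_exists assms by blast
  have "V.len (beta x) \<le> W.len x"
    using V.len_val_le[OF lists_letter[OF u(1)]] beta(2)[OF u(1)] u by simp
  then show ?thesis
    using len_retract_le[of "beta x"] assms by simp
qed

lemma alpha_inj:
  assumes "x \<in> carrier W" "y \<in> carrier W" "alpha x = alpha y"
  shows "x = y"
  using arg_cong[OF assms(3), of retract] unfolding retract_alpha[OF assms(1)] retract_alpha[OF assms(2)] .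

lemma beta_inj:
  assumes "x \<in> carrier W" "y \<in> carrier W" "beta x = beta y"
  shows "x = y"
  using arg_cong[OF assms(3), of retract] unfolding retract_beta[OF assms(1)] retract_beta[OF assms(2)] .

lemma alpha_range: "V.P = alpha ` carrier W"
proof -
  have "V.P = V.val ` lists (Inl ` I)"
    by (rule V.parabolic_eq_words[OF V.J_subset])
  also have "lists (Inl ` I) = map Inl ` lists I"
    by (rule lists_image)
  also have "V.val ` map Inl ` lists I = alpha ` W.val ` lists I"
    unfolding image_image by (rule image_cong[OF refl]) (simp only: alpha(2))
  finally show ?thesis
    unfolding W.generated .
qed

lemma alpha_in_P [simp]: "x \<in> carrier W \<Longrightarrow> alpha x \<in> V.P"
  using alpha_range by blast

text \<open>Letters of \<open>K\<close> are handled inside \<open>W\<close>. For \<open>i\<close>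
  outside \<open>K\<close>, a left descent \<open>Inl i\<close> of \<open>beta b\<close> would, by
  exchange, put \<open>S (Inl i)\<close> into the image of \<open>beta\<close>. Applying
  \<open>retract\<close> then identifies it with \<open>S (Inr i)\<close>, contrary to
  \<open>simple_inj\<close>.\<close>

lemma minimal_beta:
  assumes "W.minimal b"
  shows "V.minimal (beta b)"
proof (rule V.minimalI)
  have b: "b \<in> carrier W"
    using assms by simp
  then show "beta b \<in> carrier V"
    by simp
  fix x :: "'i + 'i" assume "x \<in> Inl ` I"
  then obtain i where i: "i \<in> I" "x = Inl i"
    by blast
  show "V.len (beta b) \<le> V.len (S x \<otimes>\<^bsub>V\<^esub> beta b)"
  proof (cases "i \<in> K")
    case True
    then have eq: "S x \<otimes>\<^bsub>V\<^esub> beta b = beta (s i \<otimes>\<^bsub>W\<^esub> b)"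
      using b i by (simp add: letter_def)
    have "W.len b \<le> W.len (s i \<otimes>\<^bsub>W\<^esub> b)"
      using assms True unfolding W.minimal_def by simp
    then show ?thesis
      unfolding eq using b i by (simp del: beta_mult)
  next
    case False
    show ?thesis
    proof (rule ccontr)
      assume less: "\<not> ?thesis"
      obtain u where u: "u \<in> lists I" "W.val u = b" "length u = W.len b"
        using W.reduced_word_exists b by blast
      have "V.val (map letter u) = beta b"
        using beta(2)[OF u(1)] u(2) by simp
      then obtain p k q where pq: "map letter u = p @ k # q" "S x \<otimes>\<^bsub>V\<^esub> beta b = V.val (p @ q)"
        using V.left_exchange[OF lists_letter[OF u(1)], of x] less i by auto
      then obtain p' k' q' where u': "u = p' @ k' # q'" "p = map letter p'" "q = map letter q'"
        by (auto simp: map_eq_append_conv map_eq_Cons_conv)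
      then have l: "p' @ q' \<in> lists I"
        using u(1) by auto
      define c where "c = W.val (p' @ q')"
      have c: "c \<in> carrier W"
        unfolding c_def using l by (rule W.val_closed)
      have "S x \<otimes>\<^bsub>V\<^esub> beta b = beta c"
        using beta(2)[OF l] pq(2) u' by (simp add: c_def)
      then have "S x = beta (c \<otimes>\<^bsub>W\<^esub> inv\<^bsub>W\<^esub> b)"
        using b c i V.inv_solve_right[of "S x" "beta c" "beta b"] by simp
      moreover have "S x = alpha (s i)"
        using i by simp
      ultimately have "s i = c \<otimes>\<^bsub>W\<^esub> inv\<^bsub>W\<^esub> b"
        using retract_alpha[of "s i"] retract_beta[of "c \<otimes>\<^bsub>W\<^esub> inv\<^bsub>W\<^esub> b"] i b c by simp
      then have "S (Inl i) = S (letter i)"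
        using \<open>S x = beta (c \<otimes>\<^bsub>W\<^esub> inv\<^bsub>W\<^esub> b)\<close> i(2) beta_simple[OF i(1)] by simp
      then show False
        using V.simple_inj[of "Inl i" "letter i"] letter_in[OF i(1)] i(1) False by (simp add: letter_def)
    qed
  qed
qed

text \<open>The pair \<open>(v, w)\<close> of \<open>Q K\<close> is represented by \<open>glue v (inv w)\<close>.\<close>

definition glue :: "'w \<Rightarrow> 'w \<Rightarrow> 'v" where
  "glue v b = alpha v \<otimes>\<^bsub>V\<^esub> beta b"

lemma glue_closed [simp]: "v \<in> carrier W \<Longrightarrow> b \<in> carrier W \<Longrightarrow> glue v b \<in> carrier V"
  by (simp add: glue_def)

lemma glue_coset_len: "v \<in> carrier W \<Longrightarrow> W.minimal b \<Longrightarrow> V.coset_len (glue v b) = W.len b"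
  by (simp add: glue_def V.coset_len_mult V.coset_len_minimal minimal_beta)

lemma glue_height:
  "v \<in> carrier W \<Longrightarrow> W.minimal b \<Longrightarrow> V.twisted_height (glue v b) = int (W.len b) - int (W.len v)"
  by (simp add: glue_def V.twisted_height_decomposition minimal_beta)

lemma glue_inj:
  assumes "v \<in> carrier W" "v' \<in> carrier W" "W.minimal b" "W.minimal b'" "glue v b = glue v' b'"
  shows "v = v'" "b = b'"
proof -
  have "alpha v = alpha v'" "beta b = beta b'"
    using V.minimal_decomposition_unique[of "alpha v" "alpha v'" "beta b" "beta b'"] assms minimal_beta
    by (auto simp: glue_def)
  then show "v = v'" "b = b'"
    using alpha_inj beta_inj assms by simp_all
qed

lemma glue_mult_simple:
  "v \<in> carrier W \<Longrightarrow> b \<in> carrier W \<Longrightarrow> i \<in> I \<Longrightarrow> glue v b \<otimes>\<^bsub>V\<^esub> S (letter i) = glue v (b \<otimes>\<^bsub>W\<^esub> s i)"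
  using letter_in by (simp add: glue_def V.m_assoc)

text \<open>Letters of \<open>K\<close> pass between the two factors; the element \<open>u\<close>
  in the order of \<open>Q K\<close> has its origin here.\<close>

lemma glue_shift:
  assumes "v \<in> carrier W" "b \<in> carrier W" "j \<in> K"
  shows "glue v (s j \<otimes>\<^bsub>W\<^esub> b) = glue (v \<otimes>\<^bsub>W\<^esub> s j) b"
proof -
  have "letter j = Inl j" "j \<in> I"
    using assms W.J_in_I by (auto simp: letter_def)
  then show ?thesis
    using assms letter_in[of j] by (simp add: glue_def V.m_assoc)
qed

section \<open>Comparison of the orders and the embedding of \<open>Q K\<close>\<close>

lemma alpha_edge:
  assumes "W.bruhat.edge x y"
  shows "V.bruhat.edge (alpha x) (alpha y)"
proof -
  obtain t where t: "x \<in> carrier W" "t \<in> W.reflections" "y = x \<otimes>\<^bsub>W\<^esub> t" "W.len x < W.len y"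
    using assms by (auto simp: W.bruhat.edge_def)
  obtain z i where z: "z \<in> carrier W" "i \<in> I" "t = z \<otimes>\<^bsub>W\<^esub> s i \<otimes>\<^bsub>W\<^esub> inv\<^bsub>W\<^esub> z"
    using t(2) by (rule W.reflectionE)
  then have "alpha t = alpha z \<otimes>\<^bsub>V\<^esub> S (Inl i) \<otimes>\<^bsub>V\<^esub> inv\<^bsub>V\<^esub> (alpha z)"
    by simp
  then have "alpha t \<in> V.reflections"
    using V.reflectionI[of "alpha z" "Inl i"] z by simp
  then show ?thesis
    using t unfolding V.bruhat.edge_def by (auto intro!: bexI[of _ "alpha t"] simp flip: alpha_mult)
qed

lemma alpha_edge_back:
  assumes "V.bruhat.edge x (alpha y)" "y \<in> carrier W"
  obtains x' where "x = alpha x'" "W.bruhat.edge x' y"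
proof -
  have "x \<in> V.P"
    using V.bruhat_edge_P(1)[OF assms(1)] assms(2) by simp
  then obtain x' where x': "x' \<in> carrier W" "x = alpha x'"
    using alpha_range by blast
  obtain t where t: "t \<in> V.reflections" "alpha y = alpha x' \<otimes>\<^bsub>V\<^esub> t" "V.len (alpha x') < V.len (alpha y)"
    using assms(1) x' by (auto simp: V.bruhat.edge_def)
  have eq: "t = alpha (inv\<^bsub>W\<^esub> x' \<otimes>\<^bsub>W\<^esub> y)"
    using t x' assms(2) by simp
  then have "t \<in> V.P"
    using x' assms(2) by simp
  then obtain p j where p: "p \<in> V.P" "j \<in> Inl ` I" "t = p \<otimes>\<^bsub>V\<^esub> S j \<otimes>\<^bsub>V\<^esub> inv\<^bsub>V\<^esub> p"
    using V.parabolic_reflection t(1) by blast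
  then obtain p' j' where p': "p' \<in> carrier W" "p = alpha p'" "j' \<in> I" "j = Inl j'"
    using alpha_range by blast
  have "alpha (inv\<^bsub>W\<^esub> x' \<otimes>\<^bsub>W\<^esub> y) = alpha (p' \<otimes>\<^bsub>W\<^esub> s j' \<otimes>\<^bsub>W\<^esub> inv\<^bsub>W\<^esub> p')"
    using eq p p' by simp
  then have "inv\<^bsub>W\<^esub> x' \<otimes>\<^bsub>W\<^esub> y = p' \<otimes>\<^bsub>W\<^esub> s j' \<otimes>\<^bsub>W\<^esub> inv\<^bsub>W\<^esub> p'"
    using alpha_inj x' assms(2) p' by simp
  then have "inv\<^bsub>W\<^esub> x' \<otimes>\<^bsub>W\<^esub> y \<in> W.reflections"
    using W.reflectionI p' by simp
  moreover have "x' \<otimes>\<^bsub>W\<^esub> (inv\<^bsub>W\<^esub> x' \<otimes>\<^bsub>W\<^esub> y) = y"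
    using x' assms(2) by simp
  ultimately have "W.bruhat.edge x' y"
    unfolding W.bruhat.edge_def using x' t(3) assms(2)
    by (intro conjI bexI[of _ "inv\<^bsub>W\<^esub> x' \<otimes>\<^bsub>W\<^esub> y"]) simp_all
  then show ?thesis
    using that x' by blast
qed

lemma alpha_le_iff:
  assumes "x \<in> carrier W" "y \<in> carrier W"
  shows "V.bruhat.le (alpha x) (alpha y) \<longleftrightarrow> W.bruhat.le x y"
proof
  assume "W.bruhat.le x y"
  then show "V.bruhat.le (alpha x) (alpha y)"
  proof (induction rule: W.bruhat.le_induct)
    case refl
    then show ?case
      using assms(1) by simp
  next
    case (step y z)
    then show ?case
      using alpha_edge V.bruhat.edge_le V.bruhat.le_trans by blast
  qed
next
  have "\<forall>y'\<in>carrier W. z = alpha y' \<longrightarrow> W.bruhat.le x y'" if "V.bruhat.le (alpha x) z" for z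
    using that
  proof (induction rule: V.bruhat.le_induct)
    case refl
    have "x = y'" if "y' \<in> carrier W" "alpha x = alpha y'" for y'
      using alpha_inj[OF assms(1) that] .
    then show ?case
      using assms(1) W.bruhat.le_refl by blast
  next
    case (step y z)
    show ?case
    proof (intro ballI impI)
      fix z' assume z': "z' \<in> carrier W" "z = alpha z'"
      then obtain y' where "y = alpha y'" "W.bruhat.edge y' z'"
        using alpha_edge_back step(2) by blast
      then show "W.bruhat.le x z'"
        using step.IH W.bruhat.edge_closed W.bruhat.edge_le W.bruhat.le_trans by blast
    qed
  qed
  then show "V.bruhat.le (alpha x) (alpha y) \<Longrightarrow> W.bruhat.le x y"
    using assms by blast
qed

text \<open>The two outer inequalities of the order of \<open>Q K\<close>, with \<open>b\<close> in
  the role of \<open>inv w\<close>. In this form the relation makes sense for all pairs, also those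
  without \<open>v <= w\<close>, and these occur in the induction; the middle inequality is supplied
  for elements of \<open>Q K\<close> in \<open>pair_le_iff\<close>.\<close>

definition pair_le :: "'w \<Rightarrow> 'w \<Rightarrow> 'w \<Rightarrow> 'w \<Rightarrow> bool" where
  "pair_le v' b' v b \<longleftrightarrow> (\<exists>u\<in>W.P. W.bruhat.le v (v' \<otimes>\<^bsub>W\<^esub> u) \<and> W.bruhat.le (inv\<^bsub>W\<^esub> u \<otimes>\<^bsub>W\<^esub> b') b)"

text \<open>Both relations obey the same lifting rule along a right descent \<open>i\<close> of
  \<open>b\<close>: on one side multiply by the generator of \<open>letter i\<close>, on the other
  multiply \<open>b\<close> and \<open>inv u b'\<close> by \<open>s i\<close>. When \<open>b\<close>
  is the identity, additivity of lengths forces \<open>u\<close> and \<open>b'\<close> to be the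
  identity too, and the reversed Bruhat order of the first copy remains.\<close>

theorem twisted_le_glue_iff:
  assumes "v \<in> carrier W" "v' \<in> carrier W" "W.minimal b" "W.minimal b'"
  shows "V.twisted.le (glue v' b') (glue v b) \<longleftrightarrow> pair_le v' b' v b"
  using assms
proof (induction "W.len b" arbitrary: b v' b' rule: less_induct)
  case less
  note v = less.prems(1,2) and min = less.prems(3,4)
  have b: "b \<in> carrier W" "b' \<in> carrier W"
    using min by simp_all
  show ?case
  proof (cases "b = \<one>\<^bsub>W\<^esub>")
    case True
    show ?thesis
    proof
      assume le: "V.twisted.le (glue v' b') (glue v b)"
      then have "W.len b' = 0"
        using V.twisted_le_coset_len[OF le] True v min by (simp add: glue_coset_len)
      then have b': "b' = \<one>\<^bsub>W\<^esub>"
        using W.len_eq_0_iff b by simp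
      have "V.twisted.le (alpha v') (alpha v)"
        using le v by (simp add: glue_def True b')
      then have "W.bruhat.le v v'"
        using V.twisted_le_P[of "alpha v'" "alpha v"] alpha_le_iff[OF v] v by simp
      then show "pair_le v' b' v b"
        unfolding pair_le_def using v by (intro bexI[of _ "\<one>\<^bsub>W\<^esub>"]) (simp_all add: True b')
    next
      assume "pair_le v' b' v b"
      then obtain u where u: "u \<in> W.P" "W.bruhat.le v (v' \<otimes>\<^bsub>W\<^esub> u)" "W.bruhat.le (inv\<^bsub>W\<^esub> u \<otimes>\<^bsub>W\<^esub> b') \<one>\<^bsub>W\<^esub>"
        unfolding pair_le_def True by blast
      have "inv\<^bsub>W\<^esub> u \<otimes>\<^bsub>W\<^esub> b' = \<one>\<^bsub>W\<^esub>"
        using W.bruhat_le_one(1)[OF _ u(3)] by simp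
      moreover have "W.len (inv\<^bsub>W\<^esub> u \<otimes>\<^bsub>W\<^esub> b') = W.len u + W.len b'"
        using W.len_P_mult_minimal[OF W.P_inv[OF u(1)] min(2)] u(1) by simp
      ultimately have "u = \<one>\<^bsub>W\<^esub>" "b' = \<one>\<^bsub>W\<^esub>"
        using W.len_eq_0_iff u b by simp_all
      then have "W.bruhat.le v v'"
        using u v by simp
      then have "V.twisted.le (alpha v') (alpha v)"
        using V.bruhat_le_P[of "alpha v" "alpha v'"] alpha_le_iff[OF v] v by simp
      then show "V.twisted.le (glue v' b') (glue v b)"
        using v by (simp add: glue_def True \<open>b' = \<one>\<^bsub>W\<^esub>\<close>)
    qed
  next
    case False
    then obtain i where i: "i \<in> I" "W.len b = W.len (b \<otimes>\<^bsub>W\<^esub> s i) + 1"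
      using W.right_descent_exists b by blast
    define c where "c = b \<otimes>\<^bsub>W\<^esub> s i"
    have c: "c \<in> carrier W" "W.minimal c" "W.len c < W.len b" "c \<otimes>\<^bsub>W\<^esub> s i = b"
      using W.minimal_descent[OF min(1) i(1)] i b by (simp_all add: c_def)
    have l: "letter i \<in> Inl ` I \<union> Inr ` (I - K)"
      using letter_in i by blast
    define x y where "x = glue v' b'" and "y = glue v b"
    have xc: "x \<in> carrier V" "y \<in> carrier V"
      using v b by (simp_all add: x_def y_def)
    have yS: "y \<otimes>\<^bsub>V\<^esub> S (letter i) = glue v c" "glue v c \<otimes>\<^bsub>V\<^esub> S (letter i) = y"
      using glue_mult_simple v b c i by (simp_all add: y_def c_def)
    have hy: "V.twisted_height (glue v c) < V.twisted_height y"
      using v min c by (simp add: y_def glue_height)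
    have lowy: "V.twisted.lower (letter i) y = glue v c"
      using yS hy by (simp add: V.twisted.lower_def)
    have lify: "V.twisted.le (z \<otimes>\<^bsub>V\<^esub> S (letter i)) y" if "V.twisted.le z (glue v c)" for z
      using V.twisted.le_mult_simple[OF that l] yS hy by simp
    have ley: "V.twisted.le (glue v c) y"
      using V.twisted.simple_edge(1)[OF xc(2) l] yS hy V.twisted.edge_le by simp
    have lift: "W.bruhat.le (z \<otimes>\<^bsub>W\<^esub> s i) b" if "W.bruhat.le z c" for z
      using W.bruhat.le_mult_simple[OF that i(1)] c by simp
    have leb: "W.bruhat.le c b"
      using W.bruhat.simple_edge(2)[OF c(1) i(1)] c W.bruhat.edge_le by simp
    have "W.minimal (b' \<otimes>\<^bsub>W\<^esub> s i) \<or> (\<exists>j\<in>K. b' \<otimes>\<^bsub>W\<^esub> s i = s j \<otimes>\<^bsub>W\<^esub> b')"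
      using W.minimal_mult_simple[OF min(2) i(1)] .
    \<comment> \<open>The pair \<open>(d, e)\<close> is \<open>(v', b' s i)\<close> or, in the other
      alternative of \<open>minimal_mult_simple\<close>, \<open>(v' s j, b')\<close>. The facts
      \<open>shift\<close> and \<open>shift'\<close> say that either way the pairs
      \<open>(d u, inv u e)\<close> are the pairs \<open>(v' u', inv u' b' s i)\<close>.\<close>
    then obtain d e where de: "d \<in> carrier W" "W.minimal e" "x \<otimes>\<^bsub>V\<^esub> S (letter i) = glue d e"
      and shift: "\<And>u. u \<in> W.P \<Longrightarrow> \<exists>u'\<in>W.P. d \<otimes>\<^bsub>W\<^esub> u = v' \<otimes>\<^bsub>W\<^esub> u' \<and> inv\<^bsub>W\<^esub> u \<otimes>\<^bsub>W\<^esub> e = inv\<^bsub>W\<^esub> u' \<otimes>\<^bsub>W\<^esub> b' \<otimes>\<^bsub>W\<^esub> s i"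
      and shift': "\<And>u. u \<in> W.P \<Longrightarrow> \<exists>u'\<in>W.P. d \<otimes>\<^bsub>W\<^esub> u' = v' \<otimes>\<^bsub>W\<^esub> u \<and> inv\<^bsub>W\<^esub> u' \<otimes>\<^bsub>W\<^esub> e = inv\<^bsub>W\<^esub> u \<otimes>\<^bsub>W\<^esub> b' \<otimes>\<^bsub>W\<^esub> s i"
    proof (elim disjE bexE)
      assume e: "W.minimal (b' \<otimes>\<^bsub>W\<^esub> s i)"
      show ?thesis
      proof (rule that[of v' "b' \<otimes>\<^bsub>W\<^esub> s i"])
        show "x \<otimes>\<^bsub>V\<^esub> S (letter i) = glue v' (b' \<otimes>\<^bsub>W\<^esub> s i)"
          using glue_mult_simple v b i by (simp add: x_def)
        show "\<exists>u'\<in>W.P. v' \<otimes>\<^bsub>W\<^esub> u = v' \<otimes>\<^bsub>W\<^esub> u' \<and> inv\<^bsub>W\<^esub> u \<otimes>\<^bsub>W\<^esub> (b' \<otimes>\<^bsub>W\<^esub> s i) = inv\<^bsub>W\<^esub> u' \<otimes>\<^bsub>W\<^esub> b' \<otimes>\<^bsub>W\<^esub> s i"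
          if "u \<in> W.P" for u
          using that b i(1) by (intro bexI[of _ u]) (simp_all add: W.m_assoc)
        show "\<exists>u'\<in>W.P. v' \<otimes>\<^bsub>W\<^esub> u' = v' \<otimes>\<^bsub>W\<^esub> u \<and> inv\<^bsub>W\<^esub> u' \<otimes>\<^bsub>W\<^esub> (b' \<otimes>\<^bsub>W\<^esub> s i) = inv\<^bsub>W\<^esub> u \<otimes>\<^bsub>W\<^esub> b' \<otimes>\<^bsub>W\<^esub> s i"
          if "u \<in> W.P" for u
          using that b i(1) by (intro bexI[of _ u]) (simp_all add: W.m_assoc)
      qed (use v e in simp_all)
    next
      fix j assume j: "j \<in> K" and eq: "b' \<otimes>\<^bsub>W\<^esub> s i = s j \<otimes>\<^bsub>W\<^esub> b'"
      have jc: "j \<in> I" "s j \<in> W.P"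
        using j by simp_all
      show ?thesis
      proof (rule that[of "v' \<otimes>\<^bsub>W\<^esub> s j" b'])
        show "x \<otimes>\<^bsub>V\<^esub> S (letter i) = glue (v' \<otimes>\<^bsub>W\<^esub> s j) b'"
          using glue_mult_simple glue_shift v b i eq j by (simp add: x_def)
        show "\<exists>u'\<in>W.P. v' \<otimes>\<^bsub>W\<^esub> s j \<otimes>\<^bsub>W\<^esub> u = v' \<otimes>\<^bsub>W\<^esub> u' \<and> inv\<^bsub>W\<^esub> u \<otimes>\<^bsub>W\<^esub> b' = inv\<^bsub>W\<^esub> u' \<otimes>\<^bsub>W\<^esub> b' \<otimes>\<^bsub>W\<^esub> s i"
          if "u \<in> W.P" for u
          using that b i(1) v jc eq
          by (intro bexI[of _ "s j \<otimes>\<^bsub>W\<^esub> u"]) (simp_all add: W.m_assoc W.inv_mult_group)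
        show "\<exists>u'\<in>W.P. v' \<otimes>\<^bsub>W\<^esub> s j \<otimes>\<^bsub>W\<^esub> u' = v' \<otimes>\<^bsub>W\<^esub> u \<and> inv\<^bsub>W\<^esub> u' \<otimes>\<^bsub>W\<^esub> b' = inv\<^bsub>W\<^esub> u \<otimes>\<^bsub>W\<^esub> b' \<otimes>\<^bsub>W\<^esub> s i"
          if "u \<in> W.P" for u
          using that b i(1) v jc eq
          by (intro bexI[of _ "s j \<otimes>\<^bsub>W\<^esub> u"]) (simp_all add: W.m_assoc W.inv_mult_group)
      qed (use v min(2) jc in simp_all)
    qed
    have IH1: "V.twisted.le x (glue v c) \<longleftrightarrow> pair_le v' b' v c"
      unfolding x_def by (rule less.hyps[OF c(3) v c(2) min(2)])
    have IH2: "V.twisted.le (glue d e) (glue v c) \<longleftrightarrow> pair_le d e v c"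
      by (rule less.hyps[OF c(3) v(1) de(1) c(2) de(2)])
    have "V.twisted.le x y \<longleftrightarrow> pair_le v' b' v b"
    proof
      assume le: "V.twisted.le x y"
      have low: "V.twisted.le (V.twisted.lower (letter i) x) (glue v c)"
        using V.twisted.lower_mono[OF le l] lowy by simp
      show "pair_le v' b' v b"
      proof (cases "V.twisted_height (x \<otimes>\<^bsub>V\<^esub> S (letter i)) < V.twisted_height x")
        case True
        then have "pair_le d e v c"
          using low IH2 de(3) by (simp add: V.twisted.lower_def)
        then obtain u where u: "u \<in> W.P" "W.bruhat.le v (d \<otimes>\<^bsub>W\<^esub> u)" "W.bruhat.le (inv\<^bsub>W\<^esub> u \<otimes>\<^bsub>W\<^esub> e) c"
          unfolding pair_le_def by blast
        obtain u' where u': "u' \<in> W.P" "d \<otimes>\<^bsub>W\<^esub> u = v' \<otimes>\<^bsub>W\<^esub> u'" "inv\<^bsub>W\<^esub> u \<otimes>\<^bsub>W\<^esub> e = inv\<^bsub>W\<^esub> u' \<otimes>\<^bsub>W\<^esub> b' \<otimes>\<^bsub>W\<^esub> s i"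
          using shift[OF u(1)] by blast
        have "W.bruhat.le (inv\<^bsub>W\<^esub> u' \<otimes>\<^bsub>W\<^esub> b') b"
          using lift[OF u(3)] u' b i(1) by simp
        then show ?thesis
          unfolding pair_le_def using u u' by (intro bexI[of _ u']) simp_all
      next
        case False
        then have "pair_le v' b' v c"
          using low IH1 by (simp add: V.twisted.lower_def)
        then show ?thesis
          unfolding pair_le_def using leb W.bruhat.le_trans by blast
      qed
    next
      assume "pair_le v' b' v b"
      then obtain u where u: "u \<in> W.P" "W.bruhat.le v (v' \<otimes>\<^bsub>W\<^esub> u)" "W.bruhat.le (inv\<^bsub>W\<^esub> u \<otimes>\<^bsub>W\<^esub> b') b"
        unfolding pair_le_def by blast
      let ?z = "inv\<^bsub>W\<^esub> u \<otimes>\<^bsub>W\<^esub> b'"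
      have "W.bruhat.lower i b = c"
        using c by (simp add: W.bruhat.lower_def c_def)
      then have low: "W.bruhat.le (W.bruhat.lower i ?z) c"
        using W.bruhat.lower_mono[OF u(3) i(1)] by simp
      show "V.twisted.le x y"
      proof (cases "W.len (?z \<otimes>\<^bsub>W\<^esub> s i) < W.len ?z")
        case True
        then have *: "W.bruhat.le (?z \<otimes>\<^bsub>W\<^esub> s i) c"
          using low by (simp add: W.bruhat.lower_def)
        obtain u' where u': "u' \<in> W.P" "d \<otimes>\<^bsub>W\<^esub> u' = v' \<otimes>\<^bsub>W\<^esub> u" "inv\<^bsub>W\<^esub> u' \<otimes>\<^bsub>W\<^esub> e = ?z \<otimes>\<^bsub>W\<^esub> s i"
          using shift'[OF u(1)] by blast
        have "pair_le d e v c"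
          unfolding pair_le_def using u' u * by (intro bexI[of _ u']) simp_all
        then have "V.twisted.le (x \<otimes>\<^bsub>V\<^esub> S (letter i)) (glue v c)"
          using IH2 de(3) by simp
        from lify[OF this] show ?thesis
          using xc l by simp
      next
        case False
        then have "pair_le v' b' v c"
          unfolding pair_le_def using low u by (intro bexI[of _ u]) (simp_all add: W.bruhat.lower_def)
        then show ?thesis
          using IH1 ley V.twisted.le_trans by blast
      qed
    qed
    then show ?thesis
      by (simp add: x_def y_def)
  qed
qed

text \<open>Lower both elements by a right descent of \<open>b\<close> and apply induction. Undoing
  the step on \<open>z\<close> stays in the image, since by Deodhar's lemma the letter either
  extends the minimal factor or is a letter of \<open>K\<close> that passes to the first
  factor.\<close>

lemma glue_downward_closed:
  assumes "V.twisted.le z (glue v b)" "v \<in> carrier W" "W.minimal b"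
  shows "\<exists>v'\<in>carrier W. \<exists>b'. W.minimal b' \<and> z = glue v' b'"
  using assms
proof (induction "W.len b" arbitrary: b z rule: less_induct)
  case less
  have b: "b \<in> carrier W" and z: "z \<in> carrier V"
    using less.prems V.twisted.le_closed by simp_all
  show ?case
  proof (cases "b = \<one>\<^bsub>W\<^esub>")
    case True
    then have "z \<in> V.P"
      using V.twisted_le_P[OF less.prems(1)] less.prems(2) by (simp add: glue_def)
    then obtain v' where "v' \<in> carrier W" "z = glue v' \<one>\<^bsub>W\<^esub>"
      using alpha_range by (auto simp: glue_def)
    then show ?thesis
      using W.minimal_one by blast
  next
    case False
    then obtain i where i: "i \<in> I" "W.len b = W.len (b \<otimes>\<^bsub>W\<^esub> s i) + 1"
      using W.right_descent_exists b by blast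
    have l: "letter i \<in> Inl ` I \<union> Inr ` (I - K)"
      using letter_in i by blast
    have c: "W.minimal (b \<otimes>\<^bsub>W\<^esub> s i)"
      using W.minimal_descent[OF less.prems(3) i(1)] i by simp
    have eq: "glue v b \<otimes>\<^bsub>V\<^esub> S (letter i) = glue v (b \<otimes>\<^bsub>W\<^esub> s i)"
      using glue_mult_simple less.prems(2) b i by simp
    then have "V.twisted.lower (letter i) (glue v b) = glue v (b \<otimes>\<^bsub>W\<^esub> s i)"
      using less.prems c i by (simp add: V.twisted.lower_def glue_height)
    then have "V.twisted.le (V.twisted.lower (letter i) z) (glue v (b \<otimes>\<^bsub>W\<^esub> s i))"
      using V.twisted.lower_mono[OF less.prems(1) l] by simp
    then obtain v' b' where v': "v' \<in> carrier W" "W.minimal b'" "V.twisted.lower (letter i) z = glue v' b'"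
      using less.hyps[of "b \<otimes>\<^bsub>W\<^esub> s i"] i(2) c less.prems(2) by fastforce
    show ?thesis
    proof (cases "V.twisted_height (z \<otimes>\<^bsub>V\<^esub> S (letter i)) < V.twisted_height z")
      case True
      then have "z \<otimes>\<^bsub>V\<^esub> S (letter i) = glue v' b'"
        using v' by (simp add: V.twisted.lower_def)
      then have "z = glue v' b' \<otimes>\<^bsub>V\<^esub> S (letter i)"
        using z l V.mult_simple_simple by metis
      then have z': "z = glue v' (b' \<otimes>\<^bsub>W\<^esub> s i)"
        using glue_mult_simple v' i(1) by simp
      from W.minimal_mult_simple[OF v'(2) i(1)] show ?thesis
      proof (elim disjE bexE)
        fix j assume j: "j \<in> K" "b' \<otimes>\<^bsub>W\<^esub> s i = s j \<otimes>\<^bsub>W\<^esub> b'"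
        then have "z = glue (v' \<otimes>\<^bsub>W\<^esub> s j) b'"
          using z' glue_shift v' by simp
        moreover have "v' \<otimes>\<^bsub>W\<^esub> s j \<in> carrier W"
          using v' j by simp
        ultimately show ?thesis
          using v' by blast
      qed (use z' v' in blast)
    next
      case False
      then show ?thesis
        using v' by (auto simp: V.twisted.lower_def)
    qed
  qed
qed

definition embed :: "'w \<times> 'w \<Rightarrow> 'v" where
  "embed = (\<lambda>(v, w). glue v (inv\<^bsub>W\<^esub> w))"

lemma Q_iff: "(v, w) \<in> W.Q K \<longleftrightarrow> v \<in> carrier W \<and> w \<in> carrier W \<and> W.minimal (inv\<^bsub>W\<^esub> w) \<and> W.bruhat.le v w"
  by (auto simp: W.Q_def W.min_reps_iff W.bruhat_le_iff)

lemma pair_le_iff: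
  assumes "(v', w') \<in> W.Q K" "v \<in> carrier W" "w \<in> carrier W"
  shows "pair_le v' (inv\<^bsub>W\<^esub> w') v (inv\<^bsub>W\<^esub> w) \<longleftrightarrow> (\<exists>u\<in>W.P. W.bruhat.le v (v' \<otimes>\<^bsub>W\<^esub> u) \<and>
    W.bruhat.le (v' \<otimes>\<^bsub>W\<^esub> u) (w' \<otimes>\<^bsub>W\<^esub> u) \<and> W.bruhat.le (w' \<otimes>\<^bsub>W\<^esub> u) w)"
proof -
  have *: "v' \<in> carrier W" "w' \<in> carrier W" "W.minimal (inv\<^bsub>W\<^esub> w')" "W.bruhat.le v' w'"
    using assms(1) by (auto simp: Q_iff)
  have "W.bruhat.le (inv\<^bsub>W\<^esub> u \<otimes>\<^bsub>W\<^esub> inv\<^bsub>W\<^esub> w') (inv\<^bsub>W\<^esub> w) \<longleftrightarrow> W.bruhat.le (w' \<otimes>\<^bsub>W\<^esub> u) w" if "u \<in> W.P" for u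
    using W.bruhat_le_inv[of "w' \<otimes>\<^bsub>W\<^esub> u" w] W.bruhat_le_inv[of "inv\<^bsub>W\<^esub> u \<otimes>\<^bsub>W\<^esub> inv\<^bsub>W\<^esub> w'" "inv\<^bsub>W\<^esub> w"]
      that * assms(3) by (auto simp: W.inv_mult_group)
  then show ?thesis
    unfolding pair_le_def using W.bruhat_le_mult_P[OF *(4,3)] by blast
qed

lemma Q_order_iff:
  "(p, q) \<in> W.Q_order K \<longleftrightarrow> p \<in> W.Q K \<and> q \<in> W.Q K \<and> V.twisted.le (embed p) (embed q)"
proof -
  obtain v' w' v w where pq: "p = (v', w')" "q = (v, w)"
    by (cases p, cases q)
  have "V.twisted.le (embed p) (embed q) \<longleftrightarrow> (\<exists>u\<in>W.P. W.bruhat.le v (v' \<otimes>\<^bsub>W\<^esub> u) \<and>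
    W.bruhat.le (v' \<otimes>\<^bsub>W\<^esub> u) (w' \<otimes>\<^bsub>W\<^esub> u) \<and> W.bruhat.le (w' \<otimes>\<^bsub>W\<^esub> u) w)" if "p \<in> W.Q K" "q \<in> W.Q K"
    using that twisted_le_glue_iff[of v v' "inv\<^bsub>W\<^esub> w" "inv\<^bsub>W\<^esub> w'"] pair_le_iff[of v' w' v w]
    by (simp add: pq embed_def Q_iff)
  then show ?thesis
    unfolding W.Q_order_def pq by (auto simp: W.bruhat_le_iff)
qed

lemma embed_inj: "inj_on embed (W.Q K)"
proof (rule inj_onI, clarify)
  fix v w v' w' assume "(v, w) \<in> W.Q K" "(v', w') \<in> W.Q K" "embed (v, w) = embed (v', w')"
  then have "v = v'" "inv\<^bsub>W\<^esub> w = inv\<^bsub>W\<^esub> w'" "w \<in> carrier W" "w' \<in> carrier W"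
    using glue_inj[of v v' "inv\<^bsub>W\<^esub> w" "inv\<^bsub>W\<^esub> w'"] by (auto simp: embed_def Q_iff)
  then show "v = v' \<and> w = w'"
    by (metis W.inv_inv)
qed

lemma embed_closed: "p \<in> W.Q K \<Longrightarrow> embed p \<in> carrier V"
  by (cases p) (auto simp: embed_def Q_iff)

text \<open>Elements below \<open>embed q\<close> have the form \<open>glue x b\<close>. That
  \<open>x\<close> is below \<open>inv b\<close> comes from the lower end \<open>(v', w')\<close>:
  the chain is \<open>x <= v' u <= w' u <= inv b\<close>, whose middle step is
  \<open>v' <= w'\<close> multiplied by \<open>u\<close>.\<close>

lemma embed_convex:
  assumes "p \<in> W.Q K" "q \<in> W.Q K" "V.twisted.le (embed p) z" "V.twisted.le z (embed q)"
  shows "z \<in> embed ` W.Q K"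
proof -
  obtain v' w' v w where pq: "p = (v', w')" "q = (v, w)"
    by (cases p, cases q)
  have Q: "v' \<in> carrier W" "w' \<in> carrier W" "W.minimal (inv\<^bsub>W\<^esub> w')" "v \<in> carrier W" "w \<in> carrier W"
    "W.minimal (inv\<^bsub>W\<^esub> w)"
    using assms(1,2) by (auto simp: pq Q_iff)
  obtain x b where xb: "x \<in> carrier W" "W.minimal b" "z = glue x b"
    using glue_downward_closed[of z v "inv\<^bsub>W\<^esub> w"] assms(4) Q by (auto simp: pq embed_def)
  then have b: "b \<in> carrier W"
    by simp
  have "pair_le v' (inv\<^bsub>W\<^esub> w') x (inv\<^bsub>W\<^esub> (inv\<^bsub>W\<^esub> b))"
    using twisted_le_glue_iff[of x v' b "inv\<^bsub>W\<^esub> w'"] assms(3) xb Q b by (simp add: pq embed_def)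
  then have "W.bruhat.le x (inv\<^bsub>W\<^esub> b)"
    using pair_le_iff[of v' w' x "inv\<^bsub>W\<^esub> b"] assms(1) xb(1) b W.bruhat.le_trans by (simp add: pq) blast
  then have "(x, inv\<^bsub>W\<^esub> b) \<in> W.Q K"
    using xb b by (simp add: Q_iff)
  moreover have "z = embed (x, inv\<^bsub>W\<^esub> b)"
    using xb b by (simp add: embed_def)
  ultimately show ?thesis
    by blast
qed

end

section \<open>Labelings of subposets\<close>

context coxeter_height
begin

lemma path_successively_neq: "path x ts \<Longrightarrow> successively (\<noteq>) ts"
proof (induction ts arbitrary: x)
  case (Cons t ts)
  then have t: "x \<in> carrier W" "t \<in> reflections" "h (x \<otimes> t) = h x + 1" and IH: "successively (\<noteq>) ts"
    by auto
  show ?case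
  proof (cases ts)
    case (Cons t' us)
    have "t \<noteq> t'"
      using Cons.prems t Cons by auto
    then show ?thesis
      using IH Cons by simp
  qed simp
qed simp

end

text \<open>Convexity of the image makes every interval of \<open>r\<close> a full interval of the
  ambient order, so maximal chains correspond to cover paths.\<close>

locale coxeter_height_subposet = coxeter_height_descent W I m s h \<mu>
  for W :: "('w, 'b) monoid_scheme" (structure) and I :: "'i set" and m s h \<mu> +
  fixes A :: "'a set" and r :: "'a rel" and F :: "'a \<Rightarrow> 'w"
  assumes F_inj: "inj_on F A"
    and F_closed: "F ` A \<subseteq> carrier W"
    and r_iff: "(p, q) \<in> r \<longleftrightarrow> p \<in> A \<and> q \<in> A \<and> le (F p) (F q)"
    and F_convex: "\<lbrakk>p \<in> A; q \<in> A; le (F p) z; le z (F q)\<rbrakk> \<Longrightarrow> z \<in> F ` A"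
begin

definition label :: "'a \<Rightarrow> 'a \<Rightarrow> 'w" where
  "label y x = inv (F x) \<otimes> F y"

lemma F_carrier [simp]: "p \<in> A \<Longrightarrow> F p \<in> carrier W"
  using F_closed by blast

lemma F_eq_iff: "p \<in> A \<Longrightarrow> q \<in> A \<Longrightarrow> F p = F q \<longleftrightarrow> p = q"
  using F_inj by (rule inj_on_eq_iff)

lemma partial_order: "partial_order_on A r"
proof -
  have "antisym r"
    using le_antisym F_eq_iff by (intro antisymI) (auto simp: r_iff)
  moreover have "trans r"
    using le_trans by (intro transI) (auto simp: r_iff)
  ultimately show ?thesis
    by (auto simp: partial_order_on_def preorder_on_def refl_on_def r_iff)
qed

lemma le_path_exists:
  assumes "le x y"
  obtains ts where "ts \<in> paths x y"
proof -
  obtain lt where "reflection_order lt"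
    using reflection_order_exists by blast
  from unique_increasing_path[OF assms this] show ?thesis
    using that unfolding increasing_paths_def by blast
qed

text \<open>On a path from \<open>F x\<close> to \<open>F y\<close> the vertex after
  \<open>F x\<close> lies in the image by convexity. A cover relation leaves no room for a further
  vertex, so the path is a single step.\<close>

lemma covers_iff:
  "covers r y x \<longleftrightarrow> x \<in> A \<and> y \<in> A \<and> label y x \<in> reflections \<and> h (F y) = h (F x) + 1"
proof
  assume cov: "covers r y x"
  then have xy: "x \<in> A" "y \<in> A" "le (F x) (F y)" "x \<noteq> y"
    by (auto simp: covers_def r_iff)
  obtain ts where ts: "path (F x) ts" "endpoint (F x) ts = F y"
    using le_path_exists[OF xy(3)] by (auto simp: paths_def)
  then obtain t us where t: "ts = t # us"
    using xy F_eq_iff[of x y] by (cases ts) auto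
  let ?z = "F x \<otimes> t"
  have z: "t \<in> reflections" "h ?z = h (F x) + 1" "path ?z us" "endpoint ?z us = F y"
    using ts by (auto simp: t)
  then have "edge (F x) ?z"
    using xy by (auto simp: edge_def)
  then have le: "le (F x) ?z" "le ?z (F y)"
    using edge_le path_le[OF z(3)] z(4) by auto
  then obtain w where w: "w \<in> A" "?z = F w"
    using F_convex xy by blast
  then have "w \<in> closed_interval r x y"
    using le xy by (simp add: closed_interval_def r_iff)
  then have "y = w"
    using cov z(2) w by (auto simp: covers_def)
  then have Fy: "F y = ?z"
    using w(2) by simp
  then have "label y x = t"
    unfolding label_def Fy using xy(1) z(1) by simp
  then show "x \<in> A \<and> y \<in> A \<and> label y x \<in> reflections \<and> h (F y) = h (F x) + 1"
    using xy z(1,2) unfolding Fy by simp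
next
  assume *: "x \<in> A \<and> y \<in> A \<and> label y x \<in> reflections \<and> h (F y) = h (F x) + 1"
  then have "edge (F x) (F y)"
    unfolding edge_def by (intro conjI bexI[of _ "label y x"]) (simp_all add: label_def)
  then have le: "le (F x) (F y)"
    by (rule edge_le)
  have "z = x \<or> z = y" if "(x, z) \<in> r" "(z, y) \<in> r" for z
    using that * le_height[of "F x" "F z"] le_height[of "F z" "F y"] F_eq_iff by (auto simp: r_iff)
  then show "covers r y x"
    unfolding covers_def closed_interval_def using * le by (auto simp: r_iff)
qed

lemma covers_label: "covers r y x \<Longrightarrow> F x \<otimes> label y x = F y"
  by (simp add: covers_iff label_def)

lemma chain_labels_Cons2: "chain_labels f (y # x # ws) = f y x # chain_labels f (x # ws)"
  by (simp add: chain_labels_def)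

lemma maximal_chain_Cons2:
  "maximal_chain r x y (y' # z # ws) \<longleftrightarrow> y' = y \<and> covers r y z \<and> maximal_chain r x z (z # ws)"
  by (auto simp: maximal_chain_def)

lemma maximal_chain_cases:
  assumes "maximal_chain r x y ws"
  obtains "ws = [y]" "x = y" | z vs where "ws = y # z # vs" "covers r y z" "maximal_chain r x z (z # vs)"
proof (cases ws)
  case Nil
  then show ?thesis
    using assms by (simp add: maximal_chain_def)
next
  case (Cons y' us)
  show ?thesis
  proof (cases us)
    case Nil
    then show ?thesis
      using assms Cons that(1) by (auto simp: maximal_chain_def)
  next
    case (Cons z vs)
    then show ?thesis
      using assms \<open>ws = y' # us\<close> that(2) by (simp add: maximal_chain_Cons2)
  qed
qed

text \<open>Chains are listed downwards and paths upwards, hence the reversal.\<close>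

lemma maximal_chain_path:
  assumes "maximal_chain r x y ws" "x \<in> A"
  shows "rev (chain_labels label ws) \<in> paths (F x) (F y)"
  using assms(1)
proof (induction ws arbitrary: y)
  case (Cons y' ws)
  show ?case
    using Cons.prems
  proof (cases rule: maximal_chain_cases)
    case 1
    then show ?thesis
      using assms(2) by (simp add: chain_labels_def paths_def)
  next
    case (2 z vs)
    then have "rev (chain_labels label (z # vs)) \<in> paths (F x) (F z)"
      using Cons.IH by simp
    then show ?thesis
      using 2 covers_label[OF 2(2)]
      by (auto simp: chain_labels_Cons2 paths_def path_append covers_iff)
  qed
qed (simp add: maximal_chain_def)

lemma maximal_chain_inj:
  assumes "maximal_chain r x y ws" "maximal_chain r x' y ws'"
    and "chain_labels label ws = chain_labels label ws'"
  shows "ws = ws'"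
  using assms
proof (induction ws arbitrary: y ws')
  case (Cons y' ws)
  show ?case
    using Cons.prems(1)
  proof (cases rule: maximal_chain_cases)
    case 1
    then have nil: "chain_labels label ws' = []"
      using Cons.prems(3) by (simp add: chain_labels_def)
    show ?thesis
      using Cons.prems(2)
    proof (cases rule: maximal_chain_cases)
      case 1
      then show ?thesis
        using \<open>y' # ws = [y]\<close> by simp
    next
      case (2 z vs)
      then show ?thesis
        using nil by (simp add: chain_labels_Cons2)
    qed
  next
    case c: (2 z vs)
    show ?thesis
      using Cons.prems(2)
    proof (cases rule: maximal_chain_cases)
      case 1
      then show ?thesis
        using Cons.prems(3) c by (simp add: chain_labels_Cons2) (simp add: chain_labels_def)
    next
      case (2 z' vs')
      have eq: "label y z = label y z'" "chain_labels label (z # vs) = chain_labels label (z' # vs')"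
        using Cons.prems(3) c 2 by (simp_all add: chain_labels_Cons2)
      have A: "z \<in> A" "z' \<in> A" "y \<in> A"
        using c 2 by (simp_all add: covers_iff)
      then have "inv (F z) = inv (F z')"
        using eq(1) by (simp add: label_def)
      then have "inv (inv (F z)) = inv (inv (F z'))"
        by (rule arg_cong)
      then have "F z = F z'"
        using A by simp
      then have "z = z'"
        using F_eq_iff A by simp
      then show ?thesis
        using Cons.IH[of z "z' # vs'"] c 2 eq(2) by simp
    qed
  qed
qed (simp add: maximal_chain_def)

lemma path_maximal_chain:
  assumes "ts \<in> paths (F x) (F y)" "x \<in> A" "y \<in> A"
  shows "\<exists>ws. maximal_chain r x y ws \<and> chain_labels label ws = rev ts"
  using assms(1,3)
proof (induction ts arbitrary: y rule: rev_induct)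
  case Nil
  then show ?case
    using F_eq_iff assms(2) by (intro exI[of _ "[x]"]) (auto simp: paths_def maximal_chain_def chain_labels_def)
next
  case (snoc t ts)
  define z where "z = endpoint (F x) ts"
  have z: "path (F x) ts" "t \<in> reflections" "h (z \<otimes> t) = h z + 1" "z \<otimes> t = F y" "z \<in> carrier W"
    using snoc.prems endpoint_closed by (auto simp: paths_def path_append z_def)
  then have "edge z (F y)"
    unfolding edge_def by (intro conjI bexI[of _ t]) simp_all
  then obtain w where w: "w \<in> A" "z = F w"
    using F_convex[OF assms(2) snoc.prems(2)] path_le[OF z(1)] edge_le z_def by blast
  then have "ts \<in> paths (F x) (F w)"
    using z(1) by (simp add: paths_def z_def)
  then obtain ws where ws: "maximal_chain r x w ws" "chain_labels label ws = rev ts"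
    using snoc.IH w by blast
  then obtain vs where vs: "ws = w # vs"
    by (cases ws) (auto simp: maximal_chain_def)
  have lab: "label y w = t"
    unfolding label_def using z w by (simp flip: z(4))
  then have "covers r y w"
    using w snoc.prems(2) z by (simp add: covers_iff)
  then show ?case
    using ws lab by (intro exI[of _ "y # ws"]) (simp add: vs maximal_chain_Cons2 chain_labels_Cons2)
qed

lemma length_chain_labels: "length (chain_labels f ws) = chain_length ws"
  by (simp add: chain_labels_def chain_length_def)

lemma maximal_chain_length:
  assumes "maximal_chain r x y ws" "x \<in> A"
  shows "h (F y) = h (F x) + int (chain_length ws)"
  using maximal_chain_path[OF assms] path_height[of "F x" "rev (chain_labels label ws)"]
  by (auto simp: paths_def length_chain_labels)

lemma pure: "pure_poset A r"
proof -
  have "\<exists>ws. maximal_chain r x y ws" if "(x, y) \<in> r" for x y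
    using that le_path_exists[of "F x" "F y"] path_maximal_chain unfolding r_iff by metis
  moreover have "chain_length ws = chain_length ws'"
    if "(x, y) \<in> r" "maximal_chain r x y ws" "maximal_chain r x y ws'" for x y ws ws'
    using that maximal_chain_length[of x y ws] maximal_chain_length[of x y ws'] by (simp add: r_iff)
  ultimately show ?thesis
    unfolding pure_poset_def using partial_order by blast
qed

text \<open>The two labels of such a path differ, so it is increasing or decreasing, and there is
  exactly one path of each kind. They give exactly two elements of intermediate height.\<close>

lemma interval_two:
  assumes le: "le x y" and h: "h y = h x + 2"
  shows "card {z. le x z \<and> le z y} = 4"
proof -
  obtain lt where lt: "reflection_order lt"
    using reflection_order_exists by blast
  note D = reflection_orderD[OF lt]
  have gt: "reflection_order (\<lambda>a b. lt b a)"
    using reflection_order_converse[OF lt] .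
  have two: "\<exists>a b. ts = [a, b]" if "ts \<in> paths x y" for ts
  proof -
    have "length ts = 2"
      using that h path_height[of x ts] by (simp add: paths_def)
    then show ?thesis
      by (auto simp: numeral_2_eq_2 length_Suc_conv)
  qed
  obtain ts us where ts: "ts \<in> increasing_paths lt x y" and us: "us \<in> increasing_paths (\<lambda>a b. lt b a) x y"
    using unique_increasing_path[OF le lt] unique_increasing_path[OF le gt] by blast
  then obtain a b a' b' where ab: "ts = [a, b]" "us = [a', b']"
    using two unfolding increasing_paths_def by blast
  have P: "[a, b] \<in> paths x y" "[a', b'] \<in> paths x y" "lt a b" "lt b' a'"
    using ts us by (auto simp: increasing_paths_def ab)
  then have c: "x \<in> carrier W" "a \<in> reflections" "b \<in> reflections" "a' \<in> reflections" "b' \<in> reflections"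
    and hx: "h (x \<otimes> a) = h x + 1" "h (x \<otimes> a') = h x + 1" and y: "y = x \<otimes> a \<otimes> b" "y = x \<otimes> a' \<otimes> b'"
    by (auto simp: paths_two_iff)
  have paths: "[c, d] = [a, b] \<or> [c, d] = [a', b']" if cd: "[c, d] \<in> paths x y" for c d
  proof -
    have "c \<in> reflections" "d \<in> reflections" "c \<noteq> d"
      using cd by (auto simp: paths_two_iff)
    then have "lt c d \<or> lt d c"
      using D(3) by blast
    then have "[c, d] \<in> increasing_paths lt x y \<or> [c, d] \<in> increasing_paths (\<lambda>a b. lt b a) x y"
      using cd by (auto simp: increasing_paths_def)
    then show ?thesis
      using unique_increasing_path[OF le lt] unique_increasing_path[OF le gt] ts us ab by metis
  qed
  have "a \<noteq> a'"
  proof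
    assume "a = a'"
    then have "b = b'"
      using y c by simp
    then show False
      using P(3,4) \<open>a = a'\<close> D(1,2)[OF c(2,3,2)] by blast
  qed
  then have ne: "x \<otimes> a \<noteq> x \<otimes> a'"
    using c by simp
  have "{z. le x z \<and> le z y} = {x, x \<otimes> a, x \<otimes> a', y}"
  proof (rule equalityI[OF subsetI subsetI])
    fix z assume "z \<in> {z. le x z \<and> le z y}"
    then have z: "le x z" "le z y"
      by auto
    show "z \<in> {x, x \<otimes> a, x \<otimes> a', y}"
    proof (cases "z = x \<or> z = y")
      case False
      then have "h x < h z" "h z < h y"
        using le_height z by blast+
      obtain ps where ps: "ps \<in> paths x z"
        using le_path_exists[OF z(1)] .
      obtain qs where qs: "qs \<in> paths z y"
        using le_path_exists[OF z(2)] .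
      have "h z = h x + int (length ps)"
        using ps path_height[of x ps] by (simp add: paths_def)
      then have "length ps = 1"
        using h \<open>h x < h z\<close> \<open>h z < h y\<close> by linarith
      then obtain c' where c': "ps = [c']"
        by (auto simp: length_Suc_conv)
      have "ps @ qs \<in> paths x y"
        using ps qs by (auto simp: paths_def path_append)
      then obtain c'' d where "ps @ qs = [c'', d]"
        using two by blast
      then have "[c', d] \<in> paths x y"
        using \<open>ps @ qs \<in> paths x y\<close> c' by simp
      then have "c' = a \<or> c' = a'"
        using paths by blast
      moreover have "z = x \<otimes> c'"
        using ps c' by (simp add: paths_def)
      ultimately show ?thesis
        by blast
    qed auto
  next
    fix z assume "z \<in> {x, x \<otimes> a, x \<otimes> a', y}"
    moreover have "le x (x \<otimes> a)" "le x (x \<otimes> a')"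
      using path_le[of x "[a]"] path_le[of x "[a']"] P(1,2) by (simp_all add: paths_def)
    moreover have "le (x \<otimes> a) y" "le (x \<otimes> a') y"
      using path_le[of "x \<otimes> a" "[b]"] path_le[of "x \<otimes> a'" "[b']"] P(1,2) h le_closed(2)[OF le]
      by (auto simp: paths_def)
    moreover have "le y y" "le x x"
      using le_closed[OF le] by simp_all
    ultimately show "z \<in> {z. le x z \<and> le z y}"
      using le by blast
  qed
  moreover have "x \<noteq> x \<otimes> a" "x \<noteq> x \<otimes> a'" "x \<noteq> y" "x \<otimes> a \<noteq> y" "x \<otimes> a' \<noteq> y"
    using hx h by auto
  ultimately show ?thesis
    using ne by simp
qed

theorem thin: "thin_poset A r"
proof -
  have "card (closed_interval r x y) = 4"
    if xy: "(x, y) \<in> r" and ws: "maximal_chain r x y ws" "chain_length ws = 2" for x y ws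
  proof -
    have *: "x \<in> A" "y \<in> A" "le (F x) (F y)"
      using xy by (auto simp: r_iff)
    have "F ` closed_interval r x y = {z. le (F x) z \<and> le z (F y)}"
      using F_convex[OF *(1,2)] * by (auto simp: closed_interval_def r_iff)
    moreover have "inj_on F (closed_interval r x y)"
      by (rule inj_on_subset[OF F_inj]) (auto simp: closed_interval_def r_iff)
    ultimately have "card (closed_interval r x y) = card {z. le (F x) z \<and> le z (F y)}"
      using card_image by metis
    then show ?thesis
      using interval_two[OF *(3)] maximal_chain_length[OF ws(1) *(1)] ws(2) by simp
  qed
  then show ?thesis
    unfolding thin_poset_def using pure by blast
qed

lemma lex_map:
  assumes "(xs, ys) \<in> lex R" "\<And>a b. (a, b) \<in> R \<Longrightarrow> a \<in> set xs \<Longrightarrow> b \<in> set ys \<Longrightarrow> (g a, g b) \<in> R'"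
  shows "(map g xs, map g ys) \<in> lex R'"
proof -
  obtain zs a as b bs where *: "length xs = length ys" "xs = zs @ a # as" "ys = zs @ b # bs" "(a, b) \<in> R"
    using assms(1) by (auto simp: lex_conv)
  then have "(g a, g b) \<in> R'"
    using assms(2) by simp
  then show ?thesis
    using * lex_append_leftI[of "map g (a # as)" "map g (b # bs)" R' "map g zs"] by simp
qed

text \<open>
  The labels are reflections. To obtain labels in \<open>'a \<times> 'a\<close>, each reflection that occurs is replaced
  by some cover relation that it labels.
\<close>

theorem shellable: "EL_shellable A r"
proof -
  obtain lt where lt: "reflection_order lt"
    using reflection_order_exists by blast
  note D = reflection_orderD[OF lt]
  have gt: "reflection_order (\<lambda>a b. lt b a)"
    using reflection_order_converse[OF lt] .
  define T where "T = {label y x | y x. covers r y x}"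
  define rep where "rep t = (SOME p. covers r (fst p) (snd p) \<and> label (fst p) (snd p) = t)" for t
  define d where "d = (\<lambda>(y, x). label y x)"
  have d_rep: "d (rep t) = t" if "t \<in> T" for t
  proof -
    have "\<exists>p. covers r (fst p) (snd p) \<and> label (fst p) (snd p) = t"
      using that by (auto simp: T_def)
    from someI_ex[OF this] show ?thesis
      unfolding rep_def d_def by (simp add: case_prod_beta)
  qed
  have T_refl: "t \<in> reflections" if "t \<in> T" for t
    using that by (auto simp: T_def covers_iff)
  define f where "f y x = rep (label y x)" for y x
  define L where "L = rep ` T"
  define rL where "rL = {(k, l). k \<in> L \<and> l \<in> L \<and> (k = l \<or> lt (d k) (d l))}"
  have L: "d k \<in> T" "rep (d k) = k" if "k \<in> L" for k
    using that d_rep by (auto simp: L_def)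
  have "partial_order_on L rL"
  proof -
    have "antisym rL"
    proof (rule antisymI)
      fix k l assume "(k, l) \<in> rL" "(l, k) \<in> rL"
      then show "k = l"
        using D(1,2)[of "d k" "d l" "d k"] L T_refl by (auto simp: rL_def)
    qed
    moreover have "trans rL"
    proof (rule transI)
      fix k l n assume "(k, l) \<in> rL" "(l, n) \<in> rL"
      then show "(k, n) \<in> rL"
        using D(2)[of "d k" "d l" "d n"] L T_refl by (auto simp: rL_def)
    qed
    ultimately show ?thesis
      by (auto simp: partial_order_on_def preorder_on_def refl_on_def rL_def)
  qed
  moreover have "edge_labeling r L f"
    by (auto simp: edge_labeling_def f_def L_def T_def)
  moreover have labels: "chain_labels f ws = map rep (chain_labels label ws)" for ws
    by (simp add: chain_labels_def f_def case_prod_beta)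
  have labels_T: "set (chain_labels label ws) \<subseteq> T" if "maximal_chain r x y ws" for x y ws
    using that
  proof (induction ws arbitrary: y)
    case (Cons y' ws)
    show ?case
      using Cons.prems
    proof (cases rule: maximal_chain_cases)
      case (2 z vs)
      then show ?thesis
        using Cons.IH[of z] by (auto simp: chain_labels_Cons2 T_def)
    qed (simp add: chain_labels_def)
  qed (simp add: chain_labels_def)
  \<comment> \<open>Increasing means weakly increasing in \<open>rL\<close>, but consecutive labels
    on a path differ, so the chain is strictly increasing for \<open>lt\<close>.\<close>
  have decreasing: "increasing_chain rL f ws \<longleftrightarrow> sorted_wrt (\<lambda>a b. lt b a) (rev (chain_labels label ws))"
    if ws: "maximal_chain r x y ws" "x \<in> A" for x y ws
  proof -
    let ?ts = "chain_labels label ws"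
    have path: "path (F x) (rev ?ts)"
      using maximal_chain_path[OF ws] by (simp add: paths_def)
    have T: "set ?ts \<subseteq> T"
      using labels_T ws by blast
    have neq: "successively (\<noteq>) ?ts"
      using path_successively_neq[OF path] unfolding successively_rev by (rule successively_mono) auto
    have "increasing_chain rL f ws \<longleftrightarrow> successively (\<lambda>a b. (rep a, rep b) \<in> rL) ?ts"
      by (simp add: increasing_chain_def labels successively_map)
    also have "\<dots> \<longleftrightarrow> successively lt ?ts"
    proof -
      have *: "(rep a, rep b) \<in> rL \<longleftrightarrow> a = b \<or> lt a b" if "a \<in> T" "b \<in> T" for a b
      proof -
        have "rep a = rep b \<longleftrightarrow> a = b"
          using d_rep[OF that(1)] d_rep[OF that(2)] by metis
        then show ?thesis
          using that d_rep by (simp add: rL_def L_def)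
      qed
      have "(rep (?ts ! n), rep (?ts ! Suc n)) \<in> rL \<longleftrightarrow> lt (?ts ! n) (?ts ! Suc n)" if "Suc n < length ?ts" for n
      proof -
        have "?ts ! n \<in> T" "?ts ! Suc n \<in> T"
          using T that by (meson Suc_lessD nth_mem subsetD)+
        then show ?thesis
          using * successively_nth[OF neq that] by simp
      qed
      then show ?thesis
        unfolding successively_conv_nth by blast
    qed
    also have "\<dots> \<longleftrightarrow> sorted_wrt lt ?ts"
      using D(2) T T_refl by (intro successively_iff_sorted_wrt_strong) blast
    finally show ?thesis
      by (simp add: sorted_wrt_rev)
  qed
  have "\<exists>ws. maximal_chain r x y ws \<and> increasing_chain rL f ws \<and>
      (\<forall>ws'. maximal_chain r x y ws' \<and> ws' \<noteq> ws \<longrightarrow> \<not> increasing_chain rL f ws' \<and>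
        (chain_labels f ws, chain_labels f ws') \<in> lex (rL - Id))"
    if xy: "(x, y) \<in> r" for x y
  proof -
    have *: "x \<in> A" "y \<in> A" "le (F x) (F y)"
      using xy by (auto simp: r_iff)
    obtain ts where ts: "ts \<in> increasing_paths (\<lambda>a b. lt b a) (F x) (F y)"
      and unique: "\<And>us. us \<in> increasing_paths (\<lambda>a b. lt b a) (F x) (F y) \<Longrightarrow> us = ts"
      using unique_increasing_path[OF *(3) gt] by blast
    obtain ws where ws: "maximal_chain r x y ws" "chain_labels label ws = rev ts"
      using path_maximal_chain[of ts x y] ts * by (auto simp: increasing_paths_def)
    have "increasing_chain rL f ws"
      using decreasing[OF ws(1) *(1)] ts ws(2) by (simp add: increasing_paths_def)
    moreover have "\<not> increasing_chain rL f ws' \<and> (chain_labels f ws, chain_labels f ws') \<in> lex (rL - Id)"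
      if ws': "maximal_chain r x y ws'" "ws' \<noteq> ws" for ws'
    proof -
      define us where "us = rev (chain_labels label ws')"
      have us: "us \<in> paths (F x) (F y)"
        unfolding us_def using maximal_chain_path[OF ws'(1) *(1)] .
      have "us \<noteq> ts"
        using maximal_chain_inj[OF ws'(1) ws(1)] ws'(2) ws(2) by (auto simp: us_def)
      then have "\<not> increasing_chain rL f ws'"
        using decreasing[OF ws'(1) *(1)] unique[of us] us by (auto simp: us_def increasing_paths_def)
      moreover have "(map rep (rev ts), map rep (rev us)) \<in> lex (rL - Id)"
      proof (rule lex_map[OF decreasing_path_lex_first[OF lt ts us \<open>us \<noteq> ts\<close>]])
        fix a b assume ab: "(a, b) \<in> {(a, b). a \<in> reflections \<and> b \<in> reflections \<and> lt a b}"
          and "a \<in> set (rev ts)" "b \<in> set (rev us)"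
        then have T: "a \<in> T" "b \<in> T"
          using labels_T[OF ws(1)] labels_T[OF ws'(1)] ws(2) by (auto simp: us_def)
        have "a \<noteq> b"
          using ab D(1) by blast
        then have "rep a \<noteq> rep b"
          using d_rep T by metis
        then show "(rep a, rep b) \<in> rL - Id"
          using ab T d_rep by (simp add: rL_def L_def)
      qed
      ultimately show ?thesis
        using ws(2) by (simp add: labels us_def)
    qed
    ultimately show ?thesis
      using ws(1) by blast
  qed
  ultimately have "EL_labeling A r L rL f"
    unfolding EL_labeling_def using pure by blast
  then show ?thesis
    unfolding EL_shellable_def by blast
qed

end

theorem theorem1p2:
  fixes W :: "('w, 'b) monoid_scheme" (structure)
    and I :: "'i set" and m :: "'i \<Rightarrow> 'i \<Rightarrow> enat" and s :: "'i \<Rightarrow> 'w" and K :: "'i set"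
  assumes "coxeter_system W I m s" and "K \<subseteq> I"
  shows "thin_poset (coxeter_system.Q W I s K) (coxeter_system.Q_order W I s K) \<and>
         EL_shellable (coxeter_system.Q W I s K) (coxeter_system.Q_order W I s K)"
proof -
  interpret W: coxeter_system W I m s
    by fact
  obtain V :: "('i + 'i) list set monoid" and S
    where V: "coxeter_system V (Inl ` I \<union> Inr ` (I - K)) (double_matrix K m) S"
    using coxeter_system_exists[OF coxeter_matrix_double[OF W.matrix assms(2)]] by blast
  interpret coxeter_double W I m s K V S
    by (intro coxeter_double.intro coxeter_parabolic.intro coxeter_parabolic_axioms.intro assms V) auto
  interpret coxeter_height_subposet V "Inl ` I \<union> Inr ` (I - K)" "double_matrix K m" S V.twisted_height
    V.coset_len "W.Q K" "W.Q_order K" embed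
  proof
    show "inj_on embed (W.Q K)"
      by (rule embed_inj)
    show "embed ` W.Q K \<subseteq> carrier V"
      using embed_closed by blast
    show "(p, q) \<in> W.Q_order K \<longleftrightarrow> p \<in> W.Q K \<and> q \<in> W.Q K \<and> V.twisted.le (embed p) (embed q)" for p q
      by (rule Q_order_iff)
    show "z \<in> embed ` W.Q K"
      if "p \<in> W.Q K" "q \<in> W.Q K" "V.twisted.le (embed p) z" "V.twisted.le z (embed q)" for p q z
      using embed_convex that .
  qed
  show ?thesis
    using thin shellable by blast
qed

end
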